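(* If $p$ is any complex polynomial of degree $n$, not necessarily monic, and $K$ is any compact subset of the plane $\mathbb{C}$, then \[ \rho\left(p^{-1}(K)\right) \le \rho(K)^{1/n}. \]
   Context: For a compact set $K \subset \mathbb{C}$, the roundness of $K$ is \[ \rho(K) = \frac{\mathrm{Area}(K)}{\pi\, \mathrm{cap}(K)^2}, \] where $\mathrm{Area}$ denotes two-dimensional Lebesgue measure and $\mathrm{cap}(K)$ is the logarithmic capacity of $K$, defined as follows. A Green's function for a compact set $K$ is a continuous function $f : \mathbb{C} \to \mathbb{R}$, zero on $K$ and harmonic on $\mathbb{C} \setminus K$, with $f(z) = \log|z| - \log t + o(1)$ as $z \to \infty$. If $K$ has a Green's function, then $\mathrm{cap}(K) = t$. For general compact $K$, $\mathrm{cap}(K) = \inf \mathrm{cap}(J)$ over all compact sets $J \supset K$ with regular boundary for the Dirichlet problem on $\mathbb{C} \setminus J$. *)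

theory Defs
  imports "HOL-Analysis.Analysis" "HOL-Computational_Algebra.Polynomial"
begin

(* u is twice continuously differentiable on the open set U, with u_xx + u_yy = 0 there. *)
definition harmonic_on :: "(complex \<Rightarrow> real) \<Rightarrow> complex set \<Rightarrow> bool" where
  "harmonic_on u U \<longleftrightarrow> open U \<and>
     (\<exists>ux uy uxx uxy uyx uyy :: complex \<Rightarrow> real.
        (\<forall>z\<in>U.
           (u has_derivative (\<lambda>h. ux z * Re h + uy z * Im h)) (at z) \<and>
           (ux has_derivative (\<lambda>h. uxx z * Re h + uxy z * Im h)) (at z) \<and>
           (uy has_derivative (\<lambda>h. uyx z * Re h + uyy z * Im h)) (at z) \<and>
           uxx z + uyy z = 0) \<and>
        continuous_on U uxx \<and> continuous_on U uxy \<and>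
        continuous_on U uyx \<and> continuous_on U uyy)"

definition greens_function :: "(complex \<Rightarrow> real) \<Rightarrow> complex set \<Rightarrow> real \<Rightarrow> bool" where
  "greens_function f K t \<longleftrightarrow>
     t > 0 \<and> continuous_on UNIV f \<and> (\<forall>z\<in>K. f z = 0) \<and> harmonic_on f (- K) \<and>
     ((\<lambda>z. f z - (ln (norm z) - ln t)) \<longlongrightarrow> 0) at_infinity"

(* The complement of J is unbounded when J is compact, so solutions are required to be
   bounded, as usual for the Dirichlet problem on an unbounded open set. *)
definition dirichlet_regular :: "complex set \<Rightarrow> bool" where
  "dirichlet_regular J \<longleftrightarrow>
     (\<forall>\<phi> :: complex \<Rightarrow> real. continuous_on (frontier J) \<phi> \<longrightarrow>
        (\<exists>h. continuous_on (closure (- J)) h \<and> bounded (h ` (- J)) \<and>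
             harmonic_on h (- J) \<and> (\<forall>z\<in>frontier J. h z = \<phi> z)))"

(* By the maximum principle a compact set admits a Green's function for at most one t.
   In the infimum, J ranges over the regular sets that have a Green's function: the empty set
   and singletons trivially satisfy dirichlet_regular but have none. *)
definition log_capacity :: "complex set \<Rightarrow> real" where
  "log_capacity K =
     (if \<exists>f t. greens_function f K t then THE t. \<exists>f. greens_function f K t
      else Inf {t. \<exists>J f. compact J \<and> K \<subseteq> J \<and> dirichlet_regular J \<and> greens_function f J t})"

(* If log_capacity K = 0, the quotient takes the value 0, by the convention x / 0 = 0. *)
definition roundness :: "complex set \<Rightarrow> real" where
  "roundness K = measure lebesgue K / (pi * (log_capacity K)\<^sup>2)"

end

(* The capacity of the preimage is computed by pulling back Green's functions: if g is a Green's
   function of K then (g o p) / n is one of p^-1(K), which gives cap(p^-1 K)^n = cap(K) / |a| for the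
   leading coefficient a. When K has no Green's function, the infimum defining its capacity forces us
   to find, between K and the complement of p {f >= d}, where f is a Green's function of a
   neighbourhood of p^-1(K), a regular set: a finite union of discs, whose exterior Dirichlet problem
   is solved by Perron's method.

   It remains to show |a|^2 pi (Area(p^-1 K) / pi)^n <= Area(K) (Crane). As p is n-to-one, n Area(K)
   bounds the integral of |p'|^2 over E = p^-1(K). Among sets of given area this integral is
   smallest on sublevel sets of |p'|, whose areas are controlled by Polya's inequality
   Area <= pi cap^2. The latter follows from the Ahlfors-Beurling bound |F| <= sqrt (pi Area(E)) for
   the Cauchy transform F of E: apply the maximum principle to ln |F| + g off E, where g is a Green's
   function. *)
theory Submission
  imports Defs "HOL-Complex_Analysis.Complex_Analysis"
    "HOL-Computational_Algebra.Fundamental_Theorem_Algebra" "HOL-Real_Asymp.Real_Asymp"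
begin

subsection \<open>Harmonic functions and the maximum principle\<close>

text \<open>The direction \<open>cap K \<le> |a| * cap (p^-1 K) ^ n\<close> is the one that matters,
  since \<open>cap K\<close> stands in the denominator of the bound. A set competing for the
  capacity of p^-1(K) is in general not a preimage, so the pull-back cannot simply be reversed; this
  forces the detour through sublevel sets of its Green's function. When p^-1(K) has positive area,
  \<open>cap K = 0\<close> must be excluded, because x / 0 = 0 would make the right-hand side 0. The
  inequality Area \<le> pi cap^2 does this as well. The constant in Crane's inequality comes from
  the leading coefficient n a of p': the integral of |p'|^2 over a set of area A is at least |n a|^2
  pi (A / pi)^n / n, and the factor n that remains cancels against the multiplicity n. Harmonicity
  is defined by second derivatives, whereas composition with p asks for local real parts of
  holomorphic functions. The bridge is the Dirichlet problem on a disc: real parts of polynomials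
  are dense in the continuous functions on the circle, and the maximum principle carries their
  uniform convergence inside.\<close>

lemma second_derivative_local_max:
  fixes f g :: "real \<Rightarrow> real"
  assumes "d > 0" and f: "\<And>x. \<bar>x\<bar> < d \<Longrightarrow> (f has_real_derivative g x) (at x)"
    and g: "(g has_real_derivative L) (at 0)"
    and max: "\<And>x. \<bar>x\<bar> < d \<Longrightarrow> f x \<le> f 0"
  shows "L \<le> 0"
proof (rule ccontr)
  assume "\<not> L \<le> 0"
  have "g 0 = 0"
    using DERIV_local_max[of f "g 0" 0 d] f[of 0] max \<open>d > 0\<close> by auto
  \<comment> \<open>Since g vanishes at 0 with positive slope, the derivative of f is positive just
    to the right of 0, so f rises above its maximum.\<close>
  moreover obtain e where e: "e > 0" "\<And>h. 0 < h \<Longrightarrow> h < e \<Longrightarrow> g 0 < g h"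
    using DERIV_pos_inc_right[OF g] \<open>\<not> L \<le> 0\<close> by auto
  define h where "h = min d e / 2"
  have h: "0 < h" "h < d" "h < e" using e \<open>d > 0\<close> by (auto simp: h_def min_def)
  have "f 0 < f h"
  proof (rule DERIV_pos_imp_increasing_open[OF h(1)])
    show "\<exists>y. DERIV f x :> y \<and> y > 0" if "0 < x" "x < h" for x
      using f[of x] e(2)[of x] that h \<open>g 0 = 0\<close> by (intro exI[of _ "g x"]) auto
    show "continuous_on {0..h} f"
      using DERIV_isCont[OF f] h by (intro continuous_at_imp_continuous_on ballI) auto
  qed
  with max[of h] h show False by auto
qed

lemma has_real_derivative_along_line:
  fixes u :: "complex \<Rightarrow> real"
  assumes "(u has_derivative L) (at (a + of_real x * e))"
  shows "((\<lambda>x. u (a + of_real x * e)) has_real_derivative L e) (at x)"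
proof -
  have l: "((\<lambda>x. a + of_real x * e) has_derivative (\<lambda>h. of_real h * e)) (at x)"
    by (auto intro!: derivative_eq_intros)
  have "((\<lambda>x. u (a + of_real x * e)) has_derivative (\<lambda>h. L (of_real h * e))) (at x)"
    by (rule has_derivative_compose[OF l assms])
  moreover have "L (of_real h * e) = L e * h" for h
    using linear_scale[OF has_derivative_linear[OF assms], of h e] by (simp add: scaleR_conv_of_real)
  ultimately show ?thesis by (simp add: has_field_derivative_def)
qed

lemma harmonic_onE:
  assumes "harmonic_on u U"
  obtains ux uy uxx uxy uyx uyy where "open U"
    "\<And>z. z \<in> U \<Longrightarrow> (u has_derivative (\<lambda>h. ux z * Re h + uy z * Im h)) (at z)"
    "\<And>z. z \<in> U \<Longrightarrow> (ux has_derivative (\<lambda>h. uxx z * Re h + uxy z * Im h)) (at z)"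
    "\<And>z. z \<in> U \<Longrightarrow> (uy has_derivative (\<lambda>h. uyx z * Re h + uyy z * Im h)) (at z)"
    "\<And>z. z \<in> U \<Longrightarrow> uxx z + uyy z = 0"
    "continuous_on U uxx" "continuous_on U uxy" "continuous_on U uyx" "continuous_on U uyy"
proof -
  obtain ux uy uxx uxy uyx uyy where *: "\<forall>z\<in>U.
           (u has_derivative (\<lambda>h. ux z * Re h + uy z * Im h)) (at z) \<and>
           (ux has_derivative (\<lambda>h. uxx z * Re h + uxy z * Im h)) (at z) \<and>
           (uy has_derivative (\<lambda>h. uyx z * Re h + uyy z * Im h)) (at z) \<and>
           uxx z + uyy z = 0"
     "continuous_on U uxx" "continuous_on U uxy" "continuous_on U uyx" "continuous_on U uyy"
    using assms unfolding harmonic_on_def by (elim conjE exE) (rule that)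
  show ?thesis
    by (rule that[of ux uy uxx uxy uyx uyy]) (use assms * in \<open>auto simp: harmonic_on_def\<close>)
qed


lemma harmonic_onI:
  assumes "open U"
    "\<And>z. z \<in> U \<Longrightarrow> (u has_derivative (\<lambda>h. ux z * Re h + uy z * Im h)) (at z)"
    "\<And>z. z \<in> U \<Longrightarrow> (ux has_derivative (\<lambda>h. uxx z * Re h + uxy z * Im h)) (at z)"
    "\<And>z. z \<in> U \<Longrightarrow> (uy has_derivative (\<lambda>h. uyx z * Re h + uyy z * Im h)) (at z)"
    "\<And>z. z \<in> U \<Longrightarrow> uxx z + uyy z = 0"
    "continuous_on U uxx" "continuous_on U uxy" "continuous_on U uyx" "continuous_on U uyy"
  shows "harmonic_on u U"
  unfolding harmonic_on_def
  by (rule conjI[OF assms(1)], rule exI[of _ ux], rule exI[of _ uy], rule exI[of _ uxx],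
      rule exI[of _ uxy], rule exI[of _ uyx], rule exI[of _ uyy]) (use assms in simp)

text \<open>Adding \<epsilon> |z|^2 makes the Laplacian equal to 4 \<epsilon> > 0, so the second
  derivative test along the two axes rules out an interior maximum.\<close>

lemma harmonic_max_principle:
  assumes W: "bounded W" and cont: "continuous_on (closure W) u"
    and harm: "harmonic_on u W" and bd: "\<And>z. z \<in> frontier W \<Longrightarrow> u z \<le> B" and z: "z \<in> W"
  shows "u z \<le> B"
proof (rule ccontr)
  assume neg: "\<not> u z \<le> B"
  obtain ux uy uxx uxy uyx uyy where "open W" and D:
    "\<And>z. z \<in> W \<Longrightarrow> (u has_derivative (\<lambda>h. ux z * Re h + uy z * Im h)) (at z)"
    "\<And>z. z \<in> W \<Longrightarrow> (ux has_derivative (\<lambda>h. uxx z * Re h + uxy z * Im h)) (at z)"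
    "\<And>z. z \<in> W \<Longrightarrow> (uy has_derivative (\<lambda>h. uyx z * Re h + uyy z * Im h)) (at z)"
    "\<And>z. z \<in> W \<Longrightarrow> uxx z + uyy z = 0"
    "continuous_on W uxx" "continuous_on W uxy" "continuous_on W uyx" "continuous_on W uyy"
    using harm by (rule harmonic_onE) (rule that; assumption)
  obtain R where R: "R > 0" "\<And>z. z \<in> closure W \<Longrightarrow> norm z \<le> R"
    using W bounded_closure bounded_pos by metis
  \<comment> \<open>\<epsilon> R^2 is half the excess of u z over B, so the perturbation cannot push
    the maximum point of v onto the frontier.\<close>
  define \<epsilon> where "\<epsilon> = (u z - B) / (2 * R\<^sup>2)"
  have \<epsilon>: "\<epsilon> > 0" "\<epsilon> * R\<^sup>2 < u z - B" using neg R by (auto simp: \<epsilon>_def)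
  define v where "v = (\<lambda>z. u z + \<epsilon> * (norm z)\<^sup>2)"
  have "compact (closure W)" using W by (simp add: compact_closure)
  moreover have "continuous_on (closure W) v" unfolding v_def by (intro continuous_intros cont)
  ultimately obtain a where a: "a \<in> closure W" "\<And>w. w \<in> closure W \<Longrightarrow> v w \<le> v a"
    using continuous_attains_sup[of "closure W" v] z closure_subset by blast
  have "v z \<le> v a" using a z closure_subset by blast
  moreover have "u z \<le> v z" using \<epsilon> by (simp add: v_def)
  moreover have "\<epsilon> * (norm a)\<^sup>2 \<le> \<epsilon> * R\<^sup>2"
    using \<epsilon> R(2)[OF a(1)] by (intro mult_left_mono power_mono) auto
  ultimately have "u a > B" using \<epsilon>(2) by (simp add: v_def)
  then have "a \<notin> frontier W" using bd by force
  then have "a \<in> W" using a(1) \<open>open W\<close> by (simp add: frontier_def interior_open)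
  then obtain d where d: "d > 0" "ball a d \<subseteq> W" using \<open>open W\<close> openE by blast
  have m: "v w \<le> v a" if "w \<in> ball a d" for w using a(2) d closure_subset that by blast
  \<comment> \<open>The squared norm contributes 2 \<epsilon> along each axis. Facts
    \<open>1\<close> and \<open>2\<close> add up to
    \<open>uxx a + uyy a + 4 * \<epsilon> \<le> 0\<close>, against harmonicity.\<close>
  have 1: "uxx a + 2 * \<epsilon> \<le> 0"
  proof (rule second_derivative_local_max[OF d(1)])
    let ?l = "\<lambda>x. a + complex_of_real x * 1"
    show "((\<lambda>x. u (?l x) + \<epsilon> * ((Re a + x)\<^sup>2 + (Im a)\<^sup>2)) has_real_derivative
            ux (?l x) + 2 * \<epsilon> * (Re a + x)) (at x)" if "\<bar>x\<bar> < d" for x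
    proof -
      have "?l x \<in> W" using that d by (auto simp: dist_norm)
      from has_real_derivative_along_line[OF D(1)[OF this]]
      have "((\<lambda>x. u (?l x)) has_real_derivative ux (?l x)) (at x)" by simp
      then show ?thesis by (auto intro!: derivative_eq_intros simp: algebra_simps)
    qed
    have "(ux has_derivative (\<lambda>h. uxx a * Re h + uxy a * Im h)) (at (?l 0))"
      using D(2)[OF \<open>a \<in> W\<close>] by simp
    from has_real_derivative_along_line[OF this]
    have "((\<lambda>x. ux (?l x)) has_real_derivative uxx a) (at 0)" by simp
    then show "((\<lambda>x. ux (?l x) + 2 * \<epsilon> * (Re a + x)) has_real_derivative uxx a + 2 * \<epsilon>) (at 0)"
      by (auto intro!: derivative_eq_intros)
    show "u (?l x) + \<epsilon> * ((Re a + x)\<^sup>2 + (Im a)\<^sup>2) \<le> u (?l 0) + \<epsilon> * ((Re a + 0)\<^sup>2 + (Im a)\<^sup>2)"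
      if "\<bar>x\<bar> < d" for x
      using m[of "?l x"] that by (simp add: v_def cmod_power2 dist_norm)
  qed
  have 2: "uyy a + 2 * \<epsilon> \<le> 0"
  proof (rule second_derivative_local_max[OF d(1)])
    let ?l = "\<lambda>x. a + complex_of_real x * \<i>"
    show "((\<lambda>x. u (?l x) + \<epsilon> * ((Re a)\<^sup>2 + (Im a + x)\<^sup>2)) has_real_derivative
            uy (?l x) + 2 * \<epsilon> * (Im a + x)) (at x)" if "\<bar>x\<bar> < d" for x
    proof -
      have "?l x \<in> W" using that d by (auto simp: dist_norm norm_mult)
      from has_real_derivative_along_line[OF D(1)[OF this]]
      have "((\<lambda>x. u (?l x)) has_real_derivative uy (?l x)) (at x)" by simp
      then show ?thesis by (auto intro!: derivative_eq_intros simp: algebra_simps)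
    qed
    have "(uy has_derivative (\<lambda>h. uyx a * Re h + uyy a * Im h)) (at (?l 0))"
      using D(3)[OF \<open>a \<in> W\<close>] by simp
    from has_real_derivative_along_line[OF this]
    have "((\<lambda>x. uy (?l x)) has_real_derivative uyy a) (at 0)" by simp
    then show "((\<lambda>x. uy (?l x) + 2 * \<epsilon> * (Im a + x)) has_real_derivative uyy a + 2 * \<epsilon>) (at 0)"
      by (auto intro!: derivative_eq_intros)
    show "u (?l x) + \<epsilon> * ((Re a)\<^sup>2 + (Im a + x)\<^sup>2) \<le> u (?l 0) + \<epsilon> * ((Re a)\<^sup>2 + (Im a + 0)\<^sup>2)"
      if "\<bar>x\<bar> < d" for x
      using m[of "?l x"] that by (simp add: v_def cmod_power2 dist_norm norm_mult)
  qed
  show False using 1 2 D(4)[OF \<open>a \<in> W\<close>] \<epsilon> by linarith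
qed

section \<open>Closure properties of harmonic functions, and real parts of holomorphic
  functions\<close>

lemma harmonic_on_subset:
  assumes "harmonic_on u U" "open V" "V \<subseteq> U"
  shows "harmonic_on u V"
proof -
  obtain ux uy uxx uxy uyx uyy where D: "open U"
    "\<And>z. z \<in> U \<Longrightarrow> (u has_derivative (\<lambda>h. ux z * Re h + uy z * Im h)) (at z)"
    "\<And>z. z \<in> U \<Longrightarrow> (ux has_derivative (\<lambda>h. uxx z * Re h + uxy z * Im h)) (at z)"
    "\<And>z. z \<in> U \<Longrightarrow> (uy has_derivative (\<lambda>h. uyx z * Re h + uyy z * Im h)) (at z)"
    "\<And>z. z \<in> U \<Longrightarrow> uxx z + uyy z = 0"
    "continuous_on U uxx" "continuous_on U uxy" "continuous_on U uyx" "continuous_on U uyy"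
    using assms(1) by (rule harmonic_onE) (rule that; assumption)
  show ?thesis
    by (rule harmonic_onI[of V u ux uy uxx uxy uyx uyy])
      (use assms D in \<open>auto intro: continuous_on_subset\<close>)
qed

lemma harmonic_on_imp_continuous_on:
  assumes "harmonic_on u U" shows "continuous_on U u"
proof -
  obtain ux uy uxx uxy uyx uyy where D: "open U"
    "\<And>z. z \<in> U \<Longrightarrow> (u has_derivative (\<lambda>h. ux z * Re h + uy z * Im h)) (at z)"
    "\<And>z. z \<in> U \<Longrightarrow> (ux has_derivative (\<lambda>h. uxx z * Re h + uxy z * Im h)) (at z)"
    "\<And>z. z \<in> U \<Longrightarrow> (uy has_derivative (\<lambda>h. uyx z * Re h + uyy z * Im h)) (at z)"
    "\<And>z. z \<in> U \<Longrightarrow> uxx z + uyy z = 0"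
    "continuous_on U uxx" "continuous_on U uxy" "continuous_on U uyx" "continuous_on U uyy"
    using assms(1) by (rule harmonic_onE) (rule that; assumption)
  show ?thesis
    by (intro continuous_at_imp_continuous_on ballI has_derivative_continuous[OF D(2)])
qed

lemma harmonic_on_const: "open U \<Longrightarrow> harmonic_on (\<lambda>_. c) U"
  by (rule harmonic_onI[of U _ "\<lambda>_. 0" "\<lambda>_. 0" "\<lambda>_. 0" "\<lambda>_. 0" "\<lambda>_. 0" "\<lambda>_. 0"]) auto

lemma harmonic_on_cmult:
  assumes "harmonic_on u U"
  shows "harmonic_on (\<lambda>z. c * u z) U"
proof -
  obtain ux uy uxx uxy uyx uyy where D: "open U"
    "\<And>z. z \<in> U \<Longrightarrow> (u has_derivative (\<lambda>h. ux z * Re h + uy z * Im h)) (at z)"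
    "\<And>z. z \<in> U \<Longrightarrow> (ux has_derivative (\<lambda>h. uxx z * Re h + uxy z * Im h)) (at z)"
    "\<And>z. z \<in> U \<Longrightarrow> (uy has_derivative (\<lambda>h. uyx z * Re h + uyy z * Im h)) (at z)"
    "\<And>z. z \<in> U \<Longrightarrow> uxx z + uyy z = 0"
    "continuous_on U uxx" "continuous_on U uxy" "continuous_on U uyx" "continuous_on U uyy"
    using assms by (rule harmonic_onE) (rule that; assumption)
  show ?thesis
  proof (rule harmonic_onI[of U _ "\<lambda>z. c * ux z" "\<lambda>z. c * uy z" "\<lambda>z. c * uxx z"
        "\<lambda>z. c * uxy z" "\<lambda>z. c * uyx z" "\<lambda>z. c * uyy z"])
    fix z assume "z \<in> U"
    note d = D(2-5)[OF this]
    show "((\<lambda>z. c * u z) has_derivative (\<lambda>h. (c * ux z) * Re h + (c * uy z) * Im h)) (at z)"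
      using has_derivative_mult_right[OF d(1), of c] by (simp add: algebra_simps)
    show "((\<lambda>z. c * ux z) has_derivative (\<lambda>h. (c * uxx z) * Re h + (c * uxy z) * Im h)) (at z)"
      using has_derivative_mult_right[OF d(2), of c] by (simp add: algebra_simps)
    show "((\<lambda>z. c * uy z) has_derivative (\<lambda>h. (c * uyx z) * Re h + (c * uyy z) * Im h)) (at z)"
      using has_derivative_mult_right[OF d(3), of c] by (simp add: algebra_simps)
    show "c * uxx z + c * uyy z = 0" using d(4) by (metis distrib_left mult_zero_right)
  qed (use D in \<open>auto intro!: continuous_intros\<close>)
qed

lemma harmonic_on_add:
  assumes "harmonic_on u U" "harmonic_on v U"
  shows "harmonic_on (\<lambda>z. u z + v z) U"
proof -
  obtain ux uy uxx uxy uyx uyy where D: "open U"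
    "\<And>z. z \<in> U \<Longrightarrow> (u has_derivative (\<lambda>h. ux z * Re h + uy z * Im h)) (at z)"
    "\<And>z. z \<in> U \<Longrightarrow> (ux has_derivative (\<lambda>h. uxx z * Re h + uxy z * Im h)) (at z)"
    "\<And>z. z \<in> U \<Longrightarrow> (uy has_derivative (\<lambda>h. uyx z * Re h + uyy z * Im h)) (at z)"
    "\<And>z. z \<in> U \<Longrightarrow> uxx z + uyy z = 0"
    "continuous_on U uxx" "continuous_on U uxy" "continuous_on U uyx" "continuous_on U uyy"
    using assms(1) by (rule harmonic_onE) (rule that; assumption)
  obtain vx vy vxx vxy vyx vyy where E: "open U"
    "\<And>z. z \<in> U \<Longrightarrow> (v has_derivative (\<lambda>h. vx z * Re h + vy z * Im h)) (at z)"
    "\<And>z. z \<in> U \<Longrightarrow> (vx has_derivative (\<lambda>h. vxx z * Re h + vxy z * Im h)) (at z)"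
    "\<And>z. z \<in> U \<Longrightarrow> (vy has_derivative (\<lambda>h. vyx z * Re h + vyy z * Im h)) (at z)"
    "\<And>z. z \<in> U \<Longrightarrow> vxx z + vyy z = 0"
    "continuous_on U vxx" "continuous_on U vxy" "continuous_on U vyx" "continuous_on U vyy"
    using assms(2) by (rule harmonic_onE) (rule that; assumption)
  show ?thesis
  proof (rule harmonic_onI[of U _ "\<lambda>z. ux z + vx z" "\<lambda>z. uy z + vy z" "\<lambda>z. uxx z + vxx z"
        "\<lambda>z. uxy z + vxy z" "\<lambda>z. uyx z + vyx z" "\<lambda>z. uyy z + vyy z"])
    fix z assume z: "z \<in> U"
    note d = D(2-5)[OF z] and e = E(2-5)[OF z]
    show "((\<lambda>z. u z + v z) has_derivative (\<lambda>h. (ux z + vx z) * Re h + (uy z + vy z) * Im h)) (at z)"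
      using has_derivative_add[OF d(1) e(1)] by (simp add: algebra_simps)
    show "((\<lambda>z. ux z + vx z) has_derivative (\<lambda>h. (uxx z + vxx z) * Re h + (uxy z + vxy z) * Im h)) (at z)"
      using has_derivative_add[OF d(2) e(2)]
      by (simp add: algebra_simps)
    show "((\<lambda>z. uy z + vy z) has_derivative (\<lambda>h. (uyx z + vyx z) * Re h + (uyy z + vyy z) * Im h)) (at z)"
      using has_derivative_add[OF d(3) e(3)]
      by (simp add: algebra_simps)
    show "(uxx z + vxx z) + (uyy z + vyy z) = 0" using d(4) e(4) by linarith
  qed (use D E in \<open>auto intro!: continuous_intros\<close>)
qed

lemma harmonic_on_diff:
  assumes "harmonic_on u U" "harmonic_on v U"
  shows "harmonic_on (\<lambda>z. u z - v z) U"
  using harmonic_on_add[OF assms(1) harmonic_on_cmult[OF assms(2), of "-1"]] by simp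

text \<open>The Cauchy-Riemann equations. The second form is for the derivative of F, because u_y =
  - Im F' when u = Re F.\<close>

lemma has_derivative_Re_holomorphic:
  assumes "(F has_field_derivative D) (at z)"
  shows "((\<lambda>w. Re (F w)) has_derivative (\<lambda>h. Re D * Re h + (- Im D) * Im h)) (at z)"
    and "((\<lambda>w. - Im (F w)) has_derivative (\<lambda>h. (- Im D) * Re h + (- Re D) * Im h)) (at z)"
proof -
  have F: "(F has_derivative (\<lambda>h. D * h)) (at z)" using assms by (simp add: has_field_derivative_def)
  show "((\<lambda>w. Re (F w)) has_derivative (\<lambda>h. Re D * Re h + (- Im D) * Im h)) (at z)"
    using has_derivative_Re[OF F] by simp
  show "((\<lambda>w. - Im (F w)) has_derivative (\<lambda>h. (- Im D) * Re h + (- Re D) * Im h)) (at z)"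
    using has_derivative_minus[OF has_derivative_Im[OF F]] by (simp add: algebra_simps)
qed

text \<open>The definition of \<open>harmonic_on\<close> wants its derivative functions on all of U
  at once, while F changes from ball to ball. They are therefore taken from the Frechet derivative
  of u, applied to 1 and \<i>, and only evaluated through F.\<close>

lemma harmonic_on_if_locally_Re:
  assumes "open U" and loc: "\<And>z. z \<in> U \<Longrightarrow>
     \<exists>F r. r > 0 \<and> ball z r \<subseteq> U \<and> F holomorphic_on ball z r \<and> (\<forall>w\<in>ball z r. u w = Re (F w))"
  shows "harmonic_on u U"
proof -
  define ux where "ux = (\<lambda>z. frechet_derivative u (at z) 1)"
  define uy where "uy = (\<lambda>z. frechet_derivative u (at z) \<i>)"
  define uxx where "uxx = (\<lambda>z. frechet_derivative ux (at z) 1)"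
  define uxy where "uxy = (\<lambda>z. frechet_derivative ux (at z) \<i>)"
  define uyx where "uyx = (\<lambda>z. frechet_derivative uy (at z) 1)"
  define uyy where "uyy = (\<lambda>z. frechet_derivative uy (at z) \<i>)"
  have main: "((u has_derivative (\<lambda>h. ux z * Re h + uy z * Im h)) (at z) \<and>
           (ux has_derivative (\<lambda>h. uxx z * Re h + uxy z * Im h)) (at z) \<and>
           (uy has_derivative (\<lambda>h. uyx z * Re h + uyy z * Im h)) (at z) \<and>
           uxx z + uyy z = 0) \<and>
        isCont uxx z \<and> isCont uxy z \<and> isCont uyx z \<and> isCont uyy z" if zU: "z \<in> U" for z
  proof -
    obtain F r where F: "r > 0" "F holomorphic_on ball z r" "\<And>w. w \<in> ball z r \<Longrightarrow> u w = Re (F w)"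
      using loc[OF zU] by blast
    have F': "deriv F holomorphic_on ball z r" and F'': "deriv (deriv F) holomorphic_on ball z r"
      using F(2) by (auto intro!: holomorphic_deriv)
    have u: "(u has_derivative (\<lambda>h. Re (deriv F w) * Re h + (- Im (deriv F w)) * Im h)) (at w)"
      if w: "w \<in> ball z r" for w
      using has_derivative_transform_within_open
        [OF has_derivative_Re_holomorphic(1)[OF holomorphic_derivI[OF F(2) open_ball w]] open_ball w]
        F(3) by auto
    have ux: "ux w = Re (deriv F w)" and uy: "uy w = - Im (deriv F w)" if w: "w \<in> ball z r" for w
      using fun_cong[OF frechet_derivative_at[OF u[OF w]], of 1]
        fun_cong[OF frechet_derivative_at[OF u[OF w]], of \<i>] unfolding ux_def uy_def by simp_all
    have ux': "(ux has_derivative (\<lambda>h. Re (deriv (deriv F) w) * Re h + (- Im (deriv (deriv F) w)) * Im h)) (at w)"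
      if w: "w \<in> ball z r" for w
      using has_derivative_transform_within_open
        [OF has_derivative_Re_holomorphic(1)[OF holomorphic_derivI[OF F' open_ball w]] open_ball w]
        ux by auto
    have uy': "(uy has_derivative (\<lambda>h. (- Im (deriv (deriv F) w)) * Re h + (- Re (deriv (deriv F) w)) * Im h)) (at w)"
      if w: "w \<in> ball z r" for w
      using has_derivative_transform_within_open
        [OF has_derivative_Re_holomorphic(2)[OF holomorphic_derivI[OF F' open_ball w]] open_ball w]
        uy by auto
    have eqs: "uxx w = Re (deriv (deriv F) w)" "uxy w = - Im (deriv (deriv F) w)"
      "uyx w = - Im (deriv (deriv F) w)" "uyy w = - Re (deriv (deriv F) w)" if w: "w \<in> ball z r" for w
      using fun_cong[OF frechet_derivative_at[OF ux'[OF w]], of 1] fun_cong[OF frechet_derivative_at[OF uy'[OF w]], of 1]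
        fun_cong[OF frechet_derivative_at[OF ux'[OF w]], of \<i>] fun_cong[OF frechet_derivative_at[OF uy'[OF w]], of \<i>]
      unfolding uxx_def uxy_def uyx_def uyy_def by simp_all
    have z: "z \<in> ball z r" using F by simp
    have c: "continuous_on (ball z r) (deriv (deriv F))"
      using F'' by (rule holomorphic_on_imp_continuous_on)
    have C: "isCont q z" if q: "continuous_on (ball z r) q'" "\<And>w. w \<in> ball z r \<Longrightarrow> q w = q' w"
      for q q' :: "complex \<Rightarrow> real"
      using q z by (metis (no_types, lifting) continuous_on_cong continuous_on_eq_continuous_at open_ball)
    have "isCont uxx z" "isCont uxy z" "isCont uyx z" "isCont uyy z"
      by (rule C[OF _ eqs(1)] C[OF _ eqs(2)] C[OF _ eqs(3)] C[OF _ eqs(4)];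
          auto intro!: continuous_intros c)+
    then show ?thesis using u[OF z] ux'[OF z] uy'[OF z] ux[OF z] uy[OF z] eqs[OF z] by simp
  qed
  show ?thesis
    by (rule harmonic_onI[of U u ux uy uxx uxy uyx uyy])
       (use main \<open>open U\<close> in \<open>auto intro!: continuous_at_imp_continuous_on\<close>)
qed

lemma harmonic_on_Re:
  assumes "open U" "F holomorphic_on U" "\<And>z. z \<in> U \<Longrightarrow> u z = Re (F z)"
  shows "harmonic_on u U"
proof (rule harmonic_on_if_locally_Re[OF assms(1)])
  fix z assume "z \<in> U"
  then obtain r where "r > 0" "ball z r \<subseteq> U" using assms(1) openE by blast
  then show "\<exists>F r. r > 0 \<and> ball z r \<subseteq> U \<and> F holomorphic_on ball z r \<and> (\<forall>w\<in>ball z r. u w = Re (F w))"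
    using assms by (intro exI[of _ F] exI[of _ r]) (auto intro: holomorphic_on_subset)
qed

subsection \<open>The Dirichlet problem on the unit disc\<close>

text \<open>A one-sided bound on Re F bounds the modulus of exp ((F - F z) / M) by e. Its derivative
  at z is F' z / M, so Cauchy's inequality gives the constant \<open>exp 1\<close>.\<close>

lemma gradient_bound:
  fixes F :: "complex \<Rightarrow> complex"
  assumes F: "F holomorphic_on ball z r" and "M > 0" "r > 0"
    and bd: "\<And>w. w \<in> ball z r \<Longrightarrow> Re (F w) - Re (F z) \<le> M"
  shows "norm (deriv F z) \<le> exp 1 * M / r"
proof (rule ccontr)
  let ?D = "norm (deriv F z)"
  assume "\<not> ?D \<le> exp 1 * M / r"
  then have D: "exp 1 * M / r < ?D" "?D > 0"
    using \<open>M > 0\<close> \<open>r > 0\<close> by (auto intro: le_less_trans[rotated])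
  then have "exp 1 * M / ?D < r" using \<open>r > 0\<close> by (simp add: field_simps)
  \<comment> \<open>Cauchy's inequality uses continuity on the closed disc, so the radius s is taken
    below r but still large enough to contradict the assumed size of the derivative.\<close>
  then obtain s where s: "exp 1 * M / ?D < s" "s < r" using dense by blast
  have "s > 0" using s(1) D \<open>M > 0\<close> by (smt (verit) divide_pos_pos exp_gt_zero mult_pos_pos)
  define G where "G = (\<lambda>w. exp ((F w - F z) / of_real M))"
  have G: "G holomorphic_on ball z r"
    unfolding G_def using \<open>M > 0\<close> by (intro holomorphic_intros F) auto
  have "norm ((deriv ^^ 1) G z) \<le> fact 1 * exp 1 / s ^ 1"
  proof (rule Cauchy_inequality)
    show "G holomorphic_on ball z s" using G s by (auto intro: holomorphic_on_subset)
    show "continuous_on (cball z s) G"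
      by (rule continuous_on_subset[OF holomorphic_on_imp_continuous_on[OF G]]) (use s in auto)
    fix x assume "norm (z - x) = s"
    then have "x \<in> ball z r" using s by (simp add: dist_norm)
    from bd[OF this] show "norm (G x) \<le> exp 1"
      using \<open>M > 0\<close> by (simp add: G_def)
  qed fact
  moreover have "(G has_field_derivative deriv F z / of_real M) (at z)"
  proof -
    have "(F has_field_derivative deriv F z) (at z)"
      by (rule holomorphic_derivI[OF F]) (use \<open>r > 0\<close> in auto)
    then show ?thesis unfolding G_def using \<open>M > 0\<close>
      by (auto intro!: derivative_eq_intros)
  qed
  ultimately have "?D / M \<le> exp 1 / s"
    using \<open>M > 0\<close> by (simp add: DERIV_imp_deriv norm_divide)
  with s(1) D \<open>M > 0\<close> \<open>s > 0\<close> show False by (simp add: field_simps)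
qed

text \<open>On the circle cnj z = 1 / z, so the product is a Laurent polynomial, and conjugating its
  negative powers does not change the real part. The induction removes one coefficient of P and Q at
  a time.\<close>

lemma circle_Re_poly_mult_cnj:
  "\<exists>R. \<forall>z. norm z = 1 \<longrightarrow> Re (poly P z * cnj (poly Q z)) = Re (poly R z)"
proof (induction P arbitrary: Q)
  case 0
  show ?case by (intro exI[of _ 0]) auto
next
  case (pCons a P)
  obtain b Q' where Q: "Q = pCons b Q'" by (cases Q)
  obtain R where R: "\<And>z. norm z = 1 \<Longrightarrow> Re (poly P z * cnj (poly Q' z)) = Re (poly R z)"
    using pCons.IH[of Q'] by blast
  define S where "S = [:a * cnj b:] + pCons 0 (smult (cnj a) Q') + pCons 0 (smult (cnj b) P) + R"
  have "Re (poly (pCons a P) z * cnj (poly Q z)) = Re (poly S z)" if z: "norm z = 1" for z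
  proof -
    have zz: "z * cnj z = 1" using z by (simp add: complex_norm_square[symmetric])
    have "poly (pCons a P) z * cnj (poly Q z)
      = a * cnj b + cnj (cnj a * (z * poly Q' z)) + cnj b * (z * poly P z)
        + (z * cnj z) * (poly P z * cnj (poly Q' z))"
      by (simp add: Q algebra_simps)
    also have "Re \<dots> = Re (poly S z)"
      unfolding zz using R[OF z] by (simp add: S_def algebra_simps)
    finally show ?thesis .
  qed
  then show ?case by blast
qed

text \<open>From 2 Re a Re b = Re (a b) + Re (a cnj b). Thus the real parts of polynomials form an
  algebra on the circle, as Stone-Weierstrass requires.\<close>

lemma circle_Re_poly_mult:
  "\<exists>R. \<forall>z. norm z = 1 \<longrightarrow> Re (poly P z) * Re (poly Q z) = Re (poly R z)"
proof -
  obtain R where R: "\<And>z. norm z = 1 \<Longrightarrow> Re (poly P z * cnj (poly Q z)) = Re (poly R z)"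
    using circle_Re_poly_mult_cnj by blast
  have "Re (poly P z) * Re (poly Q z) = Re (poly (smult (1/2) (P * Q + R)) z)" if "norm z = 1" for z
    using R[OF that] by simp
  then show ?thesis by blast
qed

lemma circle_Re_poly_dense:
  fixes \<phi> :: "complex \<Rightarrow> real"
  assumes "continuous_on (sphere 0 1) \<phi>" "e > 0"
  shows "\<exists>Q. \<forall>z\<in>sphere 0 1. \<bar>\<phi> z - Re (poly Q z)\<bar> < e"
proof -
  define R where "R = {f. \<exists>Q. \<forall>z\<in>sphere 0 1. f z = Re (poly Q z)}"
  interpret function_ring_on R "sphere 0 1"
  proof
    show "compact (sphere (0::complex) 1)" by simp
    show "continuous_on (sphere 0 1) f" if fR: "f \<in> R" for f
    proof -
      obtain Q where "\<forall>z\<in>sphere 0 1. f z = Re (poly Q z)" using fR by (auto simp: R_def)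
      moreover have "continuous_on (sphere 0 1) (\<lambda>z. Re (poly Q z))" by (intro continuous_intros)
      ultimately show ?thesis using continuous_on_cong by (metis (mono_tags, lifting))
    qed
    show "(\<lambda>x. f x + g x) \<in> R" if fg: "f \<in> R" "g \<in> R" for f g
    proof -
      obtain P Q where "\<forall>z\<in>sphere 0 1. f z = Re (poly P z)" "\<forall>z\<in>sphere 0 1. g z = Re (poly Q z)"
        using fg by (auto simp: R_def)
      then show ?thesis unfolding R_def by (intro CollectI exI[of _ "P + Q"]) simp
    qed
    show "(\<lambda>x. f x * g x) \<in> R" if fg: "f \<in> R" "g \<in> R" for f g
    proof -
      obtain P Q where PQ: "\<forall>z\<in>sphere 0 1. f z = Re (poly P z)" "\<forall>z\<in>sphere 0 1. g z = Re (poly Q z)"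
        using fg by (auto simp: R_def)
      obtain S where "\<forall>z. norm z = 1 \<longrightarrow> Re (poly P z) * Re (poly Q z) = Re (poly S z)"
        using circle_Re_poly_mult by blast
      with PQ show ?thesis unfolding R_def by (intro CollectI exI[of _ S]) simp
    qed
    show "(\<lambda>_. c) \<in> R" for c
      unfolding R_def by (intro CollectI exI[of _ "[:of_real c:]"]) simp
    show "\<exists>f\<in>R. f x \<noteq> f y" if "x \<noteq> y" for x y
    proof -
      have 1: "(\<lambda>z. Re z) \<in> R" unfolding R_def by (intro CollectI exI[of _ "[:0, 1:]"]) simp
      have 2: "(\<lambda>z. - Im z) \<in> R" unfolding R_def by (intro CollectI exI[of _ "[:0, \<i>:]"]) simp
      have "Re x \<noteq> Re y \<or> - Im x \<noteq> - Im y" using that by (simp add: complex_eq_iff)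
      then show ?thesis using bexI[OF _ 1, of "\<lambda>f. f x \<noteq> f y"] bexI[OF _ 2, of "\<lambda>f. f x \<noteq> f y"] by argo
    qed
  qed
  obtain g where g: "g \<in> R" "\<forall>x\<in>sphere 0 1. \<bar>\<phi> x - g x\<bar> < e"
    using Stone_Weierstrass_basic[OF assms] by blast
  obtain Q where "\<forall>z\<in>sphere 0 1. g z = Re (poly Q z)" using g(1) by (auto simp: R_def)
  with g(2) show ?thesis by (intro exI[of _ Q]) simp
qed

text \<open>Polynomials Q n whose real parts approximate \<phi> on the circle have uniformly Cauchy
  real parts on the closed disc by the maximum principle. The gradient bound then makes the
  polynomials themselves uniformly Cauchy on smaller discs, so that the limit is the real part of a
  holomorphic F.\<close>

theorem dirichlet_unit_disc:
  fixes \<phi> :: "complex \<Rightarrow> real"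
  assumes "continuous_on (sphere 0 1) \<phi>"
  shows "\<exists>u F. continuous_on (cball 0 1) u \<and> F holomorphic_on ball 0 1 \<and>
           (\<forall>z\<in>ball 0 1. u z = Re (F z)) \<and> (\<forall>z\<in>sphere 0 1. u z = \<phi> z)"
proof -
  have "\<forall>n. \<exists>Q. \<forall>z\<in>sphere 0 1. \<bar>\<phi> z - Re (poly Q z)\<bar> < 1 / Suc n"
    using circle_Re_poly_dense[OF assms] by auto
  then obtain Q where Q: "\<And>n z. norm z = 1 \<Longrightarrow> \<bar>\<phi> z - Re (poly (Q n) z)\<bar> < 1 / Suc n"
    by (metis mem_sphere_0)
  \<comment> \<open>The real parts determine the polynomials up to imaginary constants. Making the
    value at 0 real removes this freedom, without which P could not converge.\<close>
  define P where "P = (\<lambda>n z. poly (Q n) z - \<i> * of_real (Im (poly (Q n) 0)))"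
  have holP: "P n holomorphic_on S" for n S unfolding P_def by (intro holomorphic_intros)
  have RP: "Re (P n z) = Re (poly (Q n) z)" for n z by (simp add: P_def)
  have I0: "Im (P n 0) = 0" for n by (simp add: P_def)
  have le: "Re (P m z) - Re (P n z) \<le> 1 / Suc m + 1 / Suc n" if z: "norm z \<le> 1" for m n z
  proof -
    have "Re (P m z - P n z) \<le> 1 / Suc m + 1 / Suc n"
    proof (rule maximum_real_frontier[where S = "cball 0 1" and f = "\<lambda>z. P m z - P n z"])
      fix w :: complex assume "w \<in> frontier (cball 0 1)"
      then have w: "norm w = 1" by simp
      show "Re (P m w - P n w) \<le> 1 / Suc m + 1 / Suc n"
        using Q[OF w, of m] Q[OF w, of n] unfolding minus_complex.sel RP by linarith
    qed (use z in \<open>auto intro!: holomorphic_on_imp_continuous_on holomorphic_intros holP\<close>)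
    then show ?thesis by simp
  qed
  have abs: "\<bar>Re (P m z) - Re (P n z)\<bar> \<le> 1 / Suc m + 1 / Suc n" if z: "norm z \<le> 1" for m n z
    using le[OF z, of m n] le[OF z, of n m] by linarith
  have small: "\<exists>N. \<forall>m\<ge>N. \<forall>n\<ge>N. C * (1 / Suc m + 1 / Suc n) < e" if "e > 0" "C > 0" for e C :: real
  proof -
    obtain N where N: "inverse (real (Suc N)) < e / (2 * C)"
      using reals_Archimedean[of "e / (2*C)"] \<open>e > 0\<close> \<open>C > 0\<close> by auto
    have "C * (1 / Suc m + 1 / Suc n) < e" if mn: "m \<ge> N" "n \<ge> N" for m n
    proof -
      have "1 / Suc m \<le> 1 / Suc N" "1 / Suc n \<le> 1 / Suc N"
        using mn by (auto simp: field_simps)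
      moreover have "2 * (1 / Suc N) < e / C" using N by (simp add: inverse_eq_divide field_simps)
      ultimately have "1 / Suc m + 1 / Suc n < e / C" by linarith
      then show ?thesis using \<open>C > 0\<close> by (simp add: field_simps)
    qed
    then show ?thesis by blast
  qed
  have "uniformly_convergent_on (cball 0 1) (\<lambda>n z. Re (P n z))"
  proof (rule Cauchy_uniformly_convergent, unfold uniformly_Cauchy_on_def, intro allI impI)
    fix e :: real assume "e > 0"
    obtain N where N: "\<forall>m\<ge>N. \<forall>n\<ge>N. 1 * (1 / Suc m + 1 / Suc n) < e"
      using small[OF \<open>e > 0\<close>, of 1] by auto
    show "\<exists>M. \<forall>z\<in>cball 0 1. \<forall>m\<ge>M. \<forall>n\<ge>M. dist (Re (P m z)) (Re (P n z)) < e"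
    proof (intro exI[of _ N] ballI allI impI)
      fix z :: complex and m n assume "z \<in> cball 0 1" "m \<ge> N" "n \<ge> N"
      then show "dist (Re (P m z)) (Re (P n z)) < e"
        using abs[of z m n] N[rule_format, of m n] by (simp add: dist_real_def)
    qed
  qed
  then obtain u where u: "uniform_limit (cball 0 1) (\<lambda>n z. Re (P n z)) u sequentially"
    by (auto simp: uniformly_convergent_on_def)
  have contu: "continuous_on (cball 0 1) u"
    by (rule uniform_limit_theorem[OF _ u])
      (auto intro!: always_eventually continuous_intros holomorphic_on_imp_continuous_on holP)
  define F where "F = (\<lambda>z. lim (\<lambda>n. P n z))"
  have unif: "uniform_limit (cball 0 s) P F sequentially" if s: "0 < s" "s < 1" for s
  proof -
    \<comment> \<open>The summand 1 accounts for the value at 0, which is real. The other one is the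
      gradient bound on balls of radius 1 - s, where the real part oscillates by at most 2
      \<delta>.\<close>
    define C where "C = 1 + 2 * (exp 1 / (1 - s))"
    have "C > 0" using s by (simp add: C_def add_pos_pos)
    have bound: "norm (P m z - P n z) \<le> C * (1 / Suc m + 1 / Suc n)" if z: "norm z \<le> s" for m n z
    proof -
      define \<delta> :: real where "\<delta> = 1 / Suc m + 1 / Suc n"
      have "\<delta> > 0" by (simp add: \<delta>_def add_pos_pos)
      define H where "H = (\<lambda>z. P m z - P n z)"
      have H: "H holomorphic_on S" for S unfolding H_def by (intro holomorphic_intros holP)
      have aH: "\<bar>Re (H w)\<bar> \<le> \<delta>" if "norm w \<le> 1" for w
        using abs[OF that] by (simp add: H_def \<delta>_def)
      have "norm (deriv H w) \<le> exp 1 * (2 * \<delta>) / (1 - s)" if w: "norm w \<le> s" for w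
      proof (rule gradient_bound[OF H])
        fix x assume "x \<in> ball w (1 - s)"
        then have "norm x \<le> 1" using norm_triangle_ineq4[of w "w - x"] w by (simp add: dist_norm)
        then show "Re (H x) - Re (H w) \<le> 2 * \<delta>" using aH[of x] aH[of w] w s by simp
      qed (use s \<open>\<delta> > 0\<close> in auto)
      then have "norm (H z - H 0) \<le> exp 1 * (2 * \<delta>) / (1 - s) * norm (z - 0)"
        by (intro field_differentiable_bound[where S = "cball 0 s" and f' = "deriv H"])
           (use z s H[of UNIV] in \<open>auto intro: holomorphic_derivI[of _ UNIV] has_field_derivative_at_within\<close>)
      also have "\<dots> \<le> exp 1 * (2 * \<delta>) / (1 - s) * 1"
        using z s \<open>\<delta> > 0\<close> by (intro mult_left_mono) auto
      finally have "norm (H z - H 0) \<le> 2 * (exp 1 / (1 - s)) * \<delta>" by (simp add: mult_ac)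
      moreover have "norm (H 0) \<le> \<delta>"
        using aH[of 0] I0 by (simp add: H_def cmod_eq_Re)
      moreover have "norm (H z) \<le> norm (H z - H 0) + norm (H 0)" by (metis add.commute norm_triangle_sub)
      ultimately have "norm (H z) \<le> (1 + 2 * (exp 1 / (1 - s))) * \<delta>" by (simp add: algebra_simps)
      then show ?thesis unfolding C_def H_def \<delta>_def by simp
    qed
    have "uniformly_convergent_on (cball 0 s) P"
    proof (rule Cauchy_uniformly_convergent, unfold uniformly_Cauchy_on_def, intro allI impI)
      fix e :: real assume "e > 0"
      obtain N where N: "\<forall>m\<ge>N. \<forall>n\<ge>N. C * (1 / Suc m + 1 / Suc n) < e"
        using small[OF \<open>e > 0\<close> \<open>C > 0\<close>] by auto
      show "\<exists>M. \<forall>z\<in>cball 0 s. \<forall>m\<ge>M. \<forall>n\<ge>M. dist (P m z) (P n z) < e"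
      proof (intro exI[of _ N] ballI allI impI)
        fix z :: complex and m n assume "z \<in> cball 0 s" "m \<ge> N" "n \<ge> N"
        then show "dist (P m z) (P n z) < e"
          using bound[of z m n] N[rule_format, of m n] by (simp add: dist_norm)
      qed
    qed
    then show ?thesis unfolding F_def by (simp add: uniformly_convergent_uniform_limit_iff)
  qed
  have holF: "F holomorphic_on ball 0 1"
  proof (rule holomorphic_uniform_sequence[of _ P])
    fix x :: complex assume x: "x \<in> ball 0 1"
    define d where "d = (1 - norm x) / 2"
    have d: "d > 0" "norm x + d < 1" using x by (auto simp: d_def field_simps)
    have sub: "cball x d \<subseteq> cball 0 (norm x + d)"
    proof
      fix y assume "y \<in> cball x d"
      then show "y \<in> cball 0 (norm x + d)"
        using norm_triangle_ineq4[of x "x - y"] by (simp add: dist_norm)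
    qed
    have "uniform_limit (cball 0 (norm x + d)) P F sequentially"
      by (rule unif) (use d in \<open>auto intro: add_nonneg_pos\<close>)
    then have "uniform_limit (cball x d) P F sequentially"
      using sub by (rule uniform_limit_on_subset)
    moreover have "cball x d \<subseteq> ball 0 1" using sub d by force
    ultimately show "\<exists>d>0. cball x d \<subseteq> ball 0 1 \<and> uniform_limit (cball x d) P F sequentially"
      using d by blast
  qed (auto simp: holP)
  have "u z = Re (F z)" if z: "z \<in> ball 0 1" for z
  proof -
    have "(\<lambda>n. Re (P n z)) \<longlonglongrightarrow> u z" using z by (intro tendsto_uniform_limitI[OF u]) auto
    moreover obtain s where "norm z < s" "s < 1" using z dense[of "norm z" 1] by auto
    then have "(\<lambda>n. P n z) \<longlonglongrightarrow> F z" by (intro tendsto_uniform_limitI[OF unif[of s]])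
        (auto intro: le_less_trans[OF norm_ge_zero])
    then have "(\<lambda>n. Re (P n z)) \<longlonglongrightarrow> Re (F z)" by (rule tendsto_Re)
    ultimately show ?thesis by (rule LIMSEQ_unique)
  qed
  moreover have "u z = \<phi> z" if z: "z \<in> sphere 0 1" for z
  proof -
    have "(\<lambda>n. Re (P n z)) \<longlonglongrightarrow> u z" using z by (intro tendsto_uniform_limitI[OF u]) auto
    moreover have "(\<lambda>n. Re (P n z)) \<longlonglongrightarrow> \<phi> z"
    proof (rule Lim_transform2[OF tendsto_const])
      show "(\<lambda>n. \<phi> z - Re (P n z)) \<longlonglongrightarrow> 0"
      proof (rule Lim_null_comparison)
        show "\<forall>\<^sub>F n in sequentially. norm (\<phi> z - Re (P n z)) \<le> inverse (real (Suc n))"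
          using Q[of z] z by (intro always_eventually allI) (simp add: RP inverse_eq_divide less_imp_le)
      qed (rule LIMSEQ_inverse_real_of_nat)
    qed
    ultimately show ?thesis by (rule LIMSEQ_unique)
  qed
  ultimately show ?thesis using contu holF by blast
qed

section \<open>The Dirichlet problem on arbitrary discs and its consequences for harmonic
  functions\<close>

lemma harmonic_comparison:
  assumes "bounded W" "continuous_on (closure W) u" "continuous_on (closure W) v"
    "harmonic_on u W" "harmonic_on v W" "\<And>z. z \<in> frontier W \<Longrightarrow> u z \<le> v z" "z \<in> closure W"
  shows "u z \<le> v z"
proof (cases "z \<in> W")
  case True
  have "u z - v z \<le> 0"
    by (rule harmonic_max_principle[where W = W and u = "\<lambda>z. u z - v z"])
      (use assms True in \<open>auto intro!: continuous_intros harmonic_on_diff\<close>)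
  then show ?thesis by simp
next
  case False
  have "open W" using assms(4) by (simp add: harmonic_on_def)
  with False assms(6,7) show ?thesis by (simp add: frontier_def interior_open)
qed

definition is_disc_solution ::
    "complex \<Rightarrow> real \<Rightarrow> (complex \<Rightarrow> real) \<Rightarrow> (complex \<Rightarrow> real) \<Rightarrow> bool" where
  "is_disc_solution a r \<phi> u \<longleftrightarrow> continuous_on (cball a r) u \<and>
     (\<exists>F. F holomorphic_on ball a r \<and> (\<forall>z\<in>ball a r. u z = Re (F z))) \<and>
     (\<forall>z\<in>sphere a r. u z = \<phi> z)"

text \<open>Plays the role of the Poisson integral. The choice is harmless, since for continuous
  \<phi> and r > 0 the maximum principle determines the values on the closed disc.\<close>

definition disc_solution :: "complex \<Rightarrow> real \<Rightarrow> (complex \<Rightarrow> real) \<Rightarrow> complex \<Rightarrow> real" where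
  "disc_solution a r \<phi> = (SOME u. is_disc_solution a r \<phi> u)"

lemma is_disc_solution_disc_solution:
  assumes r: "r > 0" and \<phi>: "continuous_on (sphere a r) \<phi>"
  shows "is_disc_solution a r \<phi> (disc_solution a r \<phi>)"
proof -
  let ?s = "\<lambda>z. a + of_real r * z" and ?t = "\<lambda>z. (z - a) / of_real r"
  have "continuous_on (sphere 0 1) (\<lambda>z. \<phi> (?s z))"
    by (rule continuous_on_compose2[OF \<phi>])
      (use r in \<open>auto intro!: continuous_intros simp: dist_norm norm_mult\<close>)
  from dirichlet_unit_disc[OF this] obtain u F where u: "continuous_on (cball 0 1) u"
    "F holomorphic_on ball 0 1" "\<And>z. z \<in> ball 0 1 \<Longrightarrow> u z = Re (F z)"
    "\<And>z. z \<in> sphere 0 1 \<Longrightarrow> u z = \<phi> (?s z)" by blast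
  have t: "norm (?t z) = dist a z / r" for z
    using r by (simp add: norm_divide dist_norm norm_minus_commute)
  have st: "?s (?t z) = z" for z using r by simp
  have "is_disc_solution a r \<phi> (\<lambda>z. u (?t z))"
    unfolding is_disc_solution_def
  proof (intro conjI exI[of _ "\<lambda>z. F (?t z)"] ballI)
    show "continuous_on (cball a r) (\<lambda>z. u (?t z))"
      by (rule continuous_on_compose2[OF u(1)]) (use r t in \<open>auto intro!: continuous_intros\<close>)
    have "F \<circ> ?t holomorphic_on ball a r"
      by (rule holomorphic_on_compose_gen[OF _ u(2)]) (use r t in \<open>auto intro!: holomorphic_intros\<close>)
    then show "(\<lambda>z. F (?t z)) holomorphic_on ball a r" by (simp add: o_def)
    show "u (?t z) = Re (F (?t z))" if "z \<in> ball a r" for z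
      by (rule u(3)) (use that r t in auto)
    show "u (?t z) = \<phi> z" if "z \<in> sphere a r" for z
      using u(4)[of "?t z"] that r t[of z] st[of z] by simp
  qed
  then show ?thesis unfolding disc_solution_def by (rule someI[of "is_disc_solution a r \<phi>"])
qed

lemma
  assumes "r > 0" and "continuous_on (sphere a r) \<phi>"
  shows continuous_on_disc_solution: "continuous_on (cball a r) (disc_solution a r \<phi>)"
    and harmonic_on_disc_solution: "harmonic_on (disc_solution a r \<phi>) (ball a r)"
    and disc_solution_Re: "\<exists>F. F holomorphic_on ball a r \<and> (\<forall>z\<in>ball a r. disc_solution a r \<phi> z = Re (F z))"
    and disc_solution_boundary: "\<And>z. z \<in> sphere a r \<Longrightarrow> disc_solution a r \<phi> z = \<phi> z"
  using is_disc_solution_disc_solution[OF assms]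
  unfolding is_disc_solution_def by (auto intro!: harmonic_on_Re)

lemma disc_solution_mono:
  assumes r: "r > 0" and c: "continuous_on (sphere a r) \<phi>" "continuous_on (sphere a r) \<psi>"
    and le: "\<And>z. z \<in> sphere a r \<Longrightarrow> \<phi> z \<le> \<psi> z" and z: "z \<in> cball a r"
  shows "disc_solution a r \<phi> z \<le> disc_solution a r \<psi> z"
  by (rule harmonic_comparison[of "ball a r"])
    (use r z le continuous_on_disc_solution[OF r c(1)] continuous_on_disc_solution[OF r c(2)]
        harmonic_on_disc_solution[OF r c(1)] harmonic_on_disc_solution[OF r c(2)]
        disc_solution_boundary[OF r c(1)] disc_solution_boundary[OF r c(2)] in auto)

lemma disc_solution_unique:
  assumes r: "r > 0" and c: "continuous_on (cball a r) h" and h: "harmonic_on h (ball a r)"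
    and eq: "\<And>z. z \<in> sphere a r \<Longrightarrow> \<phi> z = h z" and z: "z \<in> cball a r"
  shows "disc_solution a r \<phi> z = h z"
proof -
  have "continuous_on (sphere a r) h" by (rule continuous_on_subset[OF c]) auto
  then have c': "continuous_on (sphere a r) \<phi>" by (rule continuous_on_eq) (use eq in auto)
  note d = continuous_on_disc_solution[OF r c'] harmonic_on_disc_solution[OF r c']
    disc_solution_boundary[OF r c']
  have "disc_solution a r \<phi> z \<le> h z"
    by (rule harmonic_comparison[of "ball a r"]) (use r z c h d eq in auto)
  moreover have "h z \<le> disc_solution a r \<phi> z"
    by (rule harmonic_comparison[of "ball a r"]) (use r z c h d eq in auto)
  ultimately show ?thesis by simp
qed

text \<open>By uniqueness u is the disc solution for its own boundary values, which is a real part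
  by construction. With \<open>harmonic_on_if_locally_Re\<close> this makes the two views of
  harmonicity interchangeable.\<close>

lemma harmonic_on_imp_Re:
  assumes "harmonic_on u U" "cball a r \<subseteq> U" "r > 0"
  shows "\<exists>F. F holomorphic_on ball a r \<and> (\<forall>z\<in>ball a r. u z = Re (F z))"
proof -
  have c: "continuous_on (cball a r) u"
    using harmonic_on_imp_continuous_on[OF assms(1)] assms(2) continuous_on_subset by blast
  have h: "harmonic_on u (ball a r)"
    by (rule harmonic_on_subset[OF assms(1)]) (use assms ball_subset_cball in auto)
  have c': "continuous_on (sphere a r) u" by (rule continuous_on_subset[OF c]) auto
  obtain F where F: "F holomorphic_on ball a r" "\<And>z. z \<in> ball a r \<Longrightarrow> disc_solution a r u z = Re (F z)"
    using disc_solution_Re[OF assms(3) c'] by blast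
  moreover have "disc_solution a r u z = u z" if "z \<in> ball a r" for z
    by (rule disc_solution_unique[OF assms(3) c h]) (use that in auto)
  ultimately show ?thesis by (intro exI[of _ F]) auto
qed

text \<open>Locally u is Re G, so the composition is the real part of G after F; this replaces a
  chain rule for second derivatives.\<close>

lemma harmonic_on_compose:
  assumes "harmonic_on u V" "F holomorphic_on U" "open U" "F ` U \<subseteq> V"
  shows "harmonic_on (\<lambda>z. u (F z)) U"
proof (rule harmonic_on_if_locally_Re[OF assms(3)])
  fix z assume z: "z \<in> U"
  have "open V" using assms(1) by (simp add: harmonic_on_def)
  then obtain e where e: "e > 0" "cball (F z) e \<subseteq> V"
    using assms(4) z open_contains_cball by blast
  obtain G where G: "G holomorphic_on ball (F z) e" "\<And>w. w \<in> ball (F z) e \<Longrightarrow> u w = Re (G w)"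
    using harmonic_on_imp_Re[OF assms(1) e(2,1)] by blast
  have "open (U \<inter> F -` ball (F z) e)"
    by (rule continuous_open_preimage[OF holomorphic_on_imp_continuous_on[OF assms(2)] assms(3) open_ball])
  then obtain r where r: "r > 0" "ball z r \<subseteq> U \<inter> F -` ball (F z) e"
    using z e(1) openE by (metis IntI centre_in_ball vimageI)
  have "G \<circ> F holomorphic_on ball z r"
    by (rule holomorphic_on_compose_gen[OF _ G(1)]) (use r assms(2) in \<open>auto intro: holomorphic_on_subset\<close>)
  then show "\<exists>G r. r > 0 \<and> ball z r \<subseteq> U \<and> G holomorphic_on ball z r \<and> (\<forall>w\<in>ball z r. u (F w) = Re (G w))"
    using r G(2) by (intro exI[of _ "G \<circ> F"] exI[of _ r]) auto
qed

lemma harmonic_on_locally: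
  assumes "open U" and loc: "\<And>z. z \<in> U \<Longrightarrow> \<exists>V. z \<in> V \<and> V \<subseteq> U \<and> harmonic_on u V"
  shows "harmonic_on u U"
proof (rule harmonic_on_if_locally_Re[OF assms(1)])
  fix z assume "z \<in> U"
  then obtain V where V: "z \<in> V" "V \<subseteq> U" "harmonic_on u V" using loc by blast
  then have "open V" by (simp add: harmonic_on_def)
  then obtain e where e: "e > 0" "cball z e \<subseteq> V" using V open_contains_cball by blast
  obtain G where "G holomorphic_on ball z e" "\<And>w. w \<in> ball z e \<Longrightarrow> u w = Re (G w)"
    using harmonic_on_imp_Re[OF V(3) e(2,1)] by blast
  then show "\<exists>F r. r > 0 \<and> ball z r \<subseteq> U \<and> F holomorphic_on ball z r \<and> (\<forall>w\<in>ball z r. u w = Re (F w))"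
    using e V(2) ball_subset_cball by (intro exI[of _ G] exI[of _ e]) blast
qed

lemma harmonic_on_cong:
  assumes "harmonic_on u U" "\<And>z. z \<in> U \<Longrightarrow> v z = u z"
  shows "harmonic_on v U"
proof (rule harmonic_on_if_locally_Re)
  show "open U" using assms(1) by (simp add: harmonic_on_def)
  fix z assume "z \<in> U"
  then obtain e where e: "e > 0" "cball z e \<subseteq> U" using \<open>open U\<close> open_contains_cball by blast
  obtain G where "G holomorphic_on ball z e" "\<And>w. w \<in> ball z e \<Longrightarrow> u w = Re (G w)"
    using harmonic_on_imp_Re[OF assms(1) e(2,1)] by blast
  then show "\<exists>F r. r > 0 \<and> ball z r \<subseteq> U \<and> F holomorphic_on ball z r \<and> (\<forall>w\<in>ball z r. v w = Re (F w))"
    using e assms(2) ball_subset_cball by (intro exI[of _ G] exI[of _ e]) (auto simp: subset_iff)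
qed

lemma harmonic_on_ln_norm:
  assumes "F holomorphic_on U" "open U" "\<And>z. z \<in> U \<Longrightarrow> F z \<noteq> 0"
  shows "harmonic_on (\<lambda>z. ln (norm (F z))) U"
proof -
  have "harmonic_on (\<lambda>w. ln (norm w)) (- {0})"
  proof (rule harmonic_on_if_locally_Re)
    fix z :: complex assume z: "z \<in> - {0}"
    show "\<exists>F r. r > 0 \<and> ball z r \<subseteq> - {0} \<and> F holomorphic_on ball z r \<and> (\<forall>w\<in>ball z r. ln (norm w) = Re (F w))"
    \<comment> \<open>For w in the ball of radius |z| about z the quotient w / z lies in the right
      half-plane, away from the branch cut of Ln.\<close>
    proof (intro exI[of _ "\<lambda>w. Ln (w / z) + of_real (ln (norm z))"] exI[of _ "norm z"] conjI ballI)
      have Rp: "Re (w / z) > 0" if "w \<in> ball z (norm z)" for w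
      proof -
        have "norm (1 - w / z) < 1"
          using that z by (simp add: dist_norm norm_divide diff_divide_distrib[symmetric] divide_simps
              flip: norm_divide)
            (metis diff_divide_distrib divide_less_eq_1_pos div_self norm_divide zero_less_norm_iff)
        then show ?thesis using abs_Re_le_cmod[of "1 - w / z"] by simp
      qed
      show "(\<lambda>w. Ln (w / z) + of_real (ln (norm z))) holomorphic_on ball z (norm z)"
        using Rp z by (intro holomorphic_intros) (fastforce simp: complex_nonpos_Reals_iff)+
      show "ln (norm w) = Re (Ln (w / z) + of_real (ln (norm z)))" if "w \<in> ball z (norm z)" for w
      proof -
        have "w \<noteq> 0" using that by auto
        then show ?thesis using z by (simp add: norm_divide ln_div)
      qed
    qed (use z in auto)
  qed auto
  moreover have "F ` U \<subseteq> - {0}" using assms(3) by auto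
  ultimately show ?thesis by (rule harmonic_on_compose[OF _ assms(1,2)])
qed

subsection \<open>Perron's method\<close>

text \<open>Domination by disc solutions takes the place of the sub-mean value property. Continuity
  up to the frontier is built in, so that boundary values can be compared directly.\<close>

definition subharmonic_on :: "(complex \<Rightarrow> real) \<Rightarrow> complex set \<Rightarrow> bool" where
  "subharmonic_on v W \<longleftrightarrow> continuous_on (closure W) v \<and>
     (\<forall>a r. r > 0 \<longrightarrow> cball a r \<subseteq> W \<longrightarrow> (\<forall>z\<in>cball a r. v z \<le> disc_solution a r v z))"

lemma harmonic_imp_subharmonic:
  assumes "continuous_on (closure W) v" "harmonic_on v W"
  shows "subharmonic_on v W"
  unfolding subharmonic_on_def
proof (intro conjI allI impI ballI)
  fix a r z assume r: "r > 0" "cball a r \<subseteq> W" and z: "z \<in> cball a r"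
  have "cball a r \<subseteq> closure W" using r closure_subset by blast
  then have "continuous_on (cball a r) v" by (rule continuous_on_subset[OF assms(1)])
  moreover have "harmonic_on v (ball a r)"
    by (rule harmonic_on_subset[OF assms(2)]) (use r ball_subset_cball in auto)
  ultimately show "v z \<le> disc_solution a r v z"
    using disc_solution_unique[OF r(1), of a v v z] z by simp
qed fact

lemma subharmonic_max:
  assumes "subharmonic_on u W" "subharmonic_on v W"
  shows "subharmonic_on (\<lambda>z. max (u z) (v z)) W"
proof -
  have c: "continuous_on (closure W) u" "continuous_on (closure W) v"
    using assms by (auto simp: subharmonic_on_def)
  then have cm: "continuous_on (closure W) (\<lambda>z. max (u z) (v z))" by (intro continuous_intros)
  show ?thesis unfolding subharmonic_on_def
  proof (intro conjI allI impI ballI)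
    fix a r z assume r: "r > 0" "cball a r \<subseteq> W" and z: "z \<in> cball a r"
    have "sphere a r \<subseteq> closure W" using r closure_subset sphere_cball by blast
    note cs = continuous_on_subset[OF _ this]
    have "u z \<le> disc_solution a r u z" "v z \<le> disc_solution a r v z"
      using assms r z by (auto simp: subharmonic_on_def)
    moreover have "disc_solution a r u z \<le> disc_solution a r (\<lambda>z. max (u z) (v z)) z"
      by (rule disc_solution_mono[OF r(1) cs[OF c(1)] cs[OF cm] _ z]) auto
    moreover have "disc_solution a r v z \<le> disc_solution a r (\<lambda>z. max (u z) (v z)) z"
      by (rule disc_solution_mono[OF r(1) cs[OF c(2)] cs[OF cm] _ z]) auto
    ultimately show "max (u z) (v z) \<le> disc_solution a r (\<lambda>z. max (u z) (v z)) z" by linarith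
  qed (rule cm)
qed

lemma harmonic_on_Re_mult: "open U \<Longrightarrow> harmonic_on (\<lambda>z. Re (c * (z - a))) U"
  by (rule harmonic_on_Re[of _ "\<lambda>z. c * (z - a)"]) (auto intro!: holomorphic_intros)

text \<open>The perturbation \<epsilon> |z|^2 again makes an interior maximum strict. At such a
  point a, v would lie on a small circle below a harmonic function whose value at a is only v a -
  \<epsilon> r^2.\<close>

lemma subharmonic_le_harmonic:
  assumes W: "open W" "bounded W" and v: "subharmonic_on v W"
    and h: "continuous_on (closure W) h" "harmonic_on h W"
    and le: "\<And>z. z \<in> frontier W \<Longrightarrow> v z \<le> h z" and z: "z \<in> closure W"
  shows "v z \<le> h z"
proof (rule ccontr)
  assume neg: "\<not> v z \<le> h z"
  have cv: "continuous_on (closure W) v" using v by (simp add: subharmonic_on_def)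
  obtain R where R: "R > 0" "\<And>z. z \<in> closure W \<Longrightarrow> norm z \<le> R"
    using W bounded_closure bounded_pos by metis
  define \<epsilon> where "\<epsilon> = (v z - h z) / (2 * R\<^sup>2)"
  have \<epsilon>: "\<epsilon> > 0" "\<epsilon> * R\<^sup>2 < v z - h z" using neg R by (auto simp: \<epsilon>_def)
  define d where "d = (\<lambda>z. v z - h z + \<epsilon> * (norm z)\<^sup>2)"
  have cpt: "compact (closure W)" "closure W \<noteq> {}" using W z by (auto simp: compact_closure)
  have cd: "continuous_on (closure W) d" unfolding d_def by (intro continuous_intros cv h)
  obtain a where a0: "a \<in> closure W" "\<forall>w\<in>closure W. d w \<le> d a"
    using continuous_attains_sup[OF cpt cd] by blast
  note a = a0(1) bspec[OF a0(2)]
  have "d z \<le> d a" using a z by blast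
  moreover have "v z - h z \<le> d z" using \<epsilon> by (simp add: d_def)
  moreover have "\<epsilon> * (norm a)\<^sup>2 \<le> \<epsilon> * R\<^sup>2"
    using \<epsilon> R(2)[OF a(1)] by (intro mult_left_mono power_mono) auto
  ultimately have "v a > h a" using \<epsilon>(2) by (simp add: d_def)
  then have "a \<notin> frontier W" using le by force
  then have "a \<in> W" using a(1) W by (simp add: frontier_def interior_open)
  then obtain r where r: "r > 0" "cball a r \<subseteq> W" using W open_contains_cball by blast
  then have sub: "cball a r \<subseteq> closure W" using closure_subset by blast
  have subs: "sphere a r \<subseteq> closure W" using sub sphere_cball by blast
  \<comment> \<open>On the circle |w - a| = r the function |w|^2 agrees with the real-affine
    expression in the bracket. Hence k is harmonic, and on the circle it equals d a + h w -
    \<epsilon> |w|^2, which bounds v w because a maximises d.\<close>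
  define k where "k = (\<lambda>w. d a + h w - \<epsilon> * ((norm a)\<^sup>2 + r\<^sup>2 + 2 * Re (cnj a * (w - a))))"
  have ck: "continuous_on (cball a r) k"
    unfolding k_def by (intro continuous_intros continuous_on_subset[OF h(1) sub])
  have hk: "harmonic_on k (ball a r)"
    unfolding k_def
    by (intro harmonic_on_diff harmonic_on_add harmonic_on_cmult harmonic_on_const harmonic_on_Re_mult
        harmonic_on_subset[OF h(2)]) (use r ball_subset_cball in auto)
  have "v w \<le> k w" if w: "w \<in> sphere a r" for w
  proof -
    have "(norm w)\<^sup>2 = (norm a)\<^sup>2 + (norm (w - a))\<^sup>2 + 2 * Re (cnj a * (w - a))"
      unfolding cmod_power2 by (simp add: power2_eq_square algebra_simps)
    moreover have "norm (w - a) = r" using w by (simp add: dist_norm norm_minus_commute)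
    ultimately show ?thesis using a(2)[of w] w subs unfolding k_def d_def by auto
  qed
  then have "disc_solution a r v a \<le> disc_solution a r k a"
    by (intro disc_solution_mono continuous_on_subset[OF cv subs] continuous_on_subset[OF ck])
       (use r in auto)
  also have "\<dots> = k a" by (rule disc_solution_unique[OF r(1) ck hk]) (use r in auto)
  also have "\<dots> = v a - \<epsilon> * r\<^sup>2" by (simp add: k_def d_def algebra_simps)
  finally have "disc_solution a r v a < v a" using \<epsilon> r by (smt (verit) mult_pos_pos zero_less_power)
  moreover have "v a \<le> disc_solution a r v a" using v r by (auto simp: subharmonic_on_def)
  ultimately show False by simp
qed

definition poisson_modification ::
    "complex \<Rightarrow> real \<Rightarrow> (complex \<Rightarrow> real) \<Rightarrow> complex \<Rightarrow> real" where
  "poisson_modification a r v z = (if z \<in> cball a r then disc_solution a r v z else v z)"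

text \<open>A test disc may overlap the modified disc only partly. Off \<open>ball a r\<close> the
  modification is v itself, and monotonicity of disc solutions suffices. On the intersection of the
  two balls both sides are harmonic, and each frontier point there is either off
  \<open>ball a r\<close> or on the test circle, where the inequality is already known.\<close>

lemma
  assumes v: "subharmonic_on v W" and r: "r > 0" "cball a r \<subseteq> W"
  shows le_poisson_modification: "v z \<le> poisson_modification a r v z"
    and subharmonic_poisson_modification: "subharmonic_on (poisson_modification a r v) W"
proof -
  let ?m = "poisson_modification a r v"
  have cv: "continuous_on (closure W) v" using v by (simp add: subharmonic_on_def)
  have sub: "cball a r \<subseteq> closure W" using r closure_subset by blast
  have cvs: "continuous_on (sphere a r) v"
    by (rule continuous_on_subset[OF cv]) (use sub sphere_cball in blast)
  have le: "v z \<le> ?m z" for z using v r by (auto simp: poisson_modification_def subharmonic_on_def)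
  have ms: "?m z = v z" if "z \<notin> ball a r" for z
    using disc_solution_boundary[OF r(1) cvs, of z] that by (auto simp: poisson_modification_def)
  have md: "?m z = disc_solution a r v z" if "z \<in> cball a r" for z
    using that by (simp add: poisson_modification_def)
  have "continuous_on (cball a r \<union> (closure W - ball a r)) ?m"
    unfolding poisson_modification_def
    by (rule continuous_on_cases[OF _ _ continuous_on_disc_solution[OF r(1) cvs]])
      (use disc_solution_boundary[OF r(1) cvs] cv in \<open>auto intro: continuous_on_subset\<close>)
  also have "cball a r \<union> (closure W - ball a r) = closure W" using sub by auto
  finally have cm: "continuous_on (closure W) ?m" .
  show "v z \<le> ?m z" by (rule le)
  show "subharmonic_on ?m W" unfolding subharmonic_on_def
  proof (intro conjI allI impI ballI)
    fix b s z assume s: "s > 0" "cball b s \<subseteq> W" and z: "z \<in> cball b s"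
    let ?q = "disc_solution b s ?m"
    have "sphere b s \<subseteq> closure W" using s closure_subset sphere_cball by blast
    note cs = continuous_on_subset[OF _ this]
    have q: "continuous_on (cball b s) ?q" "harmonic_on ?q (ball b s)" "\<And>z. z \<in> sphere b s \<Longrightarrow> ?q z = ?m z"
      using continuous_on_disc_solution[OF s(1) cs[OF cm]] harmonic_on_disc_solution[OF s(1) cs[OF cm]]
        disc_solution_boundary[OF s(1) cs[OF cm]] by auto
    have out: "?m w \<le> ?q w" if w: "w \<in> cball b s" "w \<notin> ball a r" for w
    proof -
      have "?m w = v w" by (rule ms) fact
      also have "\<dots> \<le> disc_solution b s v w" using v s w by (auto simp: subharmonic_on_def)
      also have "\<dots> \<le> ?q w" by (rule disc_solution_mono[OF s(1) cs[OF cv] cs[OF cm] le w(1)])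
      finally show ?thesis .
    qed
    let ?V = "ball a r \<inter> ball b s"
    have cl: "closure ?V \<subseteq> cball a r \<inter> cball b s"
      by (rule closure_minimal) (auto intro: less_imp_le)
    consider "z \<notin> ball a r" | "z \<in> sphere b s" | "z \<in> ?V" using z by force
    then show "?m z \<le> ?q z"
    proof cases
      case 3
      show ?thesis
      proof (rule harmonic_comparison[of ?V])
        show "bounded ?V" by auto
        show "continuous_on (closure ?V) ?m" "continuous_on (closure ?V) ?q"
          using cm q(1) cl sub by (auto intro: continuous_on_subset)
        show "harmonic_on ?q ?V" by (rule harmonic_on_subset[OF q(2)]) auto
        show "harmonic_on ?m ?V"
          by (rule harmonic_on_cong[OF harmonic_on_subset[OF harmonic_on_disc_solution[OF r(1) cvs]]])
             (use md in auto)
        show "z \<in> closure ?V" by (rule subsetD[OF closure_subset 3])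
        fix w assume "w \<in> frontier ?V"
        then have "w \<in> cball a r" "w \<in> cball b s" "w \<notin> ball a r \<or> w \<notin> ball b s"
          using cl by (auto simp: frontier_def interior_open)
        then show "?m w \<le> ?q w" using out[of w] q(3)[of w] by force
      qed
    qed (use out z q(3) in auto)
  qed (rule cm)
qed

section \<open>The Perron family and its supremum\<close>

locale perron =
  fixes W :: "complex set" and \<phi> :: "complex \<Rightarrow> real" and M :: real
  assumes W: "open W" "bounded W" and \<phi>: "continuous_on (frontier W) \<phi>"
    and M: "\<And>z. z \<in> frontier W \<Longrightarrow> \<bar>\<phi> z\<bar> \<le> M" "M > 0"
begin

definition family :: "(complex \<Rightarrow> real) set" where
  "family = {v. subharmonic_on v W \<and> (\<forall>z\<in>frontier W. v z \<le> \<phi> z)}"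

definition solution :: "complex \<Rightarrow> real" where
  "solution z = (SUP v\<in>family. v z)"

lemma family_le:
  assumes "v \<in> family" "z \<in> closure W" shows "v z \<le> M"
  by (rule subharmonic_le_harmonic[OF W, of v "\<lambda>_. M"])
    (use assms W M in \<open>force simp: family_def intro!: harmonic_on_const\<close>)+

lemma le_solution: "v \<in> family \<Longrightarrow> z \<in> closure W \<Longrightarrow> v z \<le> solution z"
  unfolding solution_def by (rule cSUP_upper) (auto intro!: bdd_aboveI[of _ M] family_le)

lemma const_in_family: "(\<lambda>_. - M) \<in> family"
  using M W by (force simp: family_def intro!: harmonic_imp_subharmonic harmonic_on_const)

lemma solution_le: "(\<And>v. v \<in> family \<Longrightarrow> v z \<le> c) \<Longrightarrow> solution z \<le> c"
  unfolding solution_def using const_in_family by (intro cSUP_least) auto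

lemma max_in_family: "u \<in> family \<Longrightarrow> v \<in> family \<Longrightarrow> (\<lambda>z. max (u z) (v z)) \<in> family"
  by (auto simp: family_def subharmonic_max)

lemma modification_in_family:
  assumes "v \<in> family" "r > 0" "cball a r \<subseteq> W"
  shows "poisson_modification a r v \<in> family"
proof -
  have "z \<notin> cball a r" if "z \<in> frontier W" for z
    using assms that W by (auto simp: frontier_def interior_open)
  then show ?thesis
    using assms subharmonic_poisson_modification[OF _ assms(2,3)]
    by (auto simp: family_def poisson_modification_def)
qed

text \<open>The members of the family that are harmonic on \<open>ball a R\<close> and bounded below
  by -M are directed and share a Lipschitz constant on the half ball. By compactness finitely many
  of them, hence a single one, approximate the supremum uniformly there, so the supremum equals its
  own disc solution.\<close>

lemma harmonic_solution_ball:
  assumes R: "R > 0" "cball a R \<subseteq> W"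
  shows "harmonic_on solution (ball a (R/2))"
proof -
  define G where "G = {v\<in>family. (\<forall>z\<in>closure W. - M \<le> v z) \<and>
     (\<exists>F. F holomorphic_on ball a R \<and> (\<forall>z\<in>ball a R. v z = Re (F z)))}"
  have sub: "cball a R \<subseteq> closure W" using R closure_subset by blast
  have above: "\<exists>v'\<in>G. \<forall>z\<in>closure W. v z \<le> v' z" if v: "v \<in> family" for v
  proof -
    let ?w = "\<lambda>z. max (v z) (- M)"
    have w: "?w \<in> family" using max_in_family[OF v const_in_family] .
    then have ws: "subharmonic_on ?w W" by (simp add: family_def)
    then have "continuous_on (sphere a R) ?w"
      unfolding subharmonic_on_def using sub sphere_cball
      by (metis (no_types, lifting) continuous_on_subset subset_trans)
    from disc_solution_Re[OF R(1) this] obtain F where "F holomorphic_on ball a R"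
      "\<And>z. z \<in> ball a R \<Longrightarrow> disc_solution a R ?w z = Re (F z)" by blast
    moreover have "?w z \<le> poisson_modification a R ?w z" for z
      by (rule le_poisson_modification[OF ws R])
    ultimately have "poisson_modification a R ?w \<in> G"
      using modification_in_family[OF w R] unfolding G_def
      by (auto simp: poisson_modification_def[of a R ?w] intro!: exI[of _ F])
    moreover have "v z \<le> poisson_modification a R ?w z" for z
      using le_poisson_modification[OF ws R, of z] by simp
    ultimately show ?thesis by blast
  qed
  have directed: "\<exists>g\<in>G. \<forall>i\<in>I. \<forall>z\<in>closure W. f i z \<le> g z"
    if "finite I" "\<forall>i\<in>I. f i \<in> G" for I :: "complex set" and f
    using that
  proof (induction I)
    case empty
    then show ?case using above[OF const_in_family] by blast
  next
    case (insert i I)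
    then obtain g where g: "g \<in> G" "\<forall>i\<in>I. \<forall>z\<in>closure W. f i z \<le> g z" by blast
    have "f i \<in> family" "g \<in> family" using g insert.prems by (auto simp: G_def)
    from above[OF max_in_family[OF this]] obtain g' where
      "g' \<in> G" "\<forall>z\<in>closure W. max (f i z) (g z) \<le> g' z" by blast
    with g show ?case by (intro bexI[of _ g']) force+
  qed
  \<comment> \<open>Members of G take values between -M and M on the closure, so they oscillate by
    at most 2 M on the ball of radius R / 2 about any point of the half ball.\<close>
  define L where "L = exp 1 * (2 * M) / (R / 2)"
  have "L > 0" using M R by (simp add: L_def)
  let ?B = "cball a (R/2)"
  have BR: "?B \<subseteq> ball a R" using R by auto
  have BW: "?B \<subseteq> closure W" using BR sub ball_subset_cball by blast
  have lip: "v z \<le> v w + L * dist z w" if v: "v \<in> G" and zw: "z \<in> ?B" "w \<in> ?B" for v z w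
  proof -
    obtain F where F: "F holomorphic_on ball a R" "\<And>z. z \<in> ball a R \<Longrightarrow> v z = Re (F z)"
      using v unfolding G_def by blast
    have "norm (deriv F x) \<le> L" if x: "x \<in> ?B" for x
      unfolding L_def
    proof (rule gradient_bound)
      have sub': "ball x (R/2) \<subseteq> ball a R"
      proof
        fix y assume "y \<in> ball x (R/2)"
        then show "y \<in> ball a R" using x dist_triangle[of a y x] by simp
      qed
      then show "F holomorphic_on ball x (R/2)" using F by (auto intro: holomorphic_on_subset)
      fix y assume "y \<in> ball x (R/2)"
      then have y: "y \<in> ball a R" "x \<in> ball a R" using sub' x BR by auto
      then have yW: "y \<in> closure W" "x \<in> closure W" using sub ball_subset_cball by blast+
      have "v y \<le> M" "- M \<le> v x" using v yW family_le by (auto simp: G_def)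
      then show "Re (F y) - Re (F x) \<le> 2 * M" using F(2) y by simp
    qed (use M R in auto)
    moreover have "(F has_field_derivative deriv F x) (at x within ?B)" if "x \<in> ?B" for x
      by (rule has_field_derivative_at_within[OF holomorphic_derivI[OF F(1) open_ball]]) (use BR that in blast)
    ultimately have "norm (F z - F w) \<le> L * norm (z - w)"
      using field_differentiable_bound[OF convex_cball, of a "R/2" F "deriv F" L z w] zw by blast
    moreover have "v z = Re (F z)" "v w = Re (F w)" using zw BR by (auto intro!: F(2))
    moreover have "Re (F z) - Re (F w) \<le> norm (F z - F w)" using complex_Re_le_cmod[of "F z - F w"] by simp
    ultimately show ?thesis by (simp add: dist_norm)
  qed
  have ulip: "solution z \<le> solution w + L * dist z w" if zw: "z \<in> ?B" "w \<in> ?B" for z w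
  proof (rule solution_le)
    fix v assume "v \<in> family"
    then obtain v' where v': "v' \<in> G" "v z \<le> v' z" using above zw BW by blast
    moreover have "v' w \<le> solution w" using v' zw BW by (intro le_solution) (auto simp: G_def)
    ultimately show "v z \<le> solution w + L * dist z w" using lip[OF v'(1) zw] by linarith
  qed
  have approx: "\<exists>v\<in>G. \<forall>z\<in>?B. solution z - e \<le> v z" if e: "e > 0" for e
  proof -
    \<comment> \<open>A quarter of e is spent on each of three errors: moving the supremum to the
      net point i, choosing f i there, and moving f i back to z.\<close>
    define \<delta> where "\<delta> = e / (4 * L)"
    have \<delta>: "\<delta> > 0" "L * \<delta> = e / 4" using e \<open>L > 0\<close> by (auto simp: \<delta>_def)
    have "\<exists>v\<in>G. solution z - e / 4 \<le> v z" if z: "z \<in> ?B" for z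
    proof (rule ccontr)
      assume neg: "\<not> ?thesis"
      have "solution z \<le> solution z - e / 4"
      proof (rule solution_le)
        fix v assume "v \<in> family"
        then obtain v' where "v' \<in> G" "v z \<le> v' z" using above z BW by blast
        then show "v z \<le> solution z - e / 4" using neg by force
      qed
      then show False using e by simp
    qed
    then obtain f where f: "\<And>z. z \<in> ?B \<Longrightarrow> f z \<in> G \<and> solution z - e / 4 \<le> f z z" by metis
    have cB: "compact ?B" by simp
    have cov: "?B \<subseteq> (\<Union>z\<in>?B. ball z \<delta>)" using \<delta> by force
    obtain I where I: "I \<subseteq> ?B" "finite I" "?B \<subseteq> (\<Union>z\<in>I. ball z \<delta>)"
      by (rule compactE_image[OF cB open_ball cov])
    have "\<forall>i\<in>I. f i \<in> G" using f I by blast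
    from directed[OF I(2) this] obtain g where g0: "g \<in> G" "\<forall>i\<in>I. \<forall>z\<in>closure W. f i z \<le> g z"
      by blast
    note g = g0(1) bspec[OF bspec[OF g0(2)]]
    have "solution z - e \<le> g z" if z: "z \<in> ?B" for z
    proof -
      obtain i where i: "i \<in> I" "z \<in> ball i \<delta>" using I z by blast
      then have iB: "i \<in> ?B" using I by blast
      have d: "L * dist z i \<le> e / 4" "L * dist i z \<le> e / 4"
        using mult_left_mono[of "dist i z" \<delta> L] i \<delta> \<open>L > 0\<close> by (auto simp: dist_commute)
      have "solution z \<le> solution i + e / 4" using ulip[OF z iB] d by linarith
      also have "\<dots> \<le> f i i + e / 4 + e / 4" using f[OF iB] by linarith
      also have "\<dots> \<le> f i z + e / 4 + e / 4 + e / 4" using lip[OF _ iB z, of "f i"] f[OF iB] d by simp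
      also have "\<dots> \<le> g z + e / 4 + e / 4 + e / 4" using g(2)[OF i(1), of z] z BW by auto
      finally show ?thesis using e by linarith
    qed
    with g show ?thesis by blast
  qed
  have usub: "v z \<le> solution z" if "v \<in> G" "z \<in> ?B" for v z
    using that BW by (intro le_solution) (auto simp: G_def)
  have ucont: "continuous_on ?B solution"
  proof (rule continuous_onI)
    fix z e assume z: "z \<in> ?B" and e: "(e::real) > 0"
    show "\<exists>d>0. \<forall>x'\<in>?B. dist x' z < d \<longrightarrow> dist (solution x') (solution z) \<le> e"
    proof (intro exI[of _ "e / L"] conjI ballI impI)
      fix w assume w: "w \<in> ?B" "dist w z < e / L"
      then have "L * dist w z < e" "L * dist z w < e" using \<open>L > 0\<close> by (simp_all add: field_simps dist_commute)
      then show "dist (solution w) (solution z) \<le> e"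
        using ulip[OF z w(1)] ulip[OF w(1) z] by (simp add: dist_real_def)
    qed (use e \<open>L > 0\<close> in auto)
  qed
  have R2: "R / 2 > 0" using R by simp
  have ucs: "continuous_on (sphere a (R/2)) solution" by (rule continuous_on_subset[OF ucont]) auto
  have "solution z = disc_solution a (R/2) solution z" if z: "z \<in> ?B" for z
  proof -
    \<comment> \<open>With v \<le> solution \<le> v + e on the half ball, both the solution at z and
      its disc solution lie between v z and v z + e.\<close>
    have "\<bar>solution z - disc_solution a (R/2) solution z\<bar> \<le> e" if e: "e > 0" for e
    proof -
      obtain v where v: "v \<in> G" "\<And>z. z \<in> ?B \<Longrightarrow> solution z - e \<le> v z" using approx[OF e] by blast
      obtain F where F: "F holomorphic_on ball a R" "\<And>z. z \<in> ball a R \<Longrightarrow> v z = Re (F z)"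
        using v unfolding G_def by blast
      have hv: "harmonic_on v (ball a R)" by (rule harmonic_on_Re[OF _ F]) auto
      have hv': "harmonic_on v (ball a (R/2))" by (rule harmonic_on_subset[OF hv]) (use R in auto)
      have cv: "continuous_on ?B v"
        using harmonic_on_imp_continuous_on[OF hv] BR continuous_on_subset by blast
      have cvs: "continuous_on (sphere a (R/2)) v" by (rule continuous_on_subset[OF cv]) auto
      have "disc_solution a (R/2) v z = v z" by (rule disc_solution_unique[OF R2 cv hv' _ z]) auto
      moreover have "disc_solution a (R/2) (\<lambda>z. v z + e) z = v z + e"
        by (rule disc_solution_unique[OF R2 _ _ _ z])
          (use cv hv' in \<open>auto intro!: continuous_intros harmonic_on_add harmonic_on_const\<close>)
      moreover have "disc_solution a (R/2) v z \<le> disc_solution a (R/2) solution z"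
        by (rule disc_solution_mono[OF R2 cvs ucs _ z]) (use usub[OF v(1)] in auto)
      moreover have "disc_solution a (R/2) solution z \<le> disc_solution a (R/2) (\<lambda>z. v z + e) z"
        by (rule disc_solution_mono[OF R2 ucs _ _ z])
          (use v(2) cvs in \<open>force intro!: continuous_intros simp: algebra_simps\<close>)+
      ultimately show ?thesis using usub[OF v(1) z] v(2)[OF z] by linarith
    qed
    then have "\<bar>solution z - disc_solution a (R/2) solution z\<bar> \<le> 0" by (rule field_le_epsilon) simp
    then show ?thesis by simp
  qed
  then show ?thesis
    by (intro harmonic_on_cong[OF harmonic_on_disc_solution[OF R2 ucs]]) auto
qed

lemma harmonic_solution: "harmonic_on solution W"
proof (rule harmonic_on_locally[OF W(1)])
  fix z assume "z \<in> W"
  then obtain R where R: "R > 0" "cball z R \<subseteq> W" using W open_contains_cball by blast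
  then show "\<exists>V. z \<in> V \<and> V \<subseteq> W \<and> harmonic_on solution V"
    using harmonic_solution_ball[OF R] by (intro exI[of _ "ball z (R/2)"]) (auto simp: subset_iff)
qed

text \<open>Near w the oscillation of \<phi> is below e, and elsewhere on the frontier b has a
  positive lower bound, so a large multiple of b absorbs it. Then \<phi> w - e - C b belongs to the
  family and \<phi> w + e + C b majorises every member.\<close>

lemma solution_at_barrier:
  assumes w: "w \<in> frontier W" and b: "continuous_on (closure W) b" "harmonic_on b W" "b w = 0"
    "\<And>z. z \<in> closure W \<Longrightarrow> z \<noteq> w \<Longrightarrow> b z > 0" and e: "e > 0"
  shows "\<exists>C\<ge>0. (\<forall>z\<in>frontier W. \<bar>\<phi> z - \<phi> w\<bar> \<le> e + C * b z) \<and> (\<forall>z\<in>W. \<bar>solution z - \<phi> w\<bar> \<le> e + C * b z)"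
proof -
  have fW: "frontier W \<subseteq> closure W" "compact (frontier W)"
    using W by (auto simp: frontier_def compact_frontier_bounded[unfolded frontier_def])
  have bn: "b z \<ge> 0" if "z \<in> closure W" for z using b(3,4) that by (metis less_imp_le order_refl)
  obtain d where d: "d > 0" "\<And>z. z \<in> frontier W \<Longrightarrow> dist z w < d \<Longrightarrow> dist (\<phi> z) (\<phi> w) < e"
    using \<phi> w e unfolding continuous_on_iff by metis
  have "\<exists>\<beta>>0. \<forall>z\<in>frontier W - ball w d. \<beta> \<le> b z"
  proof (cases "frontier W - ball w d = {}")
    case False
    have "compact (frontier W - ball w d)" using fW by (simp add: compact_diff)
    moreover have "continuous_on (frontier W - ball w d) b"
      by (rule continuous_on_subset[OF b(1)]) (use fW in blast)
    ultimately obtain x where x: "x \<in> frontier W - ball w d" "\<forall>z\<in>frontier W - ball w d. b x \<le> b z"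
      using continuous_attains_inf[OF _ False] by blast
    then have "b x > 0" using fW d by (intro b(4)) auto
    with x show ?thesis by blast
  qed (use zero_less_one in blast)
  then obtain \<beta> where \<beta>: "\<beta> > 0" "\<And>z. z \<in> frontier W - ball w d \<Longrightarrow> \<beta> \<le> b z" by blast
  \<comment> \<open>Away from w, \<phi> differs from \<phi> w by at most 2 M while b is at least
    \<beta>.\<close>
  define C where "C = 2 * M / \<beta>"
  have C: "C \<ge> 0" using M \<beta> by (simp add: C_def)
  have F: "\<bar>\<phi> z - \<phi> w\<bar> \<le> e + C * b z" if z: "z \<in> frontier W" for z
  proof (cases "dist z w < d")
    case True
    then show ?thesis using d(2)[OF z] C bn[of z] z fW by (smt (verit) dist_real_def mult_nonneg_nonneg subsetD)
  next
    case False
    then have "\<beta> \<le> b z" using z by (intro \<beta>(2)) (auto simp: dist_commute)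
    then have "C * \<beta> \<le> C * b z" using C by (rule mult_left_mono)
    moreover have "C * \<beta> = 2 * M" using \<beta> by (simp add: C_def)
    ultimately show ?thesis using M(1)[OF z] M(1)[OF w] e by linarith
  qed
  have "\<bar>solution z - \<phi> w\<bar> \<le> e + C * b z" if z: "z \<in> W" for z
  proof -
    have zc: "z \<in> closure W" using z closure_subset by blast
    let ?v = "\<lambda>z. \<phi> w - e - C * b z" and ?h = "\<lambda>z. \<phi> w + e + C * b z"
    have "?v \<in> family" unfolding family_def
    proof (intro CollectI conjI ballI)
      show "subharmonic_on ?v W"
        by (intro harmonic_imp_subharmonic continuous_intros b harmonic_on_diff harmonic_on_cmult harmonic_on_const W)
      show "?v x \<le> \<phi> x" if "x \<in> frontier W" for x using F[OF that] by linarith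
    qed
    from le_solution[OF this zc] have "?v z \<le> solution z" .
    moreover have "solution z \<le> ?h z"
    proof (rule solution_le)
      fix v assume v: "v \<in> family"
      show "v z \<le> ?h z"
      proof (rule subharmonic_le_harmonic[OF W])
        show "v x \<le> ?h x" if "x \<in> frontier W" for x
          using F[OF that] v that unfolding family_def by force
      qed (use v zc b W in \<open>auto simp: family_def intro!: continuous_intros harmonic_on_add harmonic_on_cmult harmonic_on_const\<close>)
    qed
    ultimately show ?thesis by linarith
  qed
  with C F show ?thesis by blast
qed

end

text \<open>The Perron solution is replaced by \<phi> off W. At a frontier point the barrier
  estimate holds for approach from within W and along the frontier alike, and b tends to 0
  there.\<close>

theorem dirichlet_problem_bounded:
  fixes \<phi> :: "complex \<Rightarrow> real"
  assumes W: "open W" "bounded W" and \<phi>: "continuous_on (frontier W) \<phi>"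
    and barrier: "\<And>w. w \<in> frontier W \<Longrightarrow> \<exists>b. continuous_on (closure W) b \<and> harmonic_on b W \<and> b w = 0 \<and>
                       (\<forall>z\<in>closure W - {w}. b z > 0)"
  shows "\<exists>h. continuous_on (closure W) h \<and> harmonic_on h W \<and> (\<forall>z\<in>frontier W. h z = \<phi> z)"
proof -
  have "compact (\<phi> ` frontier W)"
    using W by (intro compact_continuous_image \<phi> compact_frontier_bounded)
  then obtain M where M: "M > 0" "\<And>z. z \<in> frontier W \<Longrightarrow> \<bar>\<phi> z\<bar> \<le> M"
    using compact_imp_bounded bounded_pos by (metis imageI real_norm_def)
  interpret perron W \<phi> M by unfold_locales (use assms M in auto)
  define h where "h = (\<lambda>z. if z \<in> W then solution z else \<phi> z)"
  have fr: "z \<in> frontier W" if "z \<in> closure W" "z \<notin> W" for z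
    using that W by (simp add: frontier_def interior_open)
  have hh: "harmonic_on h W" by (rule harmonic_on_cong[OF harmonic_solution]) (simp add: h_def)
  moreover have hf: "\<forall>z\<in>frontier W. h z = \<phi> z"
    using W by (auto simp: h_def frontier_def interior_open)
  moreover have "continuous_on (closure W) h"
    unfolding continuous_on_eq_continuous_within
  proof
    fix w assume w: "w \<in> closure W"
    show "continuous (at w within closure W) h"
    proof (cases "w \<in> W")
      case True
      then have "isCont h w"
        using harmonic_on_imp_continuous_on[OF hh] W continuous_on_eq_continuous_at by blast
      then show ?thesis by (rule continuous_at_imp_continuous_within)
    next
      case False
      then have wf: "w \<in> frontier W" using w fr by blast
      obtain b where b: "continuous_on (closure W) b" "harmonic_on b W" "b w = 0"
        "\<And>z. z \<in> closure W \<Longrightarrow> z \<noteq> w \<Longrightarrow> b z > 0" using barrier[OF wf] by blast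
      show ?thesis unfolding continuous_within_eps_delta
      proof (intro allI impI)
        fix e :: real assume e: "e > 0"
        obtain C where C: "C \<ge> 0" "\<And>z. z \<in> frontier W \<Longrightarrow> \<bar>\<phi> z - \<phi> w\<bar> \<le> e / 2 + C * b z"
          "\<And>z. z \<in> W \<Longrightarrow> \<bar>solution z - \<phi> w\<bar> \<le> e / 2 + C * b z"
          using solution_at_barrier[OF wf b, of "e / 2"] e by auto
        have "continuous (at w within closure W) (\<lambda>z. C * b z)"
          using b(1) w unfolding continuous_on_eq_continuous_within by (intro continuous_intros) auto
        then obtain d where d: "d > 0" "\<And>z. z \<in> closure W \<Longrightarrow> dist z w < d \<Longrightarrow> dist (C * b z) (C * b w) < e / 2"
          unfolding continuous_within_eps_delta using e by (metis half_gt_zero)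
        have "dist (h z) (h w) < e" if z: "z \<in> closure W" "dist z w < d" for z
        proof -
          have "C * b z < e / 2" using d(2)[OF z] b(3) by (simp add: dist_real_def)
          moreover have "\<bar>h z - \<phi> w\<bar> \<le> e / 2 + C * b z"
            using C(2)[of z] C(3)[of z] fr[OF z(1)] by (auto simp: h_def)
          moreover have "h w = \<phi> w" using False by (simp add: h_def)
          ultimately show ?thesis by (simp add: dist_real_def)
        qed
        then show "\<exists>d>0. \<forall>x'\<in>closure W. dist x' w < d \<longrightarrow> dist (h x') (h w) < e" using d(1) by blast
      qed
    qed
  qed
  ultimately show ?thesis by blast
qed

subsection \<open>Regular neighbourhoods of compact sets\<close>

text \<open>The substitution \<open>\<zeta> \<mapsto> z0 + 1 / \<zeta>\<close> moves the exterior of \<open>J\<close> to a bounded open set. The point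
  \<open>\<zeta> = 0\<close> corresponds to infinity; it needs separate treatment since \<open>1 / 0 = 0\<close>.\<close>

lemma exterior_dirichlet_problem:
  fixes \<phi> :: "complex \<Rightarrow> real"
  assumes J: "compact J" and z0: "z0 \<in> interior J"
    and disc: "\<And>p. p \<in> frontier J \<Longrightarrow> \<exists>x. x \<noteq> p \<and> cball x (dist x p) \<subseteq> J"
    and \<phi>: "continuous_on (frontier J) \<phi>"
  shows "\<exists>h L. continuous_on (closure (- J)) h \<and> bounded (h ` (- J)) \<and> harmonic_on h (- J) \<and>
               (\<forall>z\<in>frontier J. h z = \<phi> z) \<and> (h \<longlongrightarrow> L) at_infinity"
proof -
  define i where "i = (\<lambda>\<zeta>. z0 + 1 / \<zeta>)"
  define j where "j = (\<lambda>z. 1 / (z - z0))"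
  have ij: "i (j z) = z" if "z \<noteq> z0" for z using that by (simp add: i_def j_def)
  have ji: "j (i \<zeta>) = \<zeta>" for \<zeta> by (simp add: i_def j_def)
  have z0J: "z0 \<in> J" using z0 interior_subset by blast
  have cJ: "closed J" using J by (rule compact_imp_closed)
  have conti: "continuous_on (- {0}) i" unfolding i_def by (intro continuous_intros) auto
  obtain \<rho> where \<rho>: "\<rho> > 0" "ball z0 \<rho> \<subseteq> J" using z0 by (auto simp: mem_interior)
  obtain B where B: "B > 0" "\<And>z. z \<in> J \<Longrightarrow> dist z0 z \<le> B"
  proof -
    obtain B where "\<forall>z\<in>J. dist z0 z \<le> B"
      using compact_imp_bounded[OF J] bounded_any_center[of J z0] by blast
    then show ?thesis by (intro that[of "max B 1"]) force+
  qed
  define W where "W = {\<zeta>. \<zeta> = 0 \<or> i \<zeta> \<notin> J}"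
  \<comment> \<open>This gives openness of W at 0: for 0 < |\<zeta>| < 1 / B the point i \<zeta> has
    distance more than B from z0 and so is off J.\<close>
  have "W = ball 0 (1 / B) \<union> (- {0} \<inter> i -` (- J))"
  proof (intro set_eqI iffI)
    fix \<zeta> assume "\<zeta> \<in> ball 0 (1 / B) \<union> (- {0} \<inter> i -` (- J))"
    moreover have "i \<zeta> \<notin> J" if "norm \<zeta> < 1 / B" "\<zeta> \<noteq> 0"
    proof
      assume "i \<zeta> \<in> J"
      then have "1 / norm \<zeta> \<le> B" using B(2) by (fastforce simp: i_def dist_norm norm_divide)
      then show False using that B by (simp add: field_simps)
    qed
    ultimately show "\<zeta> \<in> W" by (auto simp: W_def)
  qed (use B in \<open>auto simp: W_def\<close>)
  moreover have "open (- {0} \<inter> i -` (- J))"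
    by (rule continuous_open_preimage[OF conti]) (use cJ in auto)
  ultimately have oW: "open W" by auto
  have bW: "bounded W"
  proof (rule boundedI[of _ "1 / \<rho>"])
    fix \<zeta> assume "\<zeta> \<in> W"
    show "norm \<zeta> \<le> 1 / \<rho>"
    proof (cases "\<zeta> = 0")
      case False
      then have "i \<zeta> \<notin> ball z0 \<rho>" using \<open>\<zeta> \<in> W\<close> \<rho> by (auto simp: W_def)
      then have "\<rho> \<le> 1 / norm \<zeta>" by (simp add: i_def dist_norm norm_divide)
      then show ?thesis using False \<rho> by (simp add: field_simps)
    qed (use \<rho> in auto)
  qed
  have clW: "\<zeta> = 0 \<or> i \<zeta> \<notin> interior J" if "\<zeta> \<in> closure W" for \<zeta>
  proof -
    have "open (- {0} \<inter> i -` interior J)"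
      by (rule continuous_open_preimage[OF conti]) auto
    then have "closed (- (- {0} \<inter> i -` interior J))" by (rule closed_Compl)
    moreover have "W \<subseteq> - (- {0} \<inter> i -` interior J)" using interior_subset by (auto simp: W_def)
    ultimately have "closure W \<subseteq> - (- {0} \<inter> i -` interior J)" by (rule closure_minimal[rotated])
    then show ?thesis using that by auto
  qed
  have frW: "\<zeta> \<noteq> 0 \<and> i \<zeta> \<in> frontier J" if "\<zeta> \<in> frontier W" for \<zeta>
  proof -
    have "\<zeta> \<in> closure W" "\<zeta> \<notin> W" using that oW by (auto simp: frontier_def interior_open)
    then show ?thesis using clW[of \<zeta>] cJ by (auto simp: W_def frontier_def)
  qed
  have clJ: "z \<noteq> z0" if "z \<in> closure (- J)" for z using that z0 by (auto simp: closure_complement)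
  have contj: "continuous_on (closure (- J)) j"
    unfolding j_def using clJ by (intro continuous_intros) auto
  have jW: "j z \<in> W" if "z \<notin> J" for z
  proof -
    have "z \<noteq> z0" using that z0J by blast
    then show ?thesis using that ij[of z] by (simp add: W_def)
  qed
  have jcl: "j ` closure (- J) \<subseteq> closure W"
    by (rule image_closure_subset[OF contj]) (use jW closure_subset[of W] in auto)
  have jfr: "j z \<in> frontier W" if z: "z \<in> frontier J" for z
  proof -
    have zc: "z \<in> closure (- J)" using z by (simp add: frontier_closures)
    have "z \<in> J" using z cJ frontier_subset_closed by blast
    moreover have "z \<noteq> z0" using clJ zc by blast
    ultimately have "j z \<notin> W" using ij[of z] by (auto simp: W_def j_def)
    moreover have "j z \<in> closure W" using jcl zc by blast
    ultimately show ?thesis using oW by (simp add: frontier_def interior_open)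
  qed
  have "\<exists>h. continuous_on (closure W) h \<and> harmonic_on h W \<and> (\<forall>\<zeta>\<in>frontier W. h \<zeta> = \<phi> (i \<zeta>))"
  proof (rule dirichlet_problem_bounded[OF oW bW])
    show "continuous_on (frontier W) (\<lambda>\<zeta>. \<phi> (i \<zeta>))"
      by (rule continuous_on_compose2[OF \<phi> continuous_on_subset[OF conti]]) (use frW in auto)
    fix w assume w: "w \<in> frontier W"
    have w0: "w \<noteq> 0" and pJ: "i w \<in> frontier J" using frW[OF w] by auto
    define p where "p = i w"
    obtain x where x: "x \<noteq> p" "cball x (dist x p) \<subseteq> J" using disc[OF pJ] unfolding p_def by blast
    have out: "dist x p \<le> dist x (i \<zeta>)" "1 + (z0 - x) * \<zeta> \<noteq> 0" if "\<zeta> \<in> closure W" "\<zeta> \<noteq> 0" for \<zeta>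
    proof -
      have "ball x (dist x p) \<subseteq> interior J"
        by (rule interior_maximal) (use x(2) ball_subset_cball in auto)
      then have "i \<zeta> \<notin> ball x (dist x p)" using clW[OF that(1)] that(2) by blast
      then show *: "dist x p \<le> dist x (i \<zeta>)" by simp
      have "1 + (z0 - x) * \<zeta> = \<zeta> * (i \<zeta> - x)" using that(2) by (simp add: i_def algebra_simps)
      moreover have "i \<zeta> \<noteq> x" using * x(1) by auto
      ultimately show "1 + (z0 - x) * \<zeta> \<noteq> 0" using that(2) by simp
    qed
    have nz: "1 + (z0 - x) * \<zeta> \<noteq> 0" if "\<zeta> \<in> closure W" for \<zeta>
      using out(2)[OF that] by (cases "\<zeta> = 0") auto
    have quo: "(p - x) * \<zeta> / (1 + (z0 - x) * \<zeta>) = (p - x) / (i \<zeta> - x)" if "\<zeta> \<noteq> 0" for \<zeta>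
    proof -
      have "1 + (z0 - x) * \<zeta> = (i \<zeta> - x) * \<zeta>" using that by (simp add: i_def algebra_simps)
      then show ?thesis using that by simp
    qed
    \<comment> \<open>In the coordinate z = i \<zeta> the barrier is 1 - Re ((p - x) / (z - x)).
      Since z is no closer to x than p, the quotient has modulus at most 1, and its real part is 1
      only at z = p. Clearing the denominator \<zeta> extends the formula to \<zeta> = 0, where the
      barrier is 1.\<close>
    let ?q = "\<lambda>\<zeta>. 1 - (p - x) * \<zeta> / (1 + (z0 - x) * \<zeta>)"
    show "\<exists>b. continuous_on (closure W) b \<and> harmonic_on b W \<and> b w = 0 \<and> (\<forall>z\<in>closure W - {w}. b z > 0)"
    proof (intro exI[of _ "\<lambda>\<zeta>. Re (?q \<zeta>)"] conjI ballI)
      show "continuous_on (closure W) (\<lambda>\<zeta>. Re (?q \<zeta>))"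
        by (intro continuous_intros) (use nz in auto)
      show "harmonic_on (\<lambda>\<zeta>. Re (?q \<zeta>)) W"
        by (rule harmonic_on_Re[OF oW, of ?q])
          (use nz closure_subset[of W] in \<open>auto intro!: holomorphic_intros\<close>)
      show "Re (?q w) = 0" unfolding quo[OF w0] using x(1) by (simp add: p_def)
      fix \<zeta> assume \<zeta>: "\<zeta> \<in> closure W - {w}"
      show "Re (?q \<zeta>) > 0"
      proof (cases "\<zeta> = 0")
        case False
        let ?y = "(p - x) / (i \<zeta> - x)"
        have "norm ?y \<le> 1"
          using out(1)[of \<zeta>] False \<zeta> x(1) by (simp add: norm_divide dist_norm norm_minus_commute divide_le_eq)
        have "Re ?y < 1"
        proof (rule ccontr)
          assume "\<not> Re ?y < 1"
          then have "Re ?y = 1" using complex_Re_le_cmod[of ?y] \<open>norm ?y \<le> 1\<close> by linarith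
          then have "1 + (Im ?y)\<^sup>2 \<le> 1"
            using \<open>norm ?y \<le> 1\<close> power_le_one[of "norm ?y" 2] unfolding cmod_power2 by simp
          then have "?y = 1" using \<open>Re ?y = 1\<close> by (simp add: complex_eq_iff)
          then have "i \<zeta> = i w" using x(1) by (simp add: p_def divide_eq_1_iff) 
          then show False using ji \<zeta> by (metis DiffD2 singletonI)
        qed
        then show ?thesis using quo[OF False] by simp
      qed simp
    qed
  qed
  then obtain h where h: "continuous_on (closure W) h" "harmonic_on h W" "\<And>\<zeta>. \<zeta> \<in> frontier W \<Longrightarrow> h \<zeta> = \<phi> (i \<zeta>)"
    by blast
  show ?thesis
  proof (intro exI[of _ "\<lambda>z. h (j z)"] exI[of _ "h 0"] conjI ballI)
    show "continuous_on (closure (- J)) (\<lambda>z. h (j z))"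
      by (rule continuous_on_compose2[OF h(1) contj jcl])
    have "bounded (h ` closure W)"
      using bW by (intro compact_imp_bounded compact_continuous_image h(1)) (simp add: compact_closure)
    then show "bounded ((\<lambda>z. h (j z)) ` (- J))"
      by (rule bounded_subset) (use jW closure_subset[of W] in auto)
    show "harmonic_on (\<lambda>z. h (j z)) (- J)"
      by (rule harmonic_on_compose[OF h(2)])
        (use z0J cJ jW in \<open>auto simp: j_def intro!: holomorphic_intros\<close>)
    show "h (j z) = \<phi> z" if "z \<in> frontier J" for z
    proof -
      have "z \<noteq> z0" using that clJ by (auto simp: frontier_closures)
      then show ?thesis using h(3)[OF jfr[OF that]] ij by simp
    qed
    have "0 \<in> W" by (simp add: W_def)
    then have "isCont h 0"
      using harmonic_on_imp_continuous_on[OF h(2)] oW continuous_on_eq_continuous_at by blast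
    moreover have "(j \<longlongrightarrow> 0) at_infinity"
    proof -
      have "filterlim (\<lambda>z. z - z0) at_infinity at_infinity"
        using tendsto_add_filterlim_at_infinity'[OF filterlim_ident tendsto_const, of "- z0"] by simp
      from filterlim_compose[OF tendsto_inverse_0 this] show ?thesis by (simp add: j_def inverse_eq_divide)
    qed
    ultimately show "((\<lambda>z. h (j z)) \<longlongrightarrow> h 0) at_infinity" by (rule isCont_tendsto_compose)
  qed
qed

text \<open>A disc inside J touching each frontier point supplies the barriers. The Green's function
  is ln |z - z0| minus the bounded harmonic function with the same boundary values; the limit L of
  the latter at infinity is the logarithm of t.\<close>

lemma
  assumes J: "compact J" "interior J \<noteq> {}"
    and disc: "\<And>p. p \<in> frontier J \<Longrightarrow> \<exists>x. x \<noteq> p \<and> cball x (dist x p) \<subseteq> J"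
  shows dirichlet_regular_interior_disc: "dirichlet_regular J"
    and greens_function_interior_disc: "\<exists>g t. greens_function g J t"
proof -
  obtain z0 where z0: "z0 \<in> interior J" using J by blast
  note ext = exterior_dirichlet_problem[OF J(1) z0 disc]
  show "dirichlet_regular J" unfolding dirichlet_regular_def using ext by blast
  have cJ: "closed J" using J by (simp add: compact_imp_closed)
  have z0J: "z0 \<in> J" using z0 interior_subset by blast
  have clJ: "z \<noteq> z0" if "z \<in> closure (- J)" for z using that z0 by (auto simp: closure_complement)
  have cln: "continuous_on (closure (- J)) (\<lambda>z. ln (norm (z - z0)))"
    using clJ by (intro continuous_intros) auto
  have "continuous_on (frontier J) (\<lambda>z. ln (norm (z - z0)))"
    by (rule continuous_on_subset[OF cln]) (simp add: frontier_closures)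
  from ext[OF _ this] obtain h L where h: "continuous_on (closure (- J)) h" "harmonic_on h (- J)"
    "\<And>z. z \<in> frontier J \<Longrightarrow> h z = ln (norm (z - z0))" "(h \<longlongrightarrow> L) at_infinity" by blast
  define g where "g = (\<lambda>z. if z \<in> J then 0 else ln (norm (z - z0)) - h z)"
  have "greens_function g J (exp L)" unfolding greens_function_def
  proof (intro conjI ballI)
    have "continuous_on (J \<union> closure (- J)) g" unfolding g_def
    proof (rule continuous_on_cases[OF cJ])
      show "\<forall>x. x \<in> J \<and> x \<notin> J \<or> x \<in> closure (- J) \<and> x \<in> J \<longrightarrow> 0 = ln (norm (x - z0)) - h x"
        using h(3) cJ by (auto simp: frontier_closures)
    qed (auto intro!: continuous_on_diff cln h)
    moreover have "J \<union> closure (- J) = UNIV" using closure_subset[of "- J"] by auto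
    ultimately show "continuous_on UNIV g" by simp
    have "harmonic_on (\<lambda>z. ln (norm (z - z0)) - h z) (- J)"
      by (intro harmonic_on_diff harmonic_on_ln_norm h(2)) (use cJ z0J in \<open>auto intro!: holomorphic_intros\<close>)
    then show "harmonic_on g (- J)" by (rule harmonic_on_cong) (simp add: g_def)
    have "((\<lambda>z. ln (norm (1 - z0 / z)) - h z + L) \<longlongrightarrow> ln (norm (1 - 0 :: complex)) - L + L) at_infinity"
      by (intro tendsto_intros h(4) tendsto_divide_0[OF tendsto_const filterlim_ident]) auto
    then have lim: "((\<lambda>z. ln (norm (1 - z0 / z)) - h z + L) \<longlongrightarrow> 0) at_infinity" by simp
    have "bounded J" using J by (simp add: compact_imp_bounded)
    then obtain B where B: "\<And>z. z \<in> J \<Longrightarrow> norm z \<le> B" unfolding bounded_iff by blast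
    show "((\<lambda>z. g z - (ln (norm z) - ln (exp L))) \<longlongrightarrow> 0) at_infinity"
    proof (rule Lim_transform_eventually[OF lim])
      show "\<forall>\<^sub>F z in at_infinity. ln (norm (1 - z0 / z)) - h z + L = g z - (ln (norm z) - ln (exp L))"
        unfolding eventually_at_infinity
      proof (intro exI[of _ "max B (norm z0) + 1"] allI impI)
        fix z :: complex assume z: "max B (norm z0) + 1 \<le> norm z"
        then have "z \<notin> J" "z \<noteq> 0" "z \<noteq> z0" using B[of z] norm_ge_zero[of z0] by (auto simp del: norm_ge_zero)
        moreover from this have "1 - z0 / z = (z - z0) / z" by (simp add: field_simps)
        ultimately show "ln (norm (1 - z0 / z)) - h z + L = g z - (ln (norm z) - ln (exp L))"
          by (simp add: g_def norm_divide ln_div)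
      qed
    qed
  qed (auto simp: g_def)
  then show "\<exists>g t. greens_function g J t" by blast
qed

text \<open>A frontier point of a finite union of closed discs lies on the bounding circle of every
  disc of the union that contains it, so the centre of such a disc witnesses the interior disc
  condition.\<close>

theorem regular_neighbourhood:
  fixes K V :: "complex set"
  assumes K: "compact K" "K \<noteq> {}" and V: "open V" "K \<subseteq> V"
  shows "\<exists>J g t. compact J \<and> K \<subseteq> J \<and> J \<subseteq> V \<and> dirichlet_regular J \<and> greens_function g J t"
proof -
  have "\<forall>x\<in>K. \<exists>r>0. cball x r \<subseteq> V" using V open_contains_cball by blast
  then obtain r where r: "\<And>x. x \<in> K \<Longrightarrow> r x > 0" "\<And>x. x \<in> K \<Longrightarrow> cball x (r x) \<subseteq> V" by metis
  have cov: "K \<subseteq> (\<Union>x\<in>K. ball x (r x))" using r by force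
  obtain I where I: "I \<subseteq> K" "finite I" "K \<subseteq> (\<Union>x\<in>I. ball x (r x))"
    by (rule compactE_image[OF K(1) open_ball cov])
  define J where "J = (\<Union>x\<in>I. cball x (r x))"
  have cJ: "compact J" unfolding J_def using I by (intro compact_UN) auto
  have ballI: "ball x (r x) \<subseteq> interior J" if "x \<in> I" for x
    by (rule interior_maximal) (use that in \<open>force simp: J_def\<close>)+
  have KJ: "K \<subseteq> J" using I(3) ballI interior_subset[of J] by blast
  have JV: "J \<subseteq> V" unfolding J_def using r(2) I(1) by blast
  have int: "interior J \<noteq> {}"
  proof -
    obtain x where x: "x \<in> I" using I(3) K(2) by blast
    then have "r x > 0" using I(1) r(1) by blast
    then have "x \<in> interior J" using ballI[OF x] by (meson centre_in_ball subsetD)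
    then show ?thesis by blast
  qed
  have disc: "\<exists>x. x \<noteq> p \<and> cball x (dist x p) \<subseteq> J" if p: "p \<in> frontier J" for p
  proof -
    have "p \<in> J" "p \<notin> interior J" using p cJ frontier_subset_closed[of J]
      by (auto simp: frontier_def compact_imp_closed)
    then obtain x where x: "x \<in> I" "p \<in> cball x (r x)" by (auto simp: J_def)
    then have "p \<notin> ball x (r x)" using ballI[OF x(1)] \<open>p \<notin> interior J\<close> by blast
    then have "dist x p = r x" using x by auto
    then show ?thesis using x r(1)[of x] I(1) by (intro exI[of _ x]) (auto simp: J_def)
  qed
  show ?thesis
    using greens_function_interior_disc[OF cJ int disc] dirichlet_regular_interior_disc[OF cJ int disc] cJ KJ JV
    by blast
qed

subsection \<open>Logarithmic capacity of polynomial preimages\<close>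

lemma filterlim_ln_norm_at_top: "filterlim (\<lambda>z::complex. ln (norm z)) at_top at_infinity"
  by (rule filterlim_compose[OF ln_at_top filterlim_norm_at_top])

text \<open>The maximum principle on an unbounded complement: cut it off by a circle so large that d
  is nonpositive from there on.\<close>

lemma harmonic_nonpos_if_eventually_nonpos:
  assumes "closed C" and d: "continuous_on UNIV d" "harmonic_on d (- C)"
    and le: "\<And>z. z \<in> C \<Longrightarrow> d z \<le> 0" and ev: "eventually (\<lambda>z. d z \<le> 0) at_infinity"
  shows "d z \<le> (0::real)"
proof (cases "z \<in> C")
  case False
  obtain b where b: "\<And>z. norm z \<ge> b \<Longrightarrow> d z \<le> 0" using ev unfolding eventually_at_infinity by blast
  define R where "R = max b (norm z + 1)"
  let ?U = "ball 0 R - C"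
  show ?thesis
  proof (rule harmonic_max_principle[of ?U])
    show "bounded ?U" by (rule bounded_subset[of "ball 0 R"]) auto
    show "continuous_on (closure ?U) d" by (rule continuous_on_subset[OF d(1)]) simp
    show "harmonic_on d ?U"
      by (rule harmonic_on_subset[OF d(2)]) (use \<open>closed C\<close> in auto)
    show "z \<in> ?U" using False by (simp add: R_def)
    fix w assume w: "w \<in> frontier ?U"
    have "open ?U" using \<open>closed C\<close> by auto
    then have "w \<in> closure ?U" "w \<notin> ?U" using w by (auto simp: frontier_def interior_open)
    then have "w \<in> C \<or> norm w \<ge> R" by auto
    then show "d w \<le> 0" using le b[of w] by (auto simp: R_def)
  qed
qed (use le in auto)

lemma greens_function_nonneg:
  assumes K: "compact K" and g: "greens_function g K t"
  shows "0 \<le> g z"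
proof -
  have lim: "((\<lambda>z. g z - (ln (norm z) - ln t)) \<longlongrightarrow> 0) at_infinity"
    using g by (simp add: greens_function_def)
  have "- g z \<le> 0"
  proof (rule harmonic_nonpos_if_eventually_nonpos[of K])
    show "harmonic_on (\<lambda>z. - g z) (- K)"
      using harmonic_on_cmult[of g "- K" "-1"] g by (simp add: greens_function_def)
    have "eventually (\<lambda>z. \<bar>g z - (ln (norm z) - ln t)\<bar> < 1) at_infinity"
      using tendstoD[OF lim, of 1] by (simp add: dist_real_def)
    moreover have "eventually (\<lambda>z::complex. ln (norm z) \<ge> 1 + ln t) at_infinity"
      using filterlim_ln_norm_at_top unfolding filterlim_at_top by blast
    ultimately show "eventually (\<lambda>z. - g z \<le> 0) at_infinity" by eventually_elim linarith
  qed (use g K in \<open>auto simp: greens_function_def compact_imp_closed intro!: continuous_intros\<close>)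
  then show ?thesis by simp
qed

text \<open>The difference f - g only tends to a constant at infinity, whose sign is unknown. The
  factor 1 + \<epsilon> makes it tend to minus infinity, so the maximum principle applies; then
  \<epsilon> tends to 0. The slack \<delta> allows L to stick out of K into a sublevel set of
  f.\<close>

lemma greens_function_comparison:
  assumes K: "compact K" "greens_function f K s" and L: "compact L" "greens_function g L t"
    and le: "\<And>z. z \<in> L \<Longrightarrow> f z \<le> \<delta>" and \<delta>: "\<delta> \<ge> 0"
  shows "ln t \<le> ln s + \<delta>"
proof -
  have limf: "((\<lambda>z. f z - (ln (norm z) - ln s)) \<longlongrightarrow> 0) at_infinity"
    and limg: "((\<lambda>z. g z - (ln (norm z) - ln t)) \<longlongrightarrow> 0) at_infinity"
    using K L by (simp_all add: greens_function_def)
  have cont: "continuous_on UNIV f" "continuous_on UNIV g"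
    using K L by (simp_all add: greens_function_def)
  have "f z - \<delta> - (1 + \<epsilon>) * g z \<le> 0" if \<epsilon>: "\<epsilon> > 0" "\<epsilon> \<le> 1" for z \<epsilon>
  proof (rule harmonic_nonpos_if_eventually_nonpos[of "K \<union> L"])
    show "closed (K \<union> L)" using K L by (auto simp: compact_imp_closed)
    show "continuous_on UNIV (\<lambda>z. f z - \<delta> - (1 + \<epsilon>) * g z)" by (intro continuous_intros cont)
    have o: "open (- (K \<union> L))" using \<open>closed (K \<union> L)\<close> by (rule open_Compl)
    have "harmonic_on f (- (K \<union> L))" "harmonic_on g (- (K \<union> L))"
      using K(2) L(2) harmonic_on_subset[OF _ o] by (auto simp: greens_function_def)
    then show "harmonic_on (\<lambda>z. f z - \<delta> - (1 + \<epsilon>) * g z) (- (K \<union> L))"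
      by (intro harmonic_on_diff harmonic_on_cmult harmonic_on_const o)
    show "f z - \<delta> - (1 + \<epsilon>) * g z \<le> 0" if "z \<in> K \<union> L" for z
    proof (cases "z \<in> L")
      case True
      then have "g z = 0" using L by (simp add: greens_function_def)
      then show ?thesis using le[OF True] by simp
    next
      case False
      then have "f z = 0" using K that by (auto simp: greens_function_def)
      moreover have "(1 + \<epsilon>) * g z \<ge> 0"
        using greens_function_nonneg[OF L] \<epsilon> by (intro mult_nonneg_nonneg) auto
      ultimately show ?thesis using \<delta> by simp
    qed
    have "eventually (\<lambda>z. \<bar>f z - (ln (norm z) - ln s)\<bar> < 1) at_infinity"
      using tendstoD[OF limf, of 1] by (simp add: dist_real_def)
    moreover have "eventually (\<lambda>z. \<bar>g z - (ln (norm z) - ln t)\<bar> < 1) at_infinity"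
      using tendstoD[OF limg, of 1] by (simp add: dist_real_def)
    \<comment> \<open>The surplus \<epsilon> ln |z| has to absorb |ln s| + 1 from f and at most 2
      |ln t| + 2 from (1 + \<epsilon>) g, where 1 + \<epsilon> \<le> 2.\<close>
    moreover have "eventually (\<lambda>z::complex. ln (norm z) \<ge> (3 + \<bar>ln s\<bar> + 2 * \<bar>ln t\<bar>) / \<epsilon>) at_infinity"
      using filterlim_ln_norm_at_top unfolding filterlim_at_top by blast
    ultimately show "eventually (\<lambda>z. f z - \<delta> - (1 + \<epsilon>) * g z \<le> 0) at_infinity"
    proof eventually_elim
      case (elim z)
      have "3 + \<bar>ln s\<bar> + 2 * \<bar>ln t\<bar> \<le> \<epsilon> * ln (norm z)" using elim(3) \<epsilon> by (simp add: field_simps)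
      moreover have "f z \<le> ln (norm z) - ln s + 1" using elim(1) by linarith
      moreover have "(1 + \<epsilon>) * g z \<ge> (1 + \<epsilon>) * (ln (norm z) - ln t - 1)"
        using elim(2) \<epsilon> by (intro mult_left_mono) auto
      moreover have "(1 + \<epsilon>) * (ln t + 1) \<le> 2 * \<bar>ln t\<bar> + 2"
      proof -
        have "(1 + \<epsilon>) * (ln t + 1) \<le> (1 + \<epsilon>) * (\<bar>ln t\<bar> + 1)" using \<epsilon> by (intro mult_left_mono) auto
        also have "\<dots> \<le> 2 * (\<bar>ln t\<bar> + 1)" using \<epsilon> by (intro mult_right_mono) auto
        finally show ?thesis by simp
      qed
      ultimately show ?case using \<delta> by (simp add: algebra_simps)
    qed
  qed
  then have "f z - \<delta> \<le> g z" for z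
  proof -
    assume *: "\<And>\<epsilon> z. 0 < \<epsilon> \<Longrightarrow> \<epsilon> \<le> 1 \<Longrightarrow> f z - \<delta> - (1 + \<epsilon>) * g z \<le> 0"
    have "f z - \<delta> \<le> g z + e" if e: "e > 0" for e
    proof -
      define \<epsilon> where "\<epsilon> = min 1 (e / (g z + 1))"
      have g0: "g z \<ge> 0" by (rule greens_function_nonneg[OF L])
      have \<epsilon>: "0 < \<epsilon>" "\<epsilon> \<le> 1" using e g0 by (auto simp: \<epsilon>_def)
      have "\<epsilon> * g z \<le> e / (g z + 1) * g z" using g0 by (intro mult_right_mono) (auto simp: \<epsilon>_def)
      also have "\<dots> \<le> e" using g0 e by (simp add: field_simps)
      finally show ?thesis using *[OF \<epsilon>, of z] by (simp add: algebra_simps)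
    qed
    then show ?thesis by (rule field_le_epsilon)
  qed
  moreover have "((\<lambda>z. f z - g z) \<longlongrightarrow> ln t - ln s) at_infinity"
    using tendsto_add[OF tendsto_diff[OF limf limg] tendsto_const[of "ln t - ln s"]]
    by (simp add: algebra_simps)
  ultimately have "ln t - ln s \<le> \<delta>"
    by (intro tendsto_upperbound[of "\<lambda>z. f z - g z"]) (auto simp: algebra_simps trivial_limit_at_infinity intro!: always_eventually)
  then show ?thesis by simp
qed

lemma greens_function_unique:
  assumes "compact K" "greens_function f K s" "greens_function g K t"
  shows "s = t"
proof -
  have "s > 0" "t > 0" using assms by (auto simp: greens_function_def)
  moreover have "ln t \<le> ln s + 0" "ln s \<le> ln t + 0"
    by (rule greens_function_comparison[OF assms(1,2) assms(1,3)]
        greens_function_comparison[OF assms(1,3) assms(1,2)];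
        use assms in \<open>simp add: greens_function_def\<close>)+
  ultimately show ?thesis by simp
qed

lemma log_capacity_eq:
  assumes "compact K" "greens_function g K t"
  shows "log_capacity K = t"
proof -
  have "(THE t. \<exists>f. greens_function f K t) = t"
    by (rule the_equality) (use assms greens_function_unique in blast)+
  then show ?thesis using assms unfolding log_capacity_def by auto
qed

section \<open>Polynomials as proper maps, and pull-back of Green's functions\<close>

lemma compact_poly_vimage:
  fixes p :: "complex poly"
  assumes "degree p \<ge> 1" "compact K"
  shows "compact (poly p -` K)"
proof -
  have "closed (poly p -` K)"
    using assms(2) by (intro closed_vimage) (auto simp: compact_imp_closed intro!: continuous_intros)
  moreover have "bounded (poly p -` K)"
  proof -
    obtain B where B: "\<And>z. z \<in> K \<Longrightarrow> norm z \<le> B" using compact_imp_bounded[OF assms(2)] unfolding bounded_iff by blast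
    have "filterlim (poly p) at_infinity at_infinity" using assms(1) by (intro filterlim_poly_at_infinity) simp
    then have "eventually (\<lambda>z. norm (poly p z) \<ge> B + 1) at_infinity"
      using filterlim_at_infinity_imp_norm_at_top[of "poly p" at_infinity] unfolding filterlim_at_top by blast
    then obtain b where b: "\<And>z. norm z \<ge> b \<Longrightarrow> norm (poly p z) \<ge> B + 1" unfolding eventually_at_infinity by blast
    show ?thesis
    proof (rule boundedI[of _ b])
      fix z assume "z \<in> poly p -` K"
      then show "norm z \<le> b" using b[of z] B[of "poly p z"] by force
    qed
  qed
  ultimately show ?thesis by (simp add: compact_eq_bounded_closed)
qed

text \<open>By properness a bounded sequence of values has its preimages in a compact set, so its
  limit is again a value. This makes the complement of an image of a closed set open.\<close>

lemma closed_poly_image: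
  fixes p :: "complex poly"
  assumes "degree p \<ge> 1" "closed A"
  shows "closed (poly p ` A)"
  unfolding closed_sequential_limits
proof (intro allI impI, elim conjE)
  fix x l assume x: "\<forall>n. x n \<in> poly p ` A" and l: "x \<longlonglongrightarrow> l"
  obtain B where B: "\<And>n. norm (x n) \<le> B"
    using convergent_imp_bounded[OF l] unfolding bounded_iff by blast
  let ?C = "poly p ` (A \<inter> poly p -` cball 0 B)"
  have "compact (A \<inter> poly p -` cball 0 B)"
    using compact_poly_vimage[OF assms(1), of "cball 0 B"] assms(2) by (simp add: closed_Int_compact)
  then have "compact ?C" by (intro compact_continuous_image continuous_intros)
  moreover have "x n \<in> ?C" for n using x B[of n] by force
  ultimately have "l \<in> ?C" using l compact_imp_closed[of ?C] closed_sequential_limits by blast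
  then show "l \<in> poly p ` A" by blast
qed

lemma surj_poly:
  fixes p :: "complex poly"
  assumes "degree p \<ge> 1" shows "\<exists>z. poly p z = w"
proof -
  have "degree (p - [:w:]) = degree p" using assms by (metis degree_pCons_0 degree_add_eq_left degree_minus diff_conv_add_uminus less_le_trans zero_less_one)
  then have "\<not> constant (poly (p - [:w:]))" using assms by (simp add: constant_degree)
  from fundamental_theorem_of_algebra[OF this] show ?thesis by auto
qed

text \<open>At infinity ln |p z| = n ln |z| + ln |a| + o(1) with a the leading coefficient. Division
  by n restores the normalisation ln |z| and turns ln t into (ln t - ln |a|) / n.\<close>

lemma greens_function_poly_vimage:
  fixes p :: "complex poly"
  assumes n: "degree p = n" "n \<ge> 1" and K: "compact K" and g: "greens_function g K t"
  shows "greens_function (\<lambda>z. g (poly p z) / n) (poly p -` K) ((t / norm (lead_coeff p)) powr (1 / n))"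
proof -
  have p0: "lead_coeff p \<noteq> 0" using n by auto
  have t: "t > 0" using g by (simp add: greens_function_def)
  have gc: "continuous_on UNIV g" and gh: "harmonic_on g (- K)"
    and lim: "((\<lambda>z. g z - (ln (norm z) - ln t)) \<longlongrightarrow> 0) at_infinity"
    using g by (auto simp: greens_function_def)
  have pinf: "filterlim (poly p) at_infinity at_infinity" using n by (intro filterlim_poly_at_infinity) simp
  let ?t = "(t / norm (lead_coeff p)) powr (1 / n)"
  have lnt: "ln ?t = (ln t - ln (norm (lead_coeff p))) / n"
    using t p0 by (simp add: ln_powr ln_div)
  show ?thesis unfolding greens_function_def
  proof (intro conjI ballI)
    show "?t > 0" using t p0 by simp
    show "continuous_on UNIV (\<lambda>z. g (poly p z) / n)"
      by (intro continuous_intros continuous_on_compose2[OF gc]) (use n in auto)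
    show "g (poly p z) / n = 0" if "z \<in> poly p -` K" for z using that g by (auto simp: greens_function_def)
    have "open (- (poly p -` K))"
      using compact_imp_closed[OF compact_poly_vimage[OF _ K, of p]] n by auto
    then have "harmonic_on (\<lambda>z. g (poly p z)) (- (poly p -` K))"
      by (intro harmonic_on_compose[OF gh]) (auto intro!: holomorphic_intros)
    from harmonic_on_cmult[OF this, of "1 / n"]
    show "harmonic_on (\<lambda>z. g (poly p z) / n) (- (poly p -` K))" by simp
    have 1: "((\<lambda>z. g (poly p z) - (ln (norm (poly p z)) - ln t)) \<longlongrightarrow> 0) at_infinity"
      by (rule filterlim_compose[OF lim pinf])
    have "((\<lambda>z. ln (norm (poly p z / z ^ n))) \<longlongrightarrow> ln (norm (lead_coeff p))) at_infinity"
      using poly_divide_tendsto_aux[of p] p0 n(1) by (intro tendsto_intros) auto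
    from tendsto_diff[OF this tendsto_const[of "ln (norm (lead_coeff p))"]]
    have 2: "((\<lambda>z. ln (norm (poly p z / z ^ n)) - ln (norm (lead_coeff p))) \<longlongrightarrow> 0) at_infinity" by simp
    have 3: "((\<lambda>z. (g (poly p z) - (ln (norm (poly p z)) - ln t)) / n +
        (ln (norm (poly p z / z ^ n)) - ln (norm (lead_coeff p))) / n) \<longlongrightarrow> 0) at_infinity"
      using tendsto_add[OF tendsto_divide[OF 1 tendsto_const[of "real n"]] tendsto_divide[OF 2 tendsto_const[of "real n"]]] n
      by simp
    show "((\<lambda>z. g (poly p z) / n - (ln (norm z) - ln ?t)) \<longlongrightarrow> 0) at_infinity"
    proof (rule Lim_transform_eventually[OF 3])
      have "eventually (\<lambda>z. poly p z \<noteq> 0) at_infinity"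
        using pinf by (metis filterlim_at_infinity_imp_eventually_ne)
      moreover have "eventually (\<lambda>z::complex. z \<noteq> 0) at_infinity"
        by (auto simp: eventually_at_infinity intro!: exI[of _ 1])
      ultimately show "\<forall>\<^sub>F z in at_infinity.
        (g (poly p z) - (ln (norm (poly p z)) - ln t)) / n + (ln (norm (poly p z / z ^ n)) - ln (norm (lead_coeff p))) / n
          = g (poly p z) / n - (ln (norm z) - ln ?t)"
      proof eventually_elim
        case (elim z)
        have eq: "ln (norm (poly p z / z ^ n)) = ln (norm (poly p z)) - n * ln (norm z)"
          using elim by (simp add: norm_divide norm_power ln_div ln_realpow)
        show ?case unfolding eq lnt using n by (simp add: diff_divide_distrib add_divide_distrib)
      qed
    qed
  qed
qed

section \<open>Capacity of sets without a Green's function\<close>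

lemma bdd_below_regular_capacities:
  "bdd_below {t. \<exists>J f. compact J \<and> K \<subseteq> J \<and> dirichlet_regular J \<and> greens_function f J t}"
  by (rule bdd_belowI[of _ 0]) (auto simp: greens_function_def)

lemma log_capacity_nonneg:
  assumes "compact K" "K \<noteq> {}" shows "log_capacity K \<ge> 0"
proof (cases "\<exists>f t. greens_function f K t")
  case True
  then obtain f t where ft: "greens_function f K t" by blast
  then show ?thesis using log_capacity_eq[OF assms(1) ft] by (simp add: greens_function_def)
next
  case False
  let ?S = "{t. \<exists>J f. compact J \<and> K \<subseteq> J \<and> dirichlet_regular J \<and> greens_function f J t}"
  have "?S \<noteq> {}" using regular_neighbourhood[OF assms, of UNIV] by auto
  then have "Inf ?S \<ge> 0" by (rule cInf_greatest) (auto simp: greens_function_def)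
  then show ?thesis using False by (simp add: log_capacity_def)
qed

text \<open>Any J between K and V has its preimage inside {f \<le> \<delta>}, and comparison of the
  pulled-back Green's function with f bounds its t. Such a regular J competes in the infimum for K,
  and \<delta> tends to 0.\<close>

lemma log_capacity_le_greens_vimage:
  fixes p :: "complex poly"
  assumes n: "degree p = n" "n \<ge> 1" and K: "compact K" "K \<noteq> {}" and noG: "\<nexists>g t. greens_function g K t"
    and J': "compact J'" "poly p -` K \<subseteq> J'" "greens_function f J' s"
  shows "log_capacity K \<le> norm (lead_coeff p) * s ^ n"
proof -
  have a: "norm (lead_coeff p) > 0" using n by auto
  have s: "s > 0" using J' by (simp add: greens_function_def)
  have fc: "continuous_on UNIV f" using J' by (simp add: greens_function_def)
  have bound: "log_capacity K \<le> norm (lead_coeff p) * (s * exp \<delta>) ^ n" if \<delta>: "\<delta> > 0" for \<delta>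
  proof -
    \<comment> \<open>A point belongs to V exactly when f < \<delta> at all of its preimages. Points
      of K qualify because f vanishes on J'.\<close>
    define V where "V = - (poly p ` {z. \<delta> \<le> f z})"
    have "closed {z. \<delta> \<le> f z}" using fc by (intro closed_Collect_le continuous_intros)
    then have oV: "open V" unfolding V_def using closed_poly_image[of p] n by auto
    have KV: "K \<subseteq> V"
    proof
      fix w assume w: "w \<in> K"
      have "f z = 0" if "poly p z = w" for z using J' w that by (auto simp: greens_function_def)
      then show "w \<in> V" using \<delta> by (auto simp: V_def)
    qed
    obtain J g t where J: "compact J" "K \<subseteq> J" "J \<subseteq> V" "dirichlet_regular J" "greens_function g J t"
      using regular_neighbourhood[OF K oV KV] by blast
    have t: "t > 0" using J by (simp add: greens_function_def)
    let ?t = "(t / norm (lead_coeff p)) powr (1 / n)"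
    have "ln ?t \<le> ln s + \<delta>"
    proof (rule greens_function_comparison[OF J'(1,3) compact_poly_vimage[OF _ J(1)] greens_function_poly_vimage[OF n J(1,5)]])
      fix z assume "z \<in> poly p -` J"
      then have "poly p z \<in> V" using J(3) by auto
      then show "f z \<le> \<delta>" by (force simp: V_def)
    qed (use n \<delta> in auto)
    also have "\<dots> = ln (s * exp \<delta>)" using s by (simp add: ln_mult)
    finally have "?t \<le> s * exp \<delta>" using s t a by (subst (asm) ln_le_cancel_iff) auto
    then have "?t ^ n \<le> (s * exp \<delta>) ^ n" by (intro power_mono) auto
    moreover have "?t ^ n = t / norm (lead_coeff p)"
      using t a n by (simp add: powr_power)
    ultimately have "t \<le> norm (lead_coeff p) * (s * exp \<delta>) ^ n" using a by (simp add: field_simps)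
    moreover have "log_capacity K \<le> t"
      unfolding log_capacity_def if_not_P[OF noG]
      by (rule cInf_lower[OF _ bdd_below_regular_capacities]) (use J in blast)
    ultimately show ?thesis by simp
  qed
  have "((\<lambda>\<delta>. norm (lead_coeff p) * (s * exp \<delta>) ^ n) \<longlongrightarrow> norm (lead_coeff p) * (s * exp 0) ^ n) (at_right 0)"
    by (intro tendsto_intros)
  then have "log_capacity K \<le> norm (lead_coeff p) * (s * exp 0) ^ n"
    by (rule tendsto_lowerbound) (use bound in \<open>auto simp: eventually_at_right_field intro!: exI[of _ 1]\<close>)
  then show ?thesis by simp
qed

theorem log_capacity_poly_vimage_ge:
  fixes p :: "complex poly"
  assumes n: "degree p = n" "n \<ge> 1" and K: "compact K" "K \<noteq> {}"
  shows "log_capacity K \<le> norm (lead_coeff p) * log_capacity (poly p -` K) ^ n"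
proof -
  have a: "norm (lead_coeff p) > 0" using n by auto
  let ?E = "poly p -` K"
  have E: "compact ?E" by (rule compact_poly_vimage) (use n K in auto)
  have E0: "?E \<noteq> {}" using K(2) surj_poly[of p] n by (metis empty_iff ex_in_conv vimage_eq order_refl)
  show ?thesis
  proof (cases "\<exists>g t. greens_function g K t")
    case True
    then obtain g t where gt: "greens_function g K t" by blast
    have t: "t > 0" using gt by (simp add: greens_function_def)
    have "log_capacity ?E = (t / norm (lead_coeff p)) powr (1 / n)"
      by (rule log_capacity_eq[OF E greens_function_poly_vimage[OF n K(1) gt]])
    then have "log_capacity ?E ^ n = t / norm (lead_coeff p)" using t a n by (simp add: powr_power)
    then show ?thesis using log_capacity_eq[OF K(1) gt] a by simp
  next
    case False
    note upper = log_capacity_le_greens_vimage[OF n K False]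
    show ?thesis
    proof (cases "\<exists>f s. greens_function f ?E s")
      case True
      then obtain f s where fs: "greens_function f ?E s" by blast
      show ?thesis using upper[OF E order_refl fs] log_capacity_eq[OF E fs] by simp
    next
      case noE: False
      let ?S = "{t. \<exists>J f. compact J \<and> ?E \<subseteq> J \<and> dirichlet_regular J \<and> greens_function f J t}"
      \<comment> \<open>This is the n-th root form of the desired lower bound; it has to be verified
        for every t that competes in the infimum for the preimage.\<close>
      let ?c = "(log_capacity K / norm (lead_coeff p)) powr (1 / n)"
      have c0: "log_capacity K \<ge> 0" by (rule log_capacity_nonneg[OF K])
      have "?S \<noteq> {}" using regular_neighbourhood[OF E E0, of UNIV] by auto
      then have "?c \<le> Inf ?S"
      proof (rule cInf_greatest)
        fix s assume "s \<in> ?S"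
        then obtain J f where J: "compact J" "?E \<subseteq> J" "greens_function f J s" by blast
        have s: "s > 0" using J by (simp add: greens_function_def)
        have "?c \<le> (s ^ n) powr (1 / n)"
          using upper[OF J] a c0 by (intro powr_mono2) (auto simp: field_simps)
        also have "\<dots> = s" using s n by (simp add: powr_powr flip: powr_realpow)
        finally show "?c \<le> s" .
      qed
      then have "?c \<le> log_capacity ?E" using noE by (simp add: log_capacity_def)
      then have "?c ^ n \<le> log_capacity ?E ^ n" by (intro power_mono) auto
      \<comment> \<open>If \<open>log_capacity K = 0\<close>, both sides are 0, since 0 powr x = 0
        and n \<ge> 1.\<close>
      moreover have "?c ^ n = log_capacity K / norm (lead_coeff p)"
        using a n c0 by (cases "log_capacity K = 0") (simp_all add: powr_power power_0_left)
      ultimately show ?thesis using a by (simp add: field_simps)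
    qed
  qed
qed

subsection \<open>The Ahlfors-Beurling inequality\<close>

text \<open>Fubini for the region between 0 and the graph of f. Negative values count as 0 on both
  sides: \<open>ennreal\<close> truncates them on the left, the indicator of \<open>{0..}\<close> on
  the right.\<close>

lemma nn_integral_layer_cake:
  fixes f :: "'a \<Rightarrow> real"
  assumes "sigma_finite_measure M" and f [measurable]: "f \<in> borel_measurable M"
  shows "(\<integral>\<^sup>+ x. ennreal (f x) \<partial>M) =
         (\<integral>\<^sup>+ \<tau>. emeasure M {x\<in>space M. \<tau> < f x} * indicator {0..} \<tau> \<partial>lborel)"
proof -
  interpret sigma_finite_measure M by fact
  interpret pair_sigma_finite M "lborel :: real measure" ..
  let ?k = "\<lambda>x \<tau>::real. indicator {..<f x} \<tau> * indicator {0..} \<tau> :: ennreal"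
  have inner: "(\<integral>\<^sup>+ \<tau>. ?k x \<tau> \<partial>lborel) = ennreal (f x)" for x
  proof -
    have "(\<integral>\<^sup>+ \<tau>. ?k x \<tau> \<partial>lborel) = (\<integral>\<^sup>+ \<tau>. indicator {0..<f x} \<tau> \<partial>lborel)"
      by (intro nn_integral_cong) (auto split: split_indicator)
    then show ?thesis by (cases "0 \<le> f x") (auto simp: ennreal_neg)
  qed
  have "case_prod ?k = (\<lambda>(x, \<tau>). if \<tau> < f x \<and> 0 \<le> \<tau> then 1 else 0)"
    by (auto simp: fun_eq_iff indicator_def)
  then have k: "case_prod ?k \<in> borel_measurable (M \<Otimes>\<^sub>M lborel)" by simp
  have "(\<integral>\<^sup>+ x. ennreal (f x) \<partial>M) = (\<integral>\<^sup>+ x. (\<integral>\<^sup>+ \<tau>. ?k x \<tau> \<partial>lborel) \<partial>M)" by (simp add: inner)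
  also have "\<dots> = (\<integral>\<^sup>+ \<tau>. (\<integral>\<^sup>+ x. ?k x \<tau> \<partial>M) \<partial>lborel)" by (rule Fubini'[OF k, symmetric])
  also have "\<dots> = (\<integral>\<^sup>+ \<tau>. emeasure M {x\<in>space M. \<tau> < f x} * indicator {0..} \<tau> \<partial>lborel)"
  proof (intro nn_integral_cong)
    fix \<tau> :: real
    have "(\<integral>\<^sup>+ x. ?k x \<tau> \<partial>M) = (\<integral>\<^sup>+ x. indicator {x\<in>space M. \<tau> < f x} x * indicator {0..} \<tau> \<partial>M)"
      by (intro nn_integral_cong) (auto split: split_indicator)
    also have "\<dots> = emeasure M {x\<in>space M. \<tau> < f x} * indicator {0..} \<tau>"
      by (subst nn_integral_multc) auto
    finally show "(\<integral>\<^sup>+ x. ?k x \<tau> \<partial>M) = emeasure M {x\<in>space M. \<tau> < f x} * indicator {0..} \<tau>" .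
  qed
  finally show ?thesis .
qed

lemma emeasure_lborel_compact:
  fixes K :: "'a::euclidean_space set"
  assumes "compact K" shows "emeasure lborel K = ennreal (measure lborel K)"
  using assms emeasure_compact_finite[of K] by (simp add: emeasure_eq_ennreal_measure)

lemma set_integrable_compact:
  fixes g :: "complex \<Rightarrow> 'b::{banach, second_countable_topology}"
  assumes "compact K" "continuous_on K g" shows "set_integrable lborel K g"
  unfolding set_integrable_def by (rule borel_integrable_compact[OF assms])

lemma set_integral_norm_le:
  fixes g :: "complex \<Rightarrow> complex"
  assumes K: "compact K" "continuous_on K g" and B: "\<And>w. w \<in> K \<Longrightarrow> norm (g w) \<le> B"
  shows "norm (LINT w:K|lborel. g w) \<le> B * measure lborel K"
proof -
  have "norm (LINT w:K|lborel. g w) \<le> (LINT w:K|lborel. norm (g w))"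
    by (rule set_integral_norm_bound[OF set_integrable_compact[OF K]])
  also have "\<dots> \<le> (LINT w:K|lborel. B)"
    by (intro set_integral_mono set_integrable_compact K(1) continuous_intros K(2)) (use B in auto)
  also have "\<dots> = B * measure lborel K"
    using K by (simp add: set_lebesgue_integral_def)
  finally show ?thesis .
qed

definition cauchy_transform :: "complex set \<Rightarrow> complex \<Rightarrow> complex" where
  "cauchy_transform K z = (LINT w:K|lborel. 1 / (w - z))"

text \<open>The sets \<open>{Re (e / (w - z)) > \<tau>}\<close> are discs of radius \<open>1 / (2 \<tau>)\<close>.\<close>

lemma Re_divide_gt_imp_in_ball:
  assumes e: "norm e = 1" and \<tau>: "\<tau> > 0" and gt: "Re (e / v) > \<tau>"
  shows "v \<in> ball (e / of_real (2 * \<tau>)) (1 / (2 * \<tau>))"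
proof -
  have v: "v \<noteq> 0" using gt \<tau> by auto
  have e2: "(Re e)\<^sup>2 + (Im e)\<^sup>2 = 1" using e by (simp flip: cmod_power2)
  have n: "(Re v)\<^sup>2 + (Im v)\<^sup>2 > 0" using v by (metis cmod_power2 zero_less_norm_iff zero_less_power)
  have "Re (e / v) = (Re e * Re v + Im e * Im v) / ((Re v)\<^sup>2 + (Im v)\<^sup>2)" by (simp add: Re_divide)
  with gt n have *: "\<tau> * ((Re v)\<^sup>2 + (Im v)\<^sup>2) < Re e * Re v + Im e * Im v" by (simp add: field_simps)
  let ?c = "1 / (2 * \<tau>)"
  have "(norm (v - e * of_real ?c))\<^sup>2 = (Re v)\<^sup>2 + (Im v)\<^sup>2 - 2 * ?c * (Re e * Re v + Im e * Im v)
      + ?c\<^sup>2 * ((Re e)\<^sup>2 + (Im e)\<^sup>2)"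
    unfolding cmod_power2 by (simp add: power2_eq_square algebra_simps)
  also have "\<dots> < ?c\<^sup>2"
  proof -
    have "(Re v)\<^sup>2 + (Im v)\<^sup>2 < (Re e * Re v + Im e * Im v) / \<tau>" using * \<tau> by (simp add: field_simps)
    moreover have "2 * ?c * (Re e * Re v + Im e * Im v) = (Re e * Re v + Im e * Im v) / \<tau>" by simp
    ultimately show ?thesis unfolding e2 by linarith
  qed
  finally have "norm (v - e * of_real ?c) < ?c" using \<tau> by (simp add: power_less_imp_less_base)
  moreover have "e * of_real ?c = e / of_real (2 * \<tau>)" by simp
  ultimately show ?thesis by (metis dist_commute dist_norm mem_ball)
qed

text \<open>After a rotation the modulus is the integral over K of Re (e / (w - z)). The set where
  this exceeds \<tau> lies both in K and in a disc of radius 1 / (2 \<tau>), so its area is at most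
  the smaller of A and pi / (4 \<tau>^2). Integrating over \<tau> gives the bound.\<close>

theorem ahlfors_beurling:
  assumes K: "compact K" and A: "measure lborel K > 0" and z: "z \<notin> K"
  shows "norm (cauchy_transform K z) \<le> sqrt (pi * measure lborel K)"
proof (cases "cauchy_transform K z = 0")
  case False
  define A where "A = measure lborel K"
  have A0: "A > 0" using A by (simp add: A_def)
  let ?c = "cauchy_transform K z"
  \<comment> \<open>The unimodular factor that turns the value of the transform into its
    modulus.\<close>
  define e where "e = cnj ?c / of_real (norm ?c)"
  have e: "norm e = 1" using False by (simp add: e_def norm_divide)
  have ec: "e * ?c = of_real (norm ?c)"
    using False by (simp add: e_def complex_norm_square[symmetric] power2_eq_square mult.commute)
  have cK: "continuous_on K (\<lambda>w. e / (w - z))" using z by (intro continuous_intros) auto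
  have cK1: "continuous_on K (\<lambda>w. 1 / (w - z))" using z by (intro continuous_intros) auto
  define h where "h = (\<lambda>w. indicator K w * Re (e / (w - z)))"
  have int: "integrable lborel h"
    using set_integrable_compact[OF K continuous_on_Re[OF cK]] by (simp add: h_def set_integrable_def)
  have "norm ?c = Re (e * ?c)" unfolding ec by simp
  also have "e * ?c = (LINT w:K|lborel. e / (w - z))"
    unfolding cauchy_transform_def by (subst set_integral_mult_right[symmetric]) simp
  also have "Re \<dots> = (\<integral>w. h w \<partial>lborel)"
    using set_integrable_compact[OF K cK] unfolding set_lebesgue_integral_def set_integrable_def h_def
    by (subst integral_Re[symmetric]) (auto simp: mult.commute)
  also have "\<dots> \<le> (\<integral>w. max 0 (h w) \<partial>lborel)" by (intro integral_mono int integrable_max) auto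
  finally have "ennreal (norm ?c) \<le> ennreal (\<integral>w. max 0 (h w) \<partial>lborel)" by (rule ennreal_leI)
  also have "\<dots> = (\<integral>\<^sup>+w. ennreal (max 0 (h w)) \<partial>lborel)"
    by (rule nn_integral_eq_integral[symmetric]) (use int in auto)
  also have "\<dots> = (\<integral>\<^sup>+w. ennreal (h w) \<partial>lborel)"
    by (intro nn_integral_cong) (auto simp: max_def ennreal_neg)
  also have "\<dots> = (\<integral>\<^sup>+ \<tau>. emeasure lborel {w\<in>space lborel. \<tau> < h w} * indicator {0..} \<tau> \<partial>lborel)"
    by (rule nn_integral_layer_cake) (use int in \<open>auto intro: sigma_finite_lborel\<close>)
  \<comment> \<open>The two area bounds coincide at \<tau> = sqrt (pi / A) / 2: below it the area of
    K is used, above it the area of the disc.\<close>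
  also have "\<dots> \<le> (\<integral>\<^sup>+ \<tau>. ennreal A * indicator {0..sqrt (pi / A) / 2} \<tau> +
      ennreal (pi / (4 * \<tau>\<^sup>2)) * indicator {sqrt (pi / A) / 2..} \<tau> \<partial>lborel)"
  proof (rule nn_integral_mono)
    fix \<tau> :: real
    let ?S = "{w\<in>space lborel. \<tau> < h w}"
    have S: "?S \<in> sets lborel" using int by measurable
    consider "\<tau> < 0" | "0 \<le> \<tau>" "\<tau> \<le> sqrt (pi / A) / 2" | "\<tau> > sqrt (pi / A) / 2" by linarith
    then show "emeasure lborel ?S * indicator {0..} \<tau> \<le> ennreal A * indicator {0..sqrt (pi / A) / 2} \<tau> +
      ennreal (pi / (4 * \<tau>\<^sup>2)) * indicator {sqrt (pi / A) / 2..} \<tau>"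
    proof cases
      case 2
      have "?S \<subseteq> K" using 2 by (auto simp: h_def indicator_def split: if_splits)
      then have "emeasure lborel ?S \<le> emeasure lborel K" using K by (intro emeasure_mono) (auto simp: borel_compact)
      then show ?thesis using 2 emeasure_lborel_compact[OF K]
        by (auto simp: A_def indicator_def intro: order_trans)
    next
      case 3
      moreover have "sqrt (pi / A) / 2 > 0" using A0 by simp
      ultimately have \<tau>: "\<tau> > 0" by linarith
      have "?S \<subseteq> ball (z + e / of_real (2 * \<tau>)) (1 / (2 * \<tau>))"
      proof
        fix w assume "w \<in> ?S"
        then have "\<tau> < Re (e / (w - z))" using \<tau> by (cases "w \<in> K") (auto simp: h_def)
        from Re_divide_gt_imp_in_ball[OF e \<tau> this]
        show "w \<in> ball (z + e / of_real (2 * \<tau>)) (1 / (2 * \<tau>))" by (simp add: dist_norm algebra_simps)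
      qed
      then have "emeasure lborel ?S \<le> emeasure lborel (ball (z + e / of_real (2 * \<tau>)) (1 / (2 * \<tau>)))"
        by (intro emeasure_mono) auto
      also have "\<dots> = ennreal (pi / (4 * \<tau>\<^sup>2))"
        using \<tau> by (subst emeasure_ball) (auto simp: unit_ball_vol_2 power2_eq_square)
      finally show ?thesis using 3 \<tau> by (auto simp: indicator_def)
    qed auto
  qed
  also have "\<dots> = ennreal A * ennreal (sqrt (pi / A) / 2) + ennreal (0 - (- (pi / (4 * (sqrt (pi / A) / 2)))))"
  proof -
    have "(\<integral>\<^sup>+ \<tau>. ennreal A * indicator {0..sqrt (pi / A) / 2} \<tau> +
      ennreal (pi / (4 * \<tau>\<^sup>2)) * indicator {sqrt (pi / A) / 2..} \<tau> \<partial>lborel) =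
      (\<integral>\<^sup>+ \<tau>. ennreal A * indicator {0..sqrt (pi / A) / 2} \<tau> \<partial>lborel) +
      (\<integral>\<^sup>+ \<tau>. ennreal (pi / (4 * \<tau>\<^sup>2)) * indicator {sqrt (pi / A) / 2..} \<tau> \<partial>lborel)"
      by (rule nn_integral_add) auto
    moreover
    have "(\<integral>\<^sup>+ \<tau>. ennreal (pi / (4 * \<tau>\<^sup>2)) * indicator {sqrt (pi / A) / 2..} \<tau> \<partial>lborel) =
        ennreal (0 - (- (pi / (4 * (sqrt (pi / A) / 2)))))"
    proof (rule nn_integral_FTC_atLeast[of _ _ "\<lambda>\<tau>. - (pi / (4 * \<tau>))"])
      fix x :: real assume "sqrt (pi / A) / 2 \<le> x"
      moreover have "sqrt (pi / A) / 2 > 0" using A0 by simp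
      ultimately have "x \<noteq> 0" by linarith
      then show "((\<lambda>\<tau>. - (pi / (4 * \<tau>))) has_real_derivative pi / (4 * x\<^sup>2)) (at x)"
        by (auto intro!: derivative_eq_intros simp: power2_eq_square field_simps)
    next
      show "((\<lambda>\<tau>. - (pi / (4 * \<tau>))) \<longlongrightarrow> 0) at_top"
        by real_asymp
    qed auto
    moreover have "(\<integral>\<^sup>+ \<tau>. ennreal A * indicator {0..sqrt (pi / A) / 2} \<tau> \<partial>lborel) = ennreal A * ennreal (sqrt (pi / A) / 2)"
      using A0 by (subst nn_integral_cmult) auto
    ultimately show ?thesis by simp
  qed
  also have "\<dots> = ennreal (A * (sqrt (pi / A) / 2) + pi / (4 * (sqrt (pi / A) / 2)))"
  proof -
    have "ennreal A * ennreal (sqrt (pi / A) / 2) = ennreal (A * (sqrt (pi / A) / 2))"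
      using A0 by (intro ennreal_mult[symmetric]) auto
    moreover have "0 - - (pi / (4 * (sqrt (pi / A) / 2))) = pi / (4 * (sqrt (pi / A) / 2))" by simp
    ultimately show ?thesis
      using A0 ennreal_plus[of "A * (sqrt (pi / A) / 2)" "pi / (4 * (sqrt (pi / A) / 2))"] by simp
  qed
  \<comment> \<open>Both ranges of \<tau> contribute the same amount, half of sqrt (pi A).\<close>
  also have "A * (sqrt (pi / A) / 2) + pi / (4 * (sqrt (pi / A) / 2)) = sqrt (pi * A)"
  proof -
    have "sqrt (pi / A) * sqrt (pi / A) = pi / A" using A0 by simp
    then have "pi / sqrt (pi / A) = A * sqrt (pi / A)" using A0 by (simp add: field_simps)
    moreover have "A * sqrt (pi / A) = sqrt (pi * A)"
    proof -
      have "A * sqrt (pi / A) = sqrt (A\<^sup>2) * sqrt (pi / A)" using A0 by simp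
      also have "\<dots> = sqrt (A\<^sup>2 * (pi / A))" by (rule real_sqrt_mult[symmetric])
      also have "A\<^sup>2 * (pi / A) = pi * A" using A0 by (simp add: power2_eq_square)
      finally show ?thesis .
    qed
    ultimately show ?thesis by simp
  qed
  finally show ?thesis using A0 by (simp add: A_def)
qed (use A in auto)

text \<open>The Taylor remainder of the kernel is exact: 1 / (w - x) - 1 / (w - z) - (x - z) / (w -
  z)^2 = (x - z)^2 / ((w - x) (w - z)^2). It is quadratic in x - z uniformly for w in K.\<close>

lemma holomorphic_cauchy_transform:
  assumes K: "compact K"
  shows "cauchy_transform K holomorphic_on (- K)"
proof -
  have oK: "open (- K)" using K by (simp add: compact_imp_closed open_Compl)
  have "(cauchy_transform K has_field_derivative (LINT w:K|lborel. 1 / (w - z)\<^sup>2)) (at z)" if z: "z \<in> - K" for z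
  proof -
    obtain d where d: "d > 0" "ball z d \<subseteq> - K" using oK z openE by blast
    have dw: "norm (w - z) \<ge> d" if "w \<in> K" for w
    proof (rule ccontr)
      assume "\<not> ?thesis"
      then have "w \<in> ball z d" by (simp add: dist_norm norm_minus_commute)
      then show False using d that by blast
    qed
    let ?D = "LINT w:K|lborel. 1 / (w - z)\<^sup>2"
    \<comment> \<open>On K one has |w - z| \<ge> d, and |w - x| \<ge> d / 2 once x is within d / 2
      of z.\<close>
    let ?B = "2 / d ^ 3 * measure lborel K"
    have est: "norm ((cauchy_transform K x - cauchy_transform K z) / (x - z) - ?D) \<le> norm (x - z) * ?B"
      if x: "x \<noteq> z" "norm (x - z) < d / 2" for x
    proof -
      have xw: "norm (w - x) \<ge> d / 2" if "w \<in> K" for w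
        using dw[OF that] x(2) norm_triangle_ineq[of "w - x" "x - z"] by simp
      have nz: "w - z \<noteq> 0" "w - x \<noteq> 0" if "w \<in> K" for w
        using dw[OF that] xw[OF that] d by auto
      have c1: "continuous_on K (\<lambda>w. 1 / (w - x))" and c2: "continuous_on K (\<lambda>w. 1 / (w - z))"
        and c3: "continuous_on K (\<lambda>w. 1 / (w - z)\<^sup>2)" and c4: "continuous_on K (\<lambda>w. 1 / ((w - x) * (w - z)\<^sup>2))"
        using nz by (auto intro!: continuous_intros)
      note ints = set_integrable_compact[OF K c1] set_integrable_compact[OF K c2] set_integrable_compact[OF K c3]
      have i4: "set_integrable lborel K (\<lambda>w. (x - z) * (1 / (w - z)\<^sup>2))"
        by (intro set_integrable_compact K continuous_on_mult continuous_on_const c3)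
      have "cauchy_transform K x - cauchy_transform K z - (x - z) * ?D =
          (LINT w:K|lborel. (1 / (w - x) - 1 / (w - z)) - (x - z) * (1 / (w - z)\<^sup>2))"
        unfolding cauchy_transform_def set_integral_diff(2)[OF set_integral_diff(1)[OF ints(1,2)] i4]
          set_integral_diff(2)[OF ints(1,2)] set_integral_mult_right ..
      also have "\<dots> = (LINT w:K|lborel. (x - z)\<^sup>2 * (1 / ((w - x) * (w - z)\<^sup>2)))"
      proof (rule set_lebesgue_integral_cong)
        show "\<forall>w. w \<in> K \<longrightarrow> (1 / (w - x) - 1 / (w - z)) - (x - z) * (1 / (w - z)\<^sup>2) =
            (x - z)\<^sup>2 * (1 / ((w - x) * (w - z)\<^sup>2))"
        proof (intro allI impI)
          fix w assume "w \<in> K"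
          from nz[OF this] show "(1 / (w - x) - 1 / (w - z)) - (x - z) * (1 / (w - z)\<^sup>2) =
            (x - z)\<^sup>2 * (1 / ((w - x) * (w - z)\<^sup>2))"
            by (simp add: divide_simps power2_eq_square) (simp add: algebra_simps)
        qed
      qed (use K in \<open>auto simp: borel_compact\<close>)
      also have "\<dots> = (x - z)\<^sup>2 * (LINT w:K|lborel. 1 / ((w - x) * (w - z)\<^sup>2))"
        by (rule set_integral_mult_right)
      finally have eq: "cauchy_transform K x - cauchy_transform K z - (x - z) * ?D =
          (x - z)\<^sup>2 * (LINT w:K|lborel. 1 / ((w - x) * (w - z)\<^sup>2))" .
      have "norm (LINT w:K|lborel. 1 / ((w - x) * (w - z)\<^sup>2)) \<le> ?B"
      proof (rule set_integral_norm_le[OF K c4])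
        fix w assume w: "w \<in> K"
        have "d / 2 * d\<^sup>2 \<le> norm (w - x) * (norm (w - z))\<^sup>2"
          using xw[OF w] dw[OF w] d by (intro mult_mono power_mono) auto
        then have "1 / (norm (w - x) * (norm (w - z))\<^sup>2) \<le> 1 / (d / 2 * d\<^sup>2)"
          using d nz[OF w] by (intro divide_left_mono mult_pos_pos) auto
        also have "\<dots> = 2 / d ^ 3" by (simp add: power3_eq_cube power2_eq_square)
        finally show "norm (1 / ((w - x) * (w - z)\<^sup>2)) \<le> 2 / d ^ 3"
          by (simp add: norm_divide norm_mult norm_power)
      qed
      from mult_left_mono[OF this norm_ge_zero[of "x - z"]]
      have "norm ((x - z) * (LINT w:K|lborel. 1 / ((w - x) * (w - z)\<^sup>2))) \<le> norm (x - z) * ?B"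
        unfolding norm_mult .
      moreover have "(cauchy_transform K x - cauchy_transform K z) / (x - z) - ?D =
          (x - z) * (LINT w:K|lborel. 1 / ((w - x) * (w - z)\<^sup>2))"
        using eq x(1) by (simp add: field_simps power2_eq_square)
      ultimately show ?thesis by metis
    qed
    show ?thesis unfolding has_field_derivative_iff
    proof (rule LIM_zero_cancel, rule Lim_null_comparison)
      show "\<forall>\<^sub>F x in at z. norm ((cauchy_transform K x - cauchy_transform K z) / (x - z) - ?D) \<le> norm (x - z) * ?B"
        unfolding eventually_at
      proof (intro exI[of _ "d / 2"] conjI ballI impI)
        fix x assume "x \<noteq> z \<and> dist x z < d / 2"
        then show "norm ((cauchy_transform K x - cauchy_transform K z) / (x - z) - ?D) \<le> norm (x - z) * ?B"
          using est[of x] by (simp add: dist_norm)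
      qed (use d(1) in simp)
      show "((\<lambda>x. norm (x - z) * ?B) \<longlongrightarrow> 0) (at z)"
        by (intro tendsto_mult_left_zero tendsto_norm_zero LIM_zero tendsto_ident_at)
    qed
  qed
  then show ?thesis unfolding holomorphic_on_open[OF oK] by blast
qed

text \<open>Write z / (w - z) = w / (w - z) - 1; the first term tends to 0 uniformly on K. The minus
  sign reflects the kernel 1 / (w - z).\<close>

lemma cauchy_transform_at_infinity:
  assumes K: "compact K"
  shows "((\<lambda>z. z * cauchy_transform K z) \<longlongrightarrow> - of_real (measure lborel K)) at_infinity"
proof -
  obtain B where B: "B > 0" "\<And>w. w \<in> K \<Longrightarrow> norm w \<le> B"
    using compact_imp_bounded[OF K] bounded_pos by blast
  let ?A = "measure lborel K"
  have est: "norm (z * cauchy_transform K z - (- of_real ?A)) \<le> B * ?A * (1 / (norm z - B))"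
    if z: "norm z > B" for z
  proof -
    have nz: "w - z \<noteq> 0" if "w \<in> K" for w using B(2)[OF that] z by auto
    have c: "continuous_on K (\<lambda>w. 1 / (w - z))" "continuous_on K (\<lambda>w. w / (w - z))"
      using nz by (auto intro!: continuous_intros)
    have "z * cauchy_transform K z = (LINT w:K|lborel. z * (1 / (w - z)))"
      unfolding cauchy_transform_def by (rule set_integral_mult_right[symmetric])
    also have "\<dots> = (LINT w:K|lborel. w / (w - z) - 1)"
      by (rule set_lebesgue_integral_cong)
        (use K nz in \<open>auto simp: borel_compact divide_simps\<close>)
    also have "\<dots> = (LINT w:K|lborel. w / (w - z)) - (LINT w:K|lborel. 1)"
      by (intro set_integral_diff set_integrable_compact K c continuous_intros)
    also have "(LINT w:K|lborel. 1) = complex_of_real ?A"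
      using K by (simp add: set_lebesgue_integral_def borel_compact scaleR_conv_of_real emeasure_lborel_compact)
    finally have "z * cauchy_transform K z - (- of_real ?A) = (LINT w:K|lborel. w / (w - z))" by simp
    moreover have "norm (LINT w:K|lborel. w / (w - z)) \<le> B / (norm z - B) * ?A"
    proof (rule set_integral_norm_le[OF K c(2)])
      fix w assume w: "w \<in> K"
      have "norm z - B \<le> norm (w - z)" using B(2)[OF w] norm_triangle_ineq2[of z w] by (simp add: norm_minus_commute)
      then show "norm (w / (w - z)) \<le> B / (norm z - B)"
        unfolding norm_divide using B(1) B(2)[OF w] z by (intro frac_le) auto
    qed
    ultimately show ?thesis by simp
  qed
  have "filterlim (\<lambda>z::complex. norm z - B) at_top at_infinity"
    using filterlim_tendsto_add_at_top[OF tendsto_const[of "- B"] filterlim_norm_at_top] by simp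
  from tendsto_inverse_0_at_top[OF this]
  have "((\<lambda>z::complex. 1 / (norm z - B)) \<longlongrightarrow> 0) at_infinity" by (simp add: inverse_eq_divide)
  from tendsto_mult_right_zero[OF this, of "B * ?A"]
  have lim: "((\<lambda>z::complex. B * ?A * (1 / (norm z - B))) \<longlongrightarrow> 0) at_infinity" .
  have "((\<lambda>z. z * cauchy_transform K z - (- of_real ?A)) \<longlongrightarrow> 0) at_infinity"
  proof (rule Lim_null_comparison[OF _ lim])
    show "\<forall>\<^sub>F z in at_infinity. norm (z * cauchy_transform K z - (- of_real ?A)) \<le> B * ?A * (1 / (norm z - B))"
      unfolding eventually_at_infinity using est by (intro exI[of _ "B + 1"]) auto
  qed
  then show ?thesis by (rule LIM_zero_cancel)
qed

subsection \<open>Area, capacity and Polya's inequality\<close>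

text \<open>F is controlled only off K and may have zeros, so the maximum principle is run on the
  set U where |F| exp ((1 - \<epsilon>) g) exceeds its intended bound. The loss \<epsilon> keeps U
  bounded, and the margin \<delta> keeps its closure away from K. At infinity the resulting bound on
  |F| exp g reads A / t \<le> sqrt (pi A).\<close>

theorem measure_le_greens_function:
  assumes K: "compact K" and g: "greens_function g K t"
  shows "measure lborel K \<le> pi * t\<^sup>2"
proof (cases "measure lborel K = 0")
  case False
  define A where "A = measure lborel K"
  have A: "A > 0" using False by (simp add: A_def zero_less_measure_iff)
  let ?F = "cauchy_transform K"
  have oK: "open (- K)" using K by (simp add: compact_imp_closed open_Compl)
  have hF: "?F holomorphic_on - K" by (rule holomorphic_cauchy_transform[OF K])
  have cF: "continuous_on (- K) ?F" using hF by (rule holomorphic_on_imp_continuous_on)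
  have t: "t > 0" and gc: "continuous_on UNIV g" and g0: "\<And>z. z \<in> K \<Longrightarrow> g z = 0"
    and gh: "harmonic_on g (- K)" and glim: "((\<lambda>z. g z - (ln (norm z) - ln t)) \<longlongrightarrow> 0) at_infinity"
    using g by (auto simp: greens_function_def)
  have gn: "g z \<ge> 0" for z by (rule greens_function_nonneg[OF K g])
  have AB: "norm (?F z) \<le> sqrt (pi * A)" if "z \<notin> K" for z
    using ahlfors_beurling[OF K _ that] A by (simp add: A_def)
  have Flim: "((\<lambda>z. z * ?F z) \<longlongrightarrow> - of_real A) at_infinity"
    using cauchy_transform_at_infinity[OF K] by (simp add: A_def)
  have nFlim: "((\<lambda>z. norm (z * ?F z)) \<longlongrightarrow> A) at_infinity"
    using tendsto_norm[OF Flim] A by simp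
  have main: "norm (?F z) * exp ((1 - \<epsilon>) * g z) \<le> exp \<delta> * sqrt (pi * A)"
    if \<epsilon>: "0 < \<epsilon>" "\<epsilon> < 1" and \<delta>: "\<delta> > 0" and z: "z \<notin> K" for \<epsilon> \<delta> z
  proof (rule ccontr)
    assume neg: "\<not> ?thesis"
    define C where "C = exp \<delta> * sqrt (pi * A)"
    have C: "C > 0" using A by (simp add: C_def)
    define m where "m = (\<lambda>z. norm (?F z) * exp ((1 - \<epsilon>) * g z))"
    have cm: "continuous_on (- K) m"
      unfolding m_def by (intro continuous_intros cF continuous_on_subset[OF gc]) auto
    \<comment> \<open>F has no zeros on the closure of U because m \<ge> C > 0 there, so ln |F| is
      harmonic on U. On the frontier m = C, so the maximum principle forces m \<le> C inside
      U.\<close>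
    define U where "U = - K \<inter> m -` {C<..}"
    have oU: "open U" unfolding U_def by (rule continuous_open_preimage[OF cm oK]) auto
    have zU: "z \<in> U" using neg z by (simp add: U_def m_def C_def)
    have "\<forall>\<^sub>F z in at_infinity. m z \<le> C"
    proof -
      have "\<forall>\<^sub>F z in at_infinity. norm (z * ?F z) < A + 1"
        using order_tendstoD(2)[OF nFlim, of "A + 1"] by simp
      moreover have "\<forall>\<^sub>F z in at_infinity. \<bar>g z - (ln (norm z) - ln t)\<bar> < 1"
        using tendstoD[OF glim, of 1] by (simp add: dist_real_def)
      moreover have "\<forall>\<^sub>F z::complex in at_infinity. ln (norm z) \<ge> (ln (A + 1) + \<bar>ln t\<bar> + 1 - ln C) / \<epsilon>"
        using filterlim_ln_norm_at_top unfolding filterlim_at_top by blast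
      moreover have "\<forall>\<^sub>F z::complex in at_infinity. z \<noteq> 0"
        by (auto simp: eventually_at_infinity intro!: exI[of _ 1])
      ultimately show ?thesis
      proof eventually_elim
        case (elim z)
        show "m z \<le> C"
        proof (cases "?F z = 0")
          case False
          have "norm z > 0" using elim by simp
          have "ln (norm z) + ln (norm (?F z)) = ln (norm (z * ?F z))"
            using False elim by (simp add: norm_mult ln_mult)
          also have "\<dots> \<le> ln (A + 1)" using elim(1,4) False A by (subst ln_le_cancel_iff) auto
          finally have 1: "ln (norm (?F z)) \<le> ln (A + 1) - ln (norm z)" by simp
          have "(1 - \<epsilon>) * g z \<le> (1 - \<epsilon>) * (ln (norm z) + (\<bar>ln t\<bar> + 1))"
            using elim(2) \<epsilon> by (intro mult_left_mono) auto
          also have "\<dots> = (1 - \<epsilon>) * ln (norm z) + (1 - \<epsilon>) * (\<bar>ln t\<bar> + 1)" by (simp add: algebra_simps)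
          also have "(1 - \<epsilon>) * (\<bar>ln t\<bar> + 1) \<le> 1 * (\<bar>ln t\<bar> + 1)"
            using \<epsilon> by (intro mult_right_mono) auto
          finally have 2: "(1 - \<epsilon>) * g z \<le> ln (norm z) - \<epsilon> * ln (norm z) + \<bar>ln t\<bar> + 1"
            by (simp add: algebra_simps)
          have 3: "ln (A + 1) + \<bar>ln t\<bar> + 1 - ln C \<le> \<epsilon> * ln (norm z)"
            using elim(3) \<epsilon> by (simp add: field_simps)
          have "m z = exp (ln (norm (?F z)) + (1 - \<epsilon>) * g z)"
            using False by (simp add: m_def exp_add)
          also have "\<dots> \<le> exp (ln C)" using 1 2 3 by (subst exp_le_cancel_iff) linarith
          finally show ?thesis using C by simp
        qed (use C in \<open>auto simp: m_def\<close>)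
      qed
    qed
    then obtain b where b: "\<And>z. norm z \<ge> b \<Longrightarrow> m z \<le> C" unfolding eventually_at_infinity by blast
    have bU: "bounded U"
    proof (rule boundedI[of _ b], rule ccontr)
      fix w assume "w \<in> U" "\<not> norm w \<le> b"
      then show False using b[of w] by (simp add: U_def)
    qed
    \<comment> \<open>As |F| is at most sqrt (pi A), exceeding C leaves a factor of at least exp
      \<delta> for the exponential. The inequality survives on the closure, whereas g = 0 on
      K.\<close>
    have Ug: "(1 - \<epsilon>) * g w \<ge> \<delta>" if "w \<in> U" for w
    proof (rule ccontr)
      assume "\<not> ?thesis"
      then have "exp ((1 - \<epsilon>) * g w) \<le> exp \<delta>" by simp
      then have "m w \<le> sqrt (pi * A) * exp \<delta>"
        unfolding m_def using AB[of w] that A by (intro mult_mono) (auto simp: U_def)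
      then show False using that by (simp add: U_def C_def mult.commute)
    qed
    have "closed {w. \<delta> \<le> (1 - \<epsilon>) * g w}"
      by (intro closed_Collect_le continuous_intros gc)
    then have clg: "closure U \<subseteq> {w. \<delta> \<le> (1 - \<epsilon>) * g w}"
      by (rule closure_minimal[rotated]) (use Ug in auto)
    then have clK: "closure U \<subseteq> - K" using g0 \<delta> by force
    have cmU: "continuous_on (closure U) m" by (rule continuous_on_subset[OF cm clK])
    have clm: "m ` closure U \<subseteq> {C..}"
      by (rule image_closure_subset[OF cmU]) (auto simp: U_def)
    have nz: "?F w \<noteq> 0" if "w \<in> closure U" for w
      using clm that C by (force simp: m_def)
    have u: "ln (norm (?F w)) + (1 - \<epsilon>) * g w = ln (m w)" if "w \<in> closure U" for w
      using nz[OF that] by (simp add: m_def ln_mult)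
    have "ln (norm (?F z)) + (1 - \<epsilon>) * g z \<le> ln C"
    proof (rule harmonic_max_principle[OF bU _ _ _ zU])
      show "continuous_on (closure U) (\<lambda>z. ln (norm (?F z)) + (1 - \<epsilon>) * g z)"
        using nz by (intro continuous_intros continuous_on_subset[OF cF clK] continuous_on_subset[OF gc]) auto
      show "harmonic_on (\<lambda>z. ln (norm (?F z)) + (1 - \<epsilon>) * g z) U"
      proof (intro harmonic_on_add harmonic_on_ln_norm harmonic_on_cmult)
        show "?F holomorphic_on U" by (rule holomorphic_on_subset[OF hF]) (auto simp: U_def)
        show "harmonic_on g U" by (rule harmonic_on_subset[OF gh oU]) (auto simp: U_def)
        show "?F w \<noteq> 0" if "w \<in> U" for w using nz that closure_subset[of U] by auto
      qed (rule oU)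
      fix w assume w: "w \<in> frontier U"
      then have wc: "w \<in> closure U" "w \<notin> U" using oU by (auto simp: frontier_def interior_open)
      then have "m w \<le> C" "m w \<ge> C" using clK clm by (auto simp: U_def)
      then show "ln (norm (?F w)) + (1 - \<epsilon>) * g w \<le> ln C" using u[OF wc(1)] by simp
    qed
    moreover have zc: "z \<in> closure U" using zU closure_subset by (rule subsetD[rotated])
    ultimately have "ln (m z) \<le> ln C" using u[OF zc] by simp
    moreover have "m z > C" using zU by (simp add: U_def)
    ultimately show False using C by simp
  qed
  have lim1: "norm (?F z) * exp (g z) \<le> sqrt (pi * A)" if z: "z \<notin> K" for z
  proof -
    have "((\<lambda>\<epsilon>. norm (?F z) * exp ((1 - \<epsilon>) * g z)) \<longlongrightarrow> norm (?F z) * exp ((1 - 0) * g z)) (at_right 0)"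
      by (intro tendsto_intros)
    moreover have "((\<lambda>\<epsilon>. exp \<epsilon> * sqrt (pi * A)) \<longlongrightarrow> exp 0 * sqrt (pi * A)) (at_right 0)"
      by (intro tendsto_intros)
    moreover have "\<forall>\<^sub>F \<epsilon> in at_right 0. norm (?F z) * exp ((1 - \<epsilon>) * g z) \<le> exp \<epsilon> * sqrt (pi * A)"
      unfolding eventually_at_right_field using main z by (intro exI[of _ 1]) auto
    ultimately show ?thesis using tendsto_le[of "at_right (0::real)"] by fastforce
  qed
  \<comment> \<open>This is |F z| exp (g z) rewritten for z off K and nonzero, so that the limits of
    z F z and of g - ln |z| + ln t can be inserted.\<close>
  have "((\<lambda>z. norm (z * ?F z) * (exp (g z - (ln (norm z) - ln t)) / t)) \<longlongrightarrow> A * (exp 0 / t)) at_infinity"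
    by (intro tendsto_intros nFlim glim) (use t in auto)
  moreover have "\<forall>\<^sub>F z in at_infinity. norm (z * ?F z) * (exp (g z - (ln (norm z) - ln t)) / t) \<le> sqrt (pi * A)"
  proof -
    obtain B where B: "\<And>z. z \<in> K \<Longrightarrow> norm z \<le> B" using compact_imp_bounded[OF K] unfolding bounded_iff by blast
    show ?thesis unfolding eventually_at_infinity
    proof (intro exI[of _ "max B 0 + 1"] allI impI)
      fix z :: complex assume z: "max B 0 + 1 \<le> norm z"
      then have zK: "z \<notin> K" using B[of z] by auto
      have "norm z > 0" using z by linarith
      then have "norm (z * ?F z) * (exp (g z - (ln (norm z) - ln t)) / t) = norm (?F z) * exp (g z)"
        using t by (simp add: norm_mult exp_diff exp_add field_simps)
      then show "norm (z * ?F z) * (exp (g z - (ln (norm z) - ln t)) / t) \<le> sqrt (pi * A)"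
        using lim1[OF zK] by simp
    qed
  qed
  ultimately have "A * (exp 0 / t) \<le> sqrt (pi * A)"
    by (rule tendsto_upperbound) (rule trivial_limit_at_infinity)
  then have "A \<le> sqrt (pi * A) * t" using t by (simp add: field_simps)
  then have "A\<^sup>2 \<le> (sqrt (pi * A) * t)\<^sup>2" using A by (intro power_mono) auto
  also have "\<dots> = A * (pi * t\<^sup>2)" using A by (simp add: power_mult_distrib)
  finally show ?thesis using A by (simp add: power2_eq_square A_def[symmetric])
qed simp

section \<open>Lemniscates and sublevel sets of polynomials\<close>

lemma greens_function_cball:
  assumes "s > 0"
  shows "greens_function (\<lambda>z. ln (max (norm z) s / s)) (cball 0 s) s"
  unfolding greens_function_def
proof (intro conjI ballI)
  have p: "max (norm z) s > 0" for z :: complex using assms by (simp add: less_max_iff_disj)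
  show "continuous_on UNIV (\<lambda>z::complex. ln (max (norm z) s / s))"
  proof -
    have "max (norm z) s / s \<noteq> 0" for z :: complex
      using p[of z] assms by (metis divide_eq_0_iff less_irrefl)
    then show ?thesis using assms by (intro continuous_intros) blast+
  qed
  show "ln (max (norm z) s / s) = 0" if "z \<in> cball 0 s" for z :: complex
    using that assms by (simp add: max_def)
  have "harmonic_on (\<lambda>z. ln (norm z) - ln s) (- cball 0 s)"
    using assms by (intro harmonic_on_diff harmonic_on_const harmonic_on_ln_norm holomorphic_intros)
      (auto intro: open_Compl)
  then show "harmonic_on (\<lambda>z. ln (max (norm z) s / s)) (- cball 0 s)"
    by (rule harmonic_on_cong) (use assms in \<open>auto simp: max_def ln_div\<close>)
  have "\<forall>\<^sub>F z::complex in at_infinity. 0 = ln (max (norm z) s / s) - (ln (norm z) - ln s)"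
    unfolding eventually_at_infinity using assms
    by (intro exI[of _ s]) (auto simp: max_def ln_div)
  then show "((\<lambda>z::complex. ln (max (norm z) s / s) - (ln (norm z) - ln s)) \<longlongrightarrow> 0) at_infinity"
    by (rule Lim_transform_eventually[OF tendsto_const])
qed (rule assms)

text \<open>The set is the preimage of a disc, so its Green's function is explicit and Area \<le> pi
  t^2 applies. The radius is sqrt \<tau> because \<tau> will be a level of |q|^2.\<close>

theorem polya_area_inequality:
  fixes q :: "complex poly"
  assumes m: "degree q = m" "m \<ge> 1" and \<tau>: "\<tau> > 0"
  shows "measure lborel (poly q -` cball 0 (sqrt \<tau>)) \<le> pi * (\<tau> / (norm (lead_coeff q))\<^sup>2) powr (1 / m)"
proof -
  let ?b = "norm (lead_coeff q)"
  have b: "?b > 0" using m by auto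
  have s: "sqrt \<tau> > 0" using \<tau> by simp
  have "measure lborel (poly q -` cball 0 (sqrt \<tau>)) \<le> pi * ((sqrt \<tau> / ?b) powr (1 / m))\<^sup>2"
    by (rule measure_le_greens_function[OF compact_poly_vimage
          greens_function_poly_vimage[OF m _ greens_function_cball[OF s]]]) (use m in auto)
  also have "((sqrt \<tau> / ?b) powr (1 / m))\<^sup>2 = ((sqrt \<tau> / ?b) * (sqrt \<tau> / ?b)) powr (1 / m)"
    using s b by (subst powr_mult) (auto simp: power2_eq_square)
  also have "(sqrt \<tau> / ?b) * (sqrt \<tau> / ?b) = \<tau> / ?b\<^sup>2" using \<tau> by (simp add: power2_eq_square)
  finally show ?thesis .
qed

text \<open>By Polya's inequality the sublevel sets of \<open>q\<close> are no larger than those of \<open>b z^m\<close>, so the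
  integral is at least that of \<open>\<bar>b z^m\<bar>^2\<close> over the centred disc with the area of \<open>E\<close>.\<close>

theorem poly_square_integral_ge:
  fixes q :: "complex poly"
  assumes m: "degree q = m" "q \<noteq> 0" and E: "compact E"
  shows "ennreal ((norm (lead_coeff q))\<^sup>2 * pi * (measure lborel E / pi) ^ (m + 1) / (m + 1))
    \<le> (\<integral>\<^sup>+ z. ennreal ((norm (poly q z))\<^sup>2) * indicator E z \<partial>lborel)"
proof -
  define A where "A = measure lborel E"
  define B where "B = (norm (lead_coeff q))\<^sup>2"
  define r where "r = A / pi"
  have "lead_coeff q \<noteq> 0" using m(2) by (rule leading_coeff_neq_0)
  then have B: "B > 0" by (simp add: B_def)
  have r: "r \<ge> 0" and Ar: "A = pi * r" by (simp_all add: r_def A_def)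
  have Eb: "E \<in> sets borel" using E by (simp add: borel_compact)
  \<comment> \<open>The exponent 1 / m requires m \<ge> 1; for constant q the claim is an equality,
    and for a null set E it is trivial.\<close>
  consider "m = 0" | "r = 0" | "m \<ge> 1" "r > 0" using r by linarith
  then show ?thesis
  proof cases
    case 1
    then obtain b where q: "q = [:b:]" using m by (metis degree_eq_zeroE)
    have "(\<integral>\<^sup>+ z. ennreal ((norm (poly q z))\<^sup>2) * indicator E z \<partial>lborel) = ennreal ((norm b)\<^sup>2) * emeasure lborel E"
      using Eb by (simp add: q nn_integral_cmult)
    also have "\<dots> = ennreal ((norm b)\<^sup>2 * A)"
      by (simp add: emeasure_lborel_compact[OF E] A_def ennreal_mult)
    finally show ?thesis using 1 by (simp add: q A_def)
  next
    case 2
    then show ?thesis by (simp add: r_def A_def)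
  next
    case 3
    have hm: "(\<lambda>z. (norm (poly q z))\<^sup>2 * indicator E z) \<in> borel_measurable borel"
    proof (rule borel_measurable_times)
      show "(\<lambda>z. (norm (poly q z))\<^sup>2) \<in> borel_measurable borel"
        by (intro borel_measurable_continuous_onI continuous_intros)
    qed (use Eb in auto)
    \<comment> \<open>For \<tau> > 0, f \<tau> is a lower bound for the area of the part of E where
      |q|^2 > \<tau>, by Polya's inequality. T is the level at which this bound reaches 0, and F is
      an antiderivative of f.\<close>
    define T where "T = B * r ^ m"
    define f where "f = (\<lambda>\<tau>. A - pi * (\<tau> / B) powr (1 / m))"
    define F where "F = (\<lambda>\<tau>. A * \<tau> - pi * B * (\<tau> / B) powr (1 + 1 / m) / (1 + 1 / m))"
    have T: "T > 0" using B 3 by (simp add: T_def)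
    have rm: "(r ^ m) powr (1 / m) = r"
      using 3 by (simp add: powr_powr flip: powr_realpow)
    have f0: "f \<tau> \<ge> 0" if "\<tau> \<in> {0..T}" for \<tau>
    proof -
      have "(\<tau> / B) powr (1 / m) \<le> (r ^ m) powr (1 / m)"
        using that B by (intro powr_mono2) (auto simp: T_def field_simps)
      then show ?thesis using rm by (simp add: f_def Ar)
    qed
    have "(f has_integral F T - F 0) {0..T}"
    proof (rule fundamental_theorem_of_calculus_interior[where f = F and a = 0 and b = T])
      have m1: "1 + 1 / real m > 0" by (simp add: add_pos_nonneg)
      have "continuous_on {0..T} (\<lambda>\<tau>. (\<tau> / B) powr (1 + 1 / m))"
        by (rule continuous_on_powr') (use m1 B in \<open>auto intro!: continuous_intros\<close>)
      then show "continuous_on {0..T} F" unfolding F_def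
        using m1 by (intro continuous_on_diff continuous_on_divide continuous_on_mult continuous_on_const
            continuous_on_id) auto
      fix \<tau> assume "\<tau> \<in> {0<..<T}"
      then have \<tau>: "0 < \<tau>" "\<tau> < T" by auto
      have p: "((\<lambda>\<tau>. (\<tau> / B) powr (1 + 1 / m)) has_real_derivative
          ((1 + 1 / m) * (\<tau> / B) powr ((1 + 1 / m) - 1)) * (1 / B)) (at \<tau>)"
        by (rule DERIV_chain2[OF has_real_derivative_powr])
          (use \<tau> B in \<open>auto intro!: derivative_eq_intros\<close>)
      have m1: "1 + 1 / real m > 0" by (simp add: add_pos_nonneg)
      have "(F has_real_derivative A * 1 - pi * B * (((1 + 1 / m) * (\<tau> / B) powr ((1 + 1 / m) - 1)) * (1 / B)) / (1 + 1 / m)) (at \<tau>)"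
        unfolding F_def
        by (intro DERIV_diff DERIV_cmult DERIV_ident DERIV_cdivide p)
      also have "A * 1 - pi * B * (((1 + 1 / m) * (\<tau> / B) powr ((1 + 1 / m) - 1)) * (1 / B)) / (1 + 1 / m) = f \<tau>"
      proof -
        define c where "c = 1 + 1 / real m"
        have "pi * B * ((c * X) * (1 / B)) / c = pi * X" for X using m1 B by (simp add: c_def[symmetric])
        then show ?thesis unfolding f_def c_def by simp
      qed
      finally show "(F has_vector_derivative f \<tau>) (at \<tau>)"
        by (simp add: has_real_derivative_iff_has_vector_derivative)
    qed (use T in simp)
    moreover have "F T - F 0 = B * pi * r ^ (m + 1) / (m + 1)"
    proof -
      have "(r ^ m) powr (1 + 1 / m) = r ^ m * r"
        using 3 rm by (simp add: powr_add)
      moreover have "T / B = r ^ m" using B by (simp add: T_def)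
      ultimately have "F T = pi * r * (B * r ^ m) - pi * B * (r ^ m * r) / (1 + 1 / m)"
        by (simp add: F_def Ar T_def)
      also have "\<dots> = B * pi * r ^ (m + 1) * (1 - 1 / (1 + 1 / m))" by (simp add: algebra_simps)
      also have "1 - 1 / (1 + 1 / real m) = 1 / (m + 1)" using 3 by (simp add: field_simps)
      finally show ?thesis by (simp add: F_def)
    qed
    ultimately have "ennreal (B * pi * r ^ (m + 1) / (m + 1)) = (\<integral>\<^sup>+ \<tau>. ennreal (f \<tau>) * indicator {0..T} \<tau> \<partial>lborel)"
      using nn_integral_has_integral_lebesgue'[of "{0..T}" f] f0 by simp
    also have "\<dots> \<le> (\<integral>\<^sup>+ \<tau>. emeasure lborel {z\<in>space lborel. \<tau> < (norm (poly q z))\<^sup>2 * indicator E z} * indicator {0..} \<tau> \<partial>lborel)"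
    proof (rule nn_integral_mono_AE)
      \<comment> \<open>Polya's inequality is available for \<tau> > 0, so the level 0 is discarded
        as a null set.\<close>
      have "AE \<tau> in lborel. \<tau> \<noteq> (0::real)" by (rule AE_lborel_singleton)
      then show "AE \<tau> in lborel. ennreal (f \<tau>) * indicator {0..T} \<tau> \<le>
        emeasure lborel {z\<in>space lborel. \<tau> < (norm (poly q z))\<^sup>2 * indicator E z} * indicator {0..} \<tau>"
      proof eventually_elim
        case (elim \<tau>)
        show ?case
        proof (cases "\<tau> \<in> {0..T}")
          case True
          then have \<tau>: "\<tau> > 0" using elim by simp
          let ?C = "poly q -` cball 0 (sqrt \<tau>)"
          have C: "compact ?C" by (rule compact_poly_vimage) (use m 3 in auto)
          have "E - ?C \<subseteq> {z\<in>space lborel. \<tau> < (norm (poly q z))\<^sup>2 * indicator E z}"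
          proof
            fix z assume "z \<in> E - ?C"
            then have "z \<in> E" "sqrt \<tau> < norm (poly q z)" by auto
            then have "(sqrt \<tau>)\<^sup>2 < (norm (poly q z))\<^sup>2" using \<tau> by (intro power_strict_mono) auto
            then show "z \<in> {z\<in>space lborel. \<tau> < (norm (poly q z))\<^sup>2 * indicator E z}" using \<tau> \<open>z \<in> E\<close> by simp
          qed
          then have "emeasure lborel (E - ?C) \<le> emeasure lborel {z\<in>space lborel. \<tau> < (norm (poly q z))\<^sup>2 * indicator E z}"
            using hm borel_measurable_iff_greater[of _ "borel :: complex measure"]
            by (intro emeasure_mono) simp_all
          moreover have "ennreal (f \<tau>) \<le> emeasure lborel (E - ?C)"
          proof -
            have "f \<tau> \<le> A - measure lborel ?C"
              using polya_area_inequality[OF m(1) 3(1) \<tau>] by (simp add: f_def B_def)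
            then have "ennreal (f \<tau>) \<le> ennreal A - ennreal (measure lborel ?C)"
              by (simp add: ennreal_minus ennreal_leI)
            also have "\<dots> = emeasure lborel E - emeasure lborel ?C"
              by (simp add: emeasure_lborel_compact[OF E] emeasure_lborel_compact[OF C] A_def)
            also have "\<dots> \<le> emeasure lborel (E - ?C)"
            proof -
              have "emeasure lborel E \<le> emeasure lborel ((E - ?C) \<union> ?C)"
                using Eb C by (intro emeasure_mono) (auto simp: borel_compact)
              also have "\<dots> \<le> emeasure lborel (E - ?C) + emeasure lborel ?C"
                using Eb C by (intro emeasure_subadditive) (auto simp: borel_compact)
              finally show ?thesis by (simp add: ennreal_minus_le_iff add.commute emeasure_lborel_compact[OF E])
            qed
            finally show ?thesis .
          qed
          ultimately show ?thesis using True by (auto simp: indicator_def intro: order_trans)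
        qed simp
      qed
    qed
    also have "\<dots> = (\<integral>\<^sup>+ z. ennreal ((norm (poly q z))\<^sup>2 * indicator E z) \<partial>lborel)"
      by (rule nn_integral_layer_cake[symmetric])
        (use hm in \<open>auto intro: sigma_finite_lborel\<close>)
    also have "\<dots> = (\<integral>\<^sup>+ z. ennreal ((norm (poly q z))\<^sup>2) * indicator E z \<partial>lborel)"
      by (intro nn_integral_cong) (auto simp: indicator_def)
    finally show ?thesis by (simp add: A_def B_def r_def)
  qed
qed

subsection \<open>Area of polynomial preimages\<close>

text \<open>The Jacobian formula is stated in terms of determinants of matrices, hence on
  \<open>real ^ 2\<close>; this pair of maps carries sets, measures and derivatives between there
  and the complex plane.\<close>

definition complex_of_vec :: "real ^ 2 \<Rightarrow> complex" where
  "complex_of_vec v = Complex (v $ 1) (v $ 2)"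

definition vec_of_complex :: "complex \<Rightarrow> real ^ 2" where
  "vec_of_complex z = (\<chi> i. if i = 1 then Re z else Im z)"

lemma vec_of_complex_nth [simp]: "vec_of_complex z $ 1 = Re z" "vec_of_complex z $ 2 = Im z"
  by (auto simp: vec_of_complex_def)

lemma complex_of_vec_inverse [simp]:
  "complex_of_vec (vec_of_complex z) = z" "vec_of_complex (complex_of_vec v) = v"
  by (auto simp: complex_of_vec_def vec_eq_iff forall_2)

lemma linear_complex_of_vec: "linear complex_of_vec"
  by (rule linearI) (auto simp: complex_of_vec_def complex_eq_iff)

lemma linear_vec_of_complex: "linear vec_of_complex"
  by (rule linearI) (auto simp: vec_eq_iff forall_2)

lemma measurable_complex_of_vec [measurable]: "complex_of_vec \<in> borel_measurable borel"
  by (intro borel_measurable_continuous_onI linear_continuous_on linear_linear[THEN iffD2] linear_complex_of_vec)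

text \<open>Lebesgue measure is determined by its values on boxes, and boxes correspond to boxes
  with the same side lengths.\<close>

lemma distr_complex_of_vec: "distr lborel borel complex_of_vec = lborel"
proof (rule lborel_eqI[symmetric])
  fix l u :: complex assume le: "\<And>b. b \<in> Basis \<Longrightarrow> l \<bullet> b \<le> u \<bullet> b"
  have lu: "Re l \<le> Re u" "Im l \<le> Im u" using le[of 1] le[of \<i>] by (auto simp: Basis_complex_def inner_complex_def)
  have "complex_of_vec -` box l u = box (vec_of_complex l) (vec_of_complex u)"
    by (auto simp: complex_of_vec_def in_box_complex_iff mem_box_cart forall_2)
  then have "emeasure (distr lborel borel complex_of_vec) (box l u) = emeasure lborel (box (vec_of_complex l) (vec_of_complex u))"
    by (subst emeasure_distr) auto
  also have "\<dots> = ennreal (\<Prod>b\<in>Basis. (vec_of_complex u - vec_of_complex l) \<bullet> b)"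
    using lu by (intro emeasure_lborel_box) (auto simp: Basis_vec_def inner_axis forall_2 vec_of_complex_def)
  also have "(\<Prod>b\<in>Basis. (vec_of_complex u - vec_of_complex l) \<bullet> b) = (Re u - Re l) * (Im u - Im l)"
  proof -
    have B: "(Basis :: (real ^ 2) set) = {axis 1 1, axis 2 1}" by (auto simp: Basis_vec_def UNIV_2)
    have "axis 1 1 \<noteq> (axis 2 1 :: real ^ 2)" by (simp add: axis_eq_axis)
    then show ?thesis unfolding B by (simp add: inner_axis)
  qed
  also have "\<dots> = (\<Prod>b\<in>Basis. (u - l) \<bullet> b)" by (simp add: Basis_complex_def inner_complex_def)
  finally show "emeasure (distr lborel borel complex_of_vec) (box l u) = ennreal (\<Prod>b\<in>Basis. (u - l) \<bullet> b)" .
qed simp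

lemma det_complex_mult:
  "det (matrix (\<lambda>v. vec_of_complex (c * complex_of_vec v))) = (norm c)\<^sup>2"
  unfolding det_2 cmod_power2
  by (simp add: matrix_def complex_of_vec_def axis_def power2_eq_square)

text \<open>An injective holomorphic map has a holomorphic inverse on its open image, and the image
  of S is the preimage of S under that inverse.\<close>

lemma borel_injective_holomorphic_image:
  assumes F: "F holomorphic_on B" "open B" "inj_on F B" and S: "S \<in> sets borel" "S \<subseteq> B"
  shows "F ` S \<in> sets borel"
proof -
  obtain g where g: "g holomorphic_on (F ` B)" "\<And>z. z \<in> B \<Longrightarrow> g (F z) = z"
    using holomorphic_has_inverse[OF F] by metis
  have oFB: "open (F ` B)" by (rule open_mapping_thm3[OF F])
  have "g \<in> borel_measurable (restrict_space borel (F ` B))"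
    by (rule borel_measurable_continuous_on_restrict[OF holomorphic_on_imp_continuous_on[OF g(1)]])
  from measurable_sets[OF this S(1)]
  have "g -` S \<inter> F ` B \<in> sets borel"
    using oFB by (simp add: space_restrict_space sets_restrict_space_iff)
  also have "g -` S \<inter> F ` B = F ` S" using S(2) g(2) by force
  finally show ?thesis .
qed

text \<open>Change of variables with the real Jacobian |F'|^2. The compact set L provides
  integrability and a bounded image, so that the identity between real integrals and measures
  carries over to \<open>ennreal\<close>.\<close>

lemma emeasure_injective_holomorphic_image:
  assumes F: "F holomorphic_on B" "open B" "inj_on F B" and S: "S \<in> sets borel" "S \<subseteq> B"
    and L: "compact L" "S \<subseteq> L" "continuous_on L F" "continuous_on UNIV F'"
    and F': "\<And>z. z \<in> S \<Longrightarrow> (F has_field_derivative F' z) (at z)"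
  shows "(\<integral>\<^sup>+ z. ennreal ((norm (F' z))\<^sup>2) * indicator S z \<partial>lborel) = emeasure lborel (F ` S)"
proof -
  define S' where "S' = complex_of_vec -` S"
  define G where "G = (\<lambda>v. vec_of_complex (F (complex_of_vec v)))"
  define G' where "G' = (\<lambda>x v. vec_of_complex (F' (complex_of_vec x) * complex_of_vec v))"
  have S'b: "S' \<in> sets borel"
    unfolding S'_def using measurable_sets[OF measurable_complex_of_vec S(1)] by simp
  then have S'l: "S' \<in> sets lebesgue" by simp
  have blv: "bounded_linear complex_of_vec" "bounded_linear vec_of_complex"
    using linear_complex_of_vec linear_vec_of_complex by (simp_all add: linear_conv_bounded_linear)
  have det: "\<bar>det (matrix (G' x))\<bar> = (norm (F' (complex_of_vec x)))\<^sup>2" for x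
    unfolding G'_def det_complex_mult by simp
  let ?f = "\<lambda>x. (norm (F' (complex_of_vec x)))\<^sup>2"
  have cf: "continuous_on UNIV ?f"
    by (intro continuous_intros continuous_on_compose2[OF L(4)] linear_continuous_on blv) auto
  have L': "compact (vec_of_complex ` L)"
    by (intro compact_continuous_image L(1) linear_continuous_on blv)
  have S'L: "S' \<subseteq> vec_of_complex ` L"
    using L(2) unfolding S'_def by (metis (no_types, lifting) complex_of_vec_inverse(2) image_eqI subsetD subsetI vimageD)
  have int: "?f integrable_on S'"
  proof -
    have "integrable lborel (\<lambda>x. indicator (vec_of_complex ` L) x *\<^sub>R ?f x)"
      by (rule borel_integrable_compact[OF L' continuous_on_subset[OF cf]]) auto
    then have "?f absolutely_integrable_on (vec_of_complex ` L)"
      unfolding set_integrable_def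
      using integrable_completion[OF borel_measurable_integrable] by blast
    then have "?f absolutely_integrable_on S'"
      by (rule set_integrable_subset) (use S'l S'L in auto)
    then show ?thesis by (simp add: absolutely_integrable_on_def)
  qed
  have GS: "measure lebesgue (G ` S') = integral S' ?f"
  proof -
    have "measure lebesgue (G ` S') = integral S' (\<lambda>x. \<bar>det (matrix (G' x))\<bar>)"
    proof (rule measure_differentiable_image_eq[OF S'l])
      show "(G has_derivative G' x) (at x within S')" if "x \<in> S'" for x
      proof -
        have "complex_of_vec x \<in> S" using that by (simp add: S'_def)
        then have "(F has_derivative (\<lambda>h. F' (complex_of_vec x) * h)) (at (complex_of_vec x))"
          using F' by (simp add: has_field_derivative_def)
        then have "((\<lambda>v. F (complex_of_vec v)) has_derivative (\<lambda>h. F' (complex_of_vec x) * complex_of_vec h)) (at x)"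
          by (rule has_derivative_compose[OF bounded_linear_imp_has_derivative[OF blv(1)]])
        from bounded_linear.has_derivative[OF blv(2) this]
        have "(G has_derivative G' x) (at x)" by (simp add: G_def G'_def)
        then show ?thesis by (rule has_derivative_at_withinI)
      qed
      show "inj_on G S'"
      proof (rule inj_onI)
        fix x y assume xy: "x \<in> S'" "y \<in> S'" "G x = G y"
        then have "F (complex_of_vec x) = F (complex_of_vec y)" unfolding G_def by (metis complex_of_vec_inverse(1))
        moreover have "complex_of_vec x \<in> B" "complex_of_vec y \<in> B" using xy S(2) by (auto simp: S'_def)
        ultimately have "complex_of_vec x = complex_of_vec y" using F(3) by (simp add: inj_on_eq_iff)
        then show "x = y" by (metis complex_of_vec_inverse(2))
      qed
    qed (use int in \<open>simp add: det\<close>)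
    then show ?thesis by (simp add: det)
  qed
  have FSb: "F ` S \<in> sets borel" by (rule borel_injective_holomorphic_image[OF F S])
  have GF: "G ` S' = complex_of_vec -` (F ` S)"
  proof (intro set_eqI iffI)
    fix v assume "v \<in> complex_of_vec -` (F ` S)"
    then obtain z where z: "z \<in> S" "complex_of_vec v = F z" by auto
    then have "v = G (vec_of_complex z)" "vec_of_complex z \<in> S'"
      by (simp_all add: G_def S'_def flip: z(2))
    then show "v \<in> G ` S'" by blast
  qed (auto simp: G_def S'_def)
  have GSb: "G ` S' \<in> sets borel"
    unfolding GF using measurable_sets[OF measurable_complex_of_vec FSb] by simp
  have "bounded (F ` S)"
    by (rule bounded_subset[OF compact_imp_bounded[OF compact_continuous_image[OF L(3,1)]]]) (use L(2) in auto)
  then have fin: "emeasure lborel (F ` S) < \<infinity>" by (rule emeasure_bounded_finite)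
  have eF: "emeasure lborel (F ` S) = emeasure lborel (G ` S')"
    unfolding GF distr_complex_of_vec[symmetric]
    by (subst emeasure_distr[OF _ FSb]) (auto simp: distr_complex_of_vec)
  have "(\<integral>\<^sup>+ z. ennreal ((norm (F' z))\<^sup>2) * indicator S z \<partial>lborel)
      = (\<integral>\<^sup>+ v. ennreal (?f v) * indicator S' v \<partial>lborel)"
  proof -
    have "(\<lambda>z. ennreal ((norm (F' z))\<^sup>2) * indicator S z) \<in> borel_measurable borel"
    proof (intro borel_measurable_times_ennreal borel_measurable_indicator S(1)
        measurable_compose[OF _ measurable_ennreal])
      show "(\<lambda>z. (norm (F' z))\<^sup>2) \<in> borel_measurable borel"
        by (intro borel_measurable_continuous_onI continuous_intros L(4))
    qed
    then have "(\<integral>\<^sup>+ z. ennreal ((norm (F' z))\<^sup>2) * indicator S z \<partial>distr lborel borel complex_of_vec) =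
        (\<integral>\<^sup>+ v. ennreal (?f v) * indicator S (complex_of_vec v) \<partial>lborel)"
      by (intro nn_integral_distr) auto
    moreover have "indicator S (complex_of_vec v) = (indicator S' v :: ennreal)" for v
      by (simp add: S'_def indicator_def)
    ultimately show ?thesis by (simp add: distr_complex_of_vec)
  qed
  also have "\<dots> = ennreal (integral S' ?f)"
    by (rule nn_integral_has_integral_lebesgue'[OF _ integrable_integral[OF int]]) simp
  also have "\<dots> = ennreal (measure lborel (G ` S'))" using GS GSb by simp
  also have "\<dots> = emeasure lborel (F ` S)"
    using fin by (simp add: eF emeasure_eq_ennreal_measure)
  finally show ?thesis .
qed

text \<open>p is injective near each point where p' does not vanish, and by Lindelof countably many
  such neighbourhoods suffice.\<close>

lemma countable_injective_cover:
  fixes p :: "complex poly"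
  assumes "degree p \<ge> 1"
  shows "\<exists>B :: nat \<Rightarrow> complex set. (\<forall>k. open (B k) \<and> inj_on (poly p) (B k)) \<and>
           {z. poly (pderiv p) z \<noteq> 0} \<subseteq> (\<Union>k. B k)"
proof -
  let ?\<F> = "insert {} {B. open B \<and> inj_on (poly p) B}"
  have "\<And>S. S \<in> ?\<F> \<Longrightarrow> open S" by auto
  then obtain \<F>' where F': "\<F>' \<subseteq> ?\<F>" "countable \<F>'" "\<Union>\<F>' = \<Union>?\<F>" by (rule Lindelof)
  \<comment> \<open>Adding the empty set guarantees a nonempty family, which can be enumerated by
    all natural numbers.\<close>
  define B where "B = from_nat_into (insert {} \<F>')"
  have range: "range B = insert {} \<F>'"
    unfolding B_def using F'(2) by (intro range_from_nat_into) auto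
  have "open (B k) \<and> inj_on (poly p) (B k)" for k
  proof -
    have "B k \<in> insert {} \<F>'" using range by blast
    then show ?thesis using F'(1) by auto
  qed
  moreover have "{z. poly (pderiv p) z \<noteq> 0} \<subseteq> (\<Union>k. B k)"
  proof
    fix z assume "z \<in> {z. poly (pderiv p) z \<noteq> 0}"
    then have "deriv (poly p) z \<noteq> 0" using DERIV_imp_deriv[OF poly_DERIV[of p z]] by simp
    moreover have holp: "poly p holomorphic_on UNIV" by (auto intro!: holomorphic_intros)
    ultimately obtain r where r: "r > 0" "inj_on (poly p) (ball z r)"
      using has_complex_derivative_locally_injective[of "poly p" UNIV z]
      using holp by auto
    then have "z \<in> \<Union>?\<F>" by (intro UnionI[of "ball z r"]) auto
    then show "z \<in> (\<Union>k. B k)" using F'(3) range by auto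
  qed
  ultimately show ?thesis by blast
qed

text \<open>Cut the preimage into disjoint Borel pieces on which p is injective. The integral over a
  piece is the area of its image, and the images cover each point at most n times because points in
  different pieces are different roots of p - w.\<close>

theorem area_poly_vimage_multiplicity:
  fixes p :: "complex poly"
  assumes n: "degree p = n" "n \<ge> 1" and K: "compact K"
  shows "(\<integral>\<^sup>+ z. ennreal ((norm (poly (pderiv p) z))\<^sup>2) * indicator (poly p -` K) z \<partial>lborel)
    \<le> of_nat n * emeasure lborel K"
proof -
  define E where "E = poly p -` K"
  have E: "compact E" unfolding E_def by (rule compact_poly_vimage) (use n K in auto)
  then have Eb: "E \<in> sets borel" by (simp add: borel_compact)
  obtain B :: "nat \<Rightarrow> complex set" where B: "\<And>k. open (B k)" "\<And>k. inj_on (poly p) (B k)"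
    "{z. poly (pderiv p) z \<noteq> 0} \<subseteq> (\<Union>k. B k)"
    using countable_injective_cover[of p] n by blast
  define D where "D = (\<lambda>k. E \<inter> disjointed B k)"
  have "disjointed B k \<in> sets borel" for k
    unfolding disjointed_def using B(1) by (intro sets.Diff sets.finite_UN) auto
  then have Db: "D k \<in> sets borel" for k using Eb by (simp add: D_def)
  have DB: "D k \<subseteq> B k" for k using disjointed_subset[of B k] by (auto simp: D_def)
  have disj: "disjoint_family D"
    using disjoint_family_disjointed[of B] by (auto simp: D_def disjoint_family_on_def)
  have pDb: "poly p ` D k \<in> sets borel" for k
    by (rule borel_injective_holomorphic_image[OF _ B(1,2) Db DB]) (auto intro!: holomorphic_intros)
  have piece: "(\<integral>\<^sup>+ z. ennreal ((norm (poly (pderiv p) z))\<^sup>2) * indicator (D k) z \<partial>lborel) = emeasure lborel (poly p ` D k)" for k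
  proof (rule emeasure_injective_holomorphic_image[OF _ B(1,2) Db DB E])
    show "(poly p has_field_derivative poly (pderiv p) z) (at z)" for z by (rule poly_DERIV)
  qed (auto simp: D_def intro!: holomorphic_intros continuous_intros)
  have hm: "(\<lambda>z. (norm (poly (pderiv p) z))\<^sup>2) \<in> borel_measurable borel"
    by (intro borel_measurable_continuous_onI continuous_intros)
  have "(\<integral>\<^sup>+ z. ennreal ((norm (poly (pderiv p) z))\<^sup>2) * indicator E z \<partial>lborel)
      = (\<integral>\<^sup>+ z. (\<Sum>k. ennreal ((norm (poly (pderiv p) z))\<^sup>2) * indicator (D k) z) \<partial>lborel)"
  proof (rule nn_integral_cong)
    fix z
    have "(\<Sum>k. ennreal ((norm (poly (pderiv p) z))\<^sup>2) * indicator (D k) z) =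
        ennreal ((norm (poly (pderiv p) z))\<^sup>2) * indicator (\<Union>k. D k) z"
      by (simp add: ennreal_suminf_cmult suminf_indicator[OF disj])
    also have "\<dots> = ennreal ((norm (poly (pderiv p) z))\<^sup>2) * indicator E z"
    \<comment> \<open>The pieces may miss critical points of p, but the integrand vanishes
      there.\<close>
    proof (cases "poly (pderiv p) z = 0")
      case False
      then have "z \<in> (\<Union>k. disjointed B k)" using B(3) unfolding UN_disjointed_eq by blast
      then have "z \<in> (\<Union>k. D k) \<longleftrightarrow> z \<in> E" by (auto simp: D_def)
      then show ?thesis by (simp add: indicator_def)
    qed simp
    finally show "ennreal ((norm (poly (pderiv p) z))\<^sup>2) * indicator E z =
      (\<Sum>k. ennreal ((norm (poly (pderiv p) z))\<^sup>2) * indicator (D k) z)" by simp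
  qed
  also have "\<dots> = (\<Sum>k. \<integral>\<^sup>+ z. ennreal ((norm (poly (pderiv p) z))\<^sup>2) * indicator (D k) z \<partial>lborel)"
    using Db hm by (intro nn_integral_suminf borel_measurable_times_ennreal borel_measurable_indicator
        measurable_compose[OF _ measurable_ennreal]) auto
  also have "\<dots> = (\<Sum>k. emeasure lborel (poly p ` D k))" by (simp add: piece)
  also have "\<dots> = (\<Sum>k. \<integral>\<^sup>+ w. indicator (poly p ` D k) w \<partial>lborel)" using pDb by simp
  also have "\<dots> = (\<integral>\<^sup>+ w. (\<Sum>k. indicator (poly p ` D k) w) \<partial>lborel)"
    using pDb by (intro nn_integral_suminf[symmetric]) auto
  also have "\<dots> \<le> (\<integral>\<^sup>+ w. of_nat n * indicator K w \<partial>lborel)"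
  proof (rule nn_integral_mono)
    fix w
    have bound: "(\<Sum>k<N. indicator (poly p ` D k) w) \<le> (of_nat n * indicator K w :: ennreal)" for N
    proof (cases "w \<in> K")
      case True
      \<comment> \<open>Choosing a preimage of w in each of these pieces embeds the index set into
        the roots of p - w, of which there are at most n.\<close>
      let ?I = "{k. k < N \<and> w \<in> poly p ` D k}" and ?R = "{z. poly (p - [:w:]) z = 0}"
      have deg: "degree (p - [:w:]) \<le> n" using n(1) by (intro degree_diff_le) auto
      have nz: "p - [:w:] \<noteq> 0" using n by auto
      have "\<forall>k\<in>?I. \<exists>z. z \<in> D k \<and> poly p z = w" by auto
      then obtain z where z: "\<And>k. k \<in> ?I \<Longrightarrow> z k \<in> D k \<and> poly p (z k) = w" by metis
      have "inj_on z ?I"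
      proof (rule inj_onI)
        fix i j assume "i \<in> ?I" "j \<in> ?I" "z i = z j"
        then show "i = j" using z[of i] z[of j] disj by (auto simp: disjoint_family_on_def)
      qed
      moreover have "z ` ?I \<subseteq> ?R" using z by auto
      ultimately have "card ?I \<le> card ?R" by (rule card_inj_on_le[OF _ _ poly_roots_finite[OF nz]])
      also have "\<dots> \<le> n" using card_poly_roots_bound[OF nz] deg by linarith
      finally have "card ?I \<le> n" .
      moreover have "(\<Sum>k<N. indicator (poly p ` D k) w) = (of_nat (card ?I) :: ennreal)"
        by (simp add: indicator_def sum.If_cases lessThan_def Int_def of_bool_def)
      ultimately show ?thesis using True by simp
    next
      case False
      then have "w \<notin> poly p ` D k" for k by (auto simp: D_def E_def)
      then show ?thesis by simp
    qed
    show "(\<Sum>k. indicator (poly p ` D k) w) \<le> (of_nat n * indicator K w :: ennreal)"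
      unfolding suminf_eq_SUP by (rule SUP_least) (rule bound)
  qed
  also have "\<dots> = of_nat n * emeasure lborel K"
    using borel_compact[OF K] by (subst nn_integral_cmult) auto
  finally show ?thesis unfolding E_def .
qed

text \<open>p' has degree n - 1 and leading coefficient n times that of p. The lower bound thus
  carries n^2 / n = n, which cancels against the multiplicity n in the upper bound.\<close>

theorem area_poly_vimage_le:
  fixes p :: "complex poly"
  assumes n: "degree p = n" "n \<ge> 1" and K: "compact K"
  shows "(norm (lead_coeff p))\<^sup>2 * pi * (measure lborel (poly p -` K) / pi) ^ n \<le> measure lborel K"
proof -
  let ?E = "poly p -` K" and ?q = "pderiv p"
  have E: "compact ?E" by (rule compact_poly_vimage) (use n K in auto)
  have deg: "degree ?q = n - 1" using n by (simp add: degree_pderiv)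
  have q0: "?q \<noteq> 0" using n by (simp add: pderiv_eq_0_iff)
  have lc: "lead_coeff ?q = of_nat n * lead_coeff p" using deg n by (simp add: coeff_pderiv)
  have "ennreal ((norm (lead_coeff ?q))\<^sup>2 * pi * (measure lborel ?E / pi) ^ (n - 1 + 1) / real (n - 1 + 1))
    \<le> (\<integral>\<^sup>+ z. ennreal ((norm (poly ?q z))\<^sup>2) * indicator ?E z \<partial>lborel)"
    using poly_square_integral_ge[OF deg q0 E] by (simp only: of_nat_add of_nat_1)
  also have "\<dots> \<le> of_nat n * emeasure lborel K" by (rule area_poly_vimage_multiplicity[OF n K])
  also have "\<dots> = ennreal (n * measure lborel K)"
    by (simp add: emeasure_lborel_compact[OF K] ennreal_mult ennreal_of_nat_eq_real_of_nat)
  finally have "(norm (lead_coeff ?q))\<^sup>2 * pi * (measure lborel ?E / pi) ^ n / n \<le> n * measure lborel K"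
    using n by (subst (asm) ennreal_le_iff) auto
  then show ?thesis
    using n unfolding lc by (simp add: norm_mult power_mult_distrib field_simps power2_eq_square)
qed

subsection \<open>The roundness inequality\<close>

theorem theorem4:
  fixes p :: "complex poly" and n :: nat and K :: "complex set"
  assumes "degree p = n" and "n \<ge> 1" and "compact K"
  shows "roundness (poly p -` K) \<le> roundness K powr (1 / real n)"
proof -
  let ?E = "poly p -` K" and ?b = "norm (lead_coeff p)"
  have E: "compact ?E" by (rule compact_poly_vimage) (use assms in auto)
  have b: "?b > 0" using assms by auto
  have mK: "measure lebesgue K = measure lborel K" "measure lebesgue ?E = measure lborel ?E"
    using assms(3) E by (simp_all add: borel_compact)
  define A c A' c' where "A = measure lborel K" and "c = log_capacity K"
    and "A' = measure lborel ?E" and "c' = log_capacity ?E"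
  have nn: "A \<ge> 0" "A' \<ge> 0" by (simp_all add: A_def A'_def)
  have area: "?b\<^sup>2 * pi * (A' / pi) ^ n \<le> A"
    using area_poly_vimage_le[OF assms] by (simp add: A_def A'_def)
  show ?thesis
  proof (cases "A' = 0 \<or> c' = 0")
    \<comment> \<open>The left-hand side is 0 here, by x / 0 = 0 when the capacity vanishes, and
      \<open>powr\<close> is nonnegative.\<close>
    case True
    then show ?thesis by (auto simp: roundness_def mK A'_def[symmetric] c'_def[symmetric])
  next
    case False
    have "A' > 0" using False nn by simp
    then have "0 < ?b\<^sup>2 * pi * (A' / pi) ^ n" using b by (intro mult_pos_pos zero_less_power) auto
    then have "A > 0" using area by linarith
    then have K0: "K \<noteq> {}" by (auto simp: A_def)
    have E0: "?E \<noteq> {}" using \<open>A' > 0\<close> by (auto simp: A'_def)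
    have c: "c \<le> ?b * c' ^ n"
      unfolding c_def c'_def by (rule log_capacity_poly_vimage_ge[OF assms K0])
    have c'0: "c' > 0" using log_capacity_nonneg[OF E E0] False by (simp add: c'_def)
    \<comment> \<open>Otherwise the right-hand side would be 0 while the left is positive. A Green's
      function of K would make c positive; failing that, every J competing in the infimum contains K
      and so has t \<ge> sqrt (A / pi).\<close>
    have "c \<noteq> 0"
    proof
      assume "c = 0"
      have noG: "\<nexists>g t. greens_function g K t"
        using log_capacity_eq[OF assms(3)] \<open>c = 0\<close> unfolding c_def
        by (metis greens_function_def less_irrefl)
      let ?S = "{t. \<exists>J f. compact J \<and> K \<subseteq> J \<and> dirichlet_regular J \<and> greens_function f J t}"
      have "sqrt (A / pi) \<le> t" if tS: "t \<in> ?S" for t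
      proof -
        obtain J f where J: "compact J" "K \<subseteq> J" "greens_function f J t" using tS by blast
        have t: "t > 0" using J(3) by (simp add: greens_function_def)
        have "ennreal A \<le> ennreal (measure lborel J)"
          unfolding A_def emeasure_lborel_compact[OF assms(3), symmetric] emeasure_lborel_compact[OF J(1), symmetric]
          using J assms(3) by (intro emeasure_mono) (auto simp: borel_compact)
        then have "A \<le> measure lborel J" by (simp add: ennreal_le_iff)
        also have "\<dots> \<le> pi * t\<^sup>2" by (rule measure_le_greens_function[OF J(1,3)])
        finally have "A / pi \<le> t\<^sup>2" by (simp add: field_simps)
        then show ?thesis using t by (simp add: real_le_lsqrt)
      qed
      moreover have "?S \<noteq> {}" using regular_neighbourhood[OF assms(3) K0, of UNIV] by auto
      ultimately have "sqrt (A / pi) \<le> Inf ?S" by (intro cInf_greatest) auto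
      then have "sqrt (A / pi) \<le> c" unfolding c_def log_capacity_def if_not_P[OF noG] .
      moreover have "sqrt (A / pi) > 0" using \<open>A > 0\<close> by simp
      ultimately show False using \<open>c = 0\<close> by linarith
    qed
    then have c0: "c > 0" using log_capacity_nonneg[OF assms(3) K0] by (simp add: c_def)
    \<comment> \<open>The capacity bound replaces c by \<open>?b * c' ^ n\<close>. The powers of c'
      then cancel, and what is left is the area inequality.\<close>
    have "(A' / (pi * c'\<^sup>2)) ^ n \<le> A / (pi * c\<^sup>2)"
    proof -
      have "c\<^sup>2 \<le> (?b * c' ^ n)\<^sup>2" using c c0 by (intro power_mono) auto
      have "(A' / (pi * c'\<^sup>2)) ^ n * (pi * c\<^sup>2) \<le> (A' / (pi * c'\<^sup>2)) ^ n * (pi * (?b * c' ^ n)\<^sup>2)"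
        using \<open>c\<^sup>2 \<le> (?b * c' ^ n)\<^sup>2\<close> nn by (intro mult_left_mono) auto
      also have "\<dots> = ?b\<^sup>2 * pi * (A' / pi) ^ n"
      proof -
        have "(c'\<^sup>2) ^ n = (c' ^ n)\<^sup>2" by (simp add: mult.commute flip: power_mult)
        then have "(A' / (pi * c'\<^sup>2)) ^ n = (A' / pi) ^ n / (c' ^ n)\<^sup>2"
          by (simp add: power_divide power_mult_distrib)
        then show ?thesis using c'0 by (simp add: power_mult_distrib)
      qed
      also have "\<dots> \<le> A" by (rule area)
      finally show ?thesis using c0 by (simp add: field_simps)
    qed
    then have "((A' / (pi * c'\<^sup>2)) ^ n) powr (1 / n) \<le> (A / (pi * c\<^sup>2)) powr (1 / n)"
      using nn by (intro powr_mono2) auto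
    moreover have "(x ^ n) powr (1 / n) = x" if "x > 0" for x :: real
      using that assms(2) by (simp add: powr_powr flip: powr_realpow)
    then have "((A' / (pi * c'\<^sup>2)) ^ n) powr (1 / n) = A' / (pi * c'\<^sup>2)"
      using \<open>A' > 0\<close> c'0 by simp
    ultimately show ?thesis
      unfolding roundness_def mK A_def A'_def c_def c'_def by simp
  qed
qed

end
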